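(* Let $d\ge1$ and let $(U_n)_{n\ge0}$ be the infinite color urn model associated with the random walk on $S^d\subseteq\mathbb{R}^d$ with increments $\{X_i\}_{i\ge1}$. Let $\Lambda_n\in\mathcal{M}_1$ be the random probability measure on $\mathbb{R}^d$ corresponding to the random probability vector $\frac{U_n}{n+1}$. For $n\ge2$ let $$\Lambda_n^{cs}(A)=\Lambda_n\left(\sqrt{\log n}\,A\varSigma^{1/2}+\mu\log n\right),$$ where $A$ is a Borel subset of $\mathbb{R}^d$. Then, as $n\to\infty$, $\Lambda_n^{cs}\stackrel{p}{\longrightarrow}\Phi_d$ in $\mathcal{M}_1$.
   Context: Vectors are row vectors; $x^T$ denotes the transpose. $\{X_i\}_{i\ge1}$ are i.i.d. random vectors in $\mathbb{R}^d$ with finite non-empty support set $B\subseteq\mathbb{R}^d$ and probability mass function $p$. Let $$S^d:=\left\{\sum_{i=1}^kn_ib_i: k\ge1,\ n_1,\dots,n_k\in\{0,1,2,\dots\},\ b_1,\dots,b_k\in B\right\},$$ a countable subset of $\mathbb{R}^d$ which indexes the colors. Put $\mu:=\mathbb{E}[X_1]$ and $\varSigma:=\mathbb{E}[X_1^TX_1]$ (a non-centered second moment matrix), assumed positive definite; $\varSigma^{1/2}$ is its unique positive definite square root. Urn model: let $R=((p(v-u)))_{u,v\in S^d}$ and let $R_u$ be the $u$-th row of $R$. The initial configuration $U_0=(U_{0,v})_{v\in S^d}$ is a (non-random) probability vector with only finitely many non-zero entries. For $n\ge0$, the color $Z_n\in S^d$ of the $(n+1)$-th selected ball satisfies $\mathbb{P}(Z_n=v\mid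 U_n,\dots,U_0)=U_{n,v}/(n+1)$, $v\in S^d$, and $U_{n+1}=U_n+R_{Z_n}$, i.e. $U_{n+1,v}=U_{n,v}+p(v-Z_n)$. (So $\sum_vU_{n,v}=n+1$.) $\mathcal{M}_1$ is the space of probability measures on $\mathbb{R}^d$ with the topology of weak convergence; $\stackrel{p}{\longrightarrow}$ denotes convergence in probability (with respect to a metric metrizing this topology). For a set $A\subseteq\mathbb{R}^d$, a matrix $M$, a scalar $c$ and a vector $b$, $cAM+b=\{c\,aM+b:a\in A\}$. $\Phi_d$ is the standard Gaussian measure on $\mathbb{R}^d$. *)

theory Defs
  imports "HOL-Probability.Probability"
begin

text \<open>Nonnegative integer combinations of elements of \<open>B\<close>.\<close>

definition color_set :: "'v::real_vector set \<Rightarrow> 'v set" where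
  "color_set B = {(\<Sum>i=1..k. real (n i) *\<^sub>R b i) | (k::nat) (n::nat \<Rightarrow> nat) b.
                    k \<ge> 1 \<and> (\<forall>i\<in>{1..k}. b i \<in> B)}"

definition iid_increments ::
  "'b measure \<Rightarrow> (nat \<Rightarrow> 'b \<Rightarrow> real^'d::finite) \<Rightarrow> (real^'d) pmf \<Rightarrow> bool" where
  "iid_increments N X p \<longleftrightarrow>
     prob_space N \<and>
     prob_space.indep_vars N (\<lambda>_. borel) X {1..} \<and>
     (\<forall>i\<ge>1. \<forall>v. measure N {\<omega> \<in> space N. X i \<omega> = v} = pmf p v)"

text \<open>For a row vector \<open>x\<close>, the matrix \<open>x\<^sup>T x\<close> is \<open>columnvector x ** rowvector x\<close>.\<close>

definition second_moment_matrix ::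
  "'b measure \<Rightarrow> ('b \<Rightarrow> real^'d::finite) \<Rightarrow> real^'d^'d" where
  "second_moment_matrix N X =
     prob_space.expectation N
       (\<lambda>\<omega>. (columnvector (X \<omega>) :: real^1^'d) ** (rowvector (X \<omega>) :: real^'d^1))"

definition pos_definite :: "real^'d::finite^'d \<Rightarrow> bool" where
  "pos_definite A \<longleftrightarrow> transpose A = A \<and> (\<forall>x. x \<noteq> 0 \<longrightarrow> x \<bullet> (A *v x) > 0)"

definition matrix_sqrt :: "real^'d::finite^'d \<Rightarrow> real^'d^'d" where
  "matrix_sqrt A = (THE Q. pos_definite Q \<and> Q ** Q = A)"

text \<open>The sigma-algebra generated by \<open>U 0, \<dots>, U n\<close>, where each \<open>U m\<close> is a family of real
  random variables indexed by the colors in \<open>S\<close>.\<close>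

definition history ::
  "'a measure \<Rightarrow> 'c set \<Rightarrow> (nat \<Rightarrow> 'a \<Rightarrow> 'c \<Rightarrow> real) \<Rightarrow> nat \<Rightarrow> 'a measure" where
  "history M S U n =
     sigma (space M)
       {(\<lambda>\<omega>. U m \<omega> v) -` A \<inter> space M | m v A. m \<le> n \<and> v \<in> S \<and> A \<in> sets borel}"

text \<open>\<open>U n \<omega> v\<close> is meaningful only for colors \<open>v \<in> S\<close>; values at other points are not
  constrained and are never used. The initial probability vector is given as a \<open>pmf\<close>.\<close>

definition infinite_color_urn ::
  "'a measure \<Rightarrow> 'c::ab_group_add set \<Rightarrow> 'c pmf \<Rightarrow> 'c pmf \<Rightarrow>
     (nat \<Rightarrow> 'a \<Rightarrow> 'c \<Rightarrow> real) \<Rightarrow> (nat \<Rightarrow> 'a \<Rightarrow> 'c) \<Rightarrow> bool" where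
  "infinite_color_urn M S p u0 U Z \<longleftrightarrow>
     prob_space M \<and>
     set_pmf u0 \<subseteq> S \<and> finite (set_pmf u0) \<and>
     (\<forall>\<omega>\<in>space M. \<forall>v\<in>S. U 0 \<omega> v = pmf u0 v) \<and>
     (\<forall>n. Z n \<in> measurable M (count_space S)) \<and>
     (\<forall>n. \<forall>v\<in>S. AE \<omega> in M.
        real_cond_exp M (history M S U n) (indicator {\<omega> \<in> space M. Z n \<omega> = v}) \<omega>
          = U n \<omega> v / (real n + 1)) \<and>
     (\<forall>n. \<forall>\<omega>\<in>space M. \<forall>v\<in>S. U (Suc n) \<omega> v = U n \<omega> v + pmf p (v - Z n \<omega>))"

text \<open>The measure on Borel sets with mass \<open>U n \<omega> v / (n + 1)\<close> at each \<open>v \<in> S\<close>.\<close>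

definition urn_measure ::
  "'c::topological_space set \<Rightarrow> (nat \<Rightarrow> 'a \<Rightarrow> 'c \<Rightarrow> real) \<Rightarrow> nat \<Rightarrow> 'a \<Rightarrow> 'c measure" where
  "urn_measure S U n \<omega> =
     distr (density (count_space S) (\<lambda>v. ennreal (U n \<omega> v / (real n + 1)))) borel (\<lambda>v. v)"

text \<open>The set function \<open>A \<mapsto> P (c A Q + b)\<close> on Borel sets, with row vectors \<open>a \<in> A\<close>
  multiplied by \<open>Q\<close> from the right.\<close>

definition affine_rescale ::
  "(real^'d::finite) measure \<Rightarrow> real \<Rightarrow> real^'d^'d \<Rightarrow> real^'d \<Rightarrow> (real^'d) measure" where
  "affine_rescale P c Q b =
     measure_of UNIV (sets borel) (\<lambda>A. emeasure P ((\<lambda>a. c *\<^sub>R (a v* Q) + b) ` A))"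

definition std_gaussian :: "(real^'d::finite) measure" where
  "std_gaussian = density lborel (\<lambda>x. ennreal (\<Prod>i\<in>UNIV. std_normal_density (x $ i)))"

definition borel_prob_measures :: "'c::topological_space measure set" where
  "borel_prob_measures = {P. prob_space P \<and> sets P = sets borel}"

text \<open>The coarsest topology on the Borel probability measures making \<open>P \<mapsto> \<integral>f dP\<close> continuous
  for every bounded continuous real function \<open>f\<close>.\<close>

definition weak_topology :: "'c::topological_space measure topology" where
  "weak_topology =
     topology_generated_by
       {{P \<in> borel_prob_measures. (\<integral>x. f x \<partial>P) \<in> G} | (f :: 'c \<Rightarrow> real) G.
          continuous_on UNIV f \<and> bounded (range f) \<and> open G}"

lemma topspace_weak_topology: "topspace weak_topology = borel_prob_measures"
proof -
  have "borel_prob_measures \<subseteq> topspace (weak_topology :: 'c::topological_space measure topology)"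
  proof
    fix P :: "'c measure" assume "P \<in> borel_prob_measures"
    moreover have "\<exists>(f :: 'c \<Rightarrow> real) G. borel_prob_measures = {P \<in> borel_prob_measures. (\<integral>x. f x \<partial>P) \<in> G}
        \<and> continuous_on UNIV f \<and> bounded (range f) \<and> open G"
      by (intro exI[of _ "\<lambda>_. 0"] exI[of _ UNIV]) auto
    ultimately show "P \<in> topspace weak_topology"
      unfolding weak_topology_def topology_generated_by_topspace by blast
  qed
  then show ?thesis
    unfolding weak_topology_def topology_generated_by_topspace by auto
qed

definition borel_of :: "'c topology \<Rightarrow> 'c measure" where
  "borel_of T = sigma (topspace T) {G. openin T G}"

text \<open>Convergence in probability to a constant, with respect to any metric that induces the
  topology \<open>T\<close>; for a constant limit the choice of metric does not matter. This is used only for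
  metrizable \<open>T\<close> (the weak topology on a separable metric space is induced, for instance, by the
  Prokhorov metric). Finitely many \<open>X n\<close> may fail to be random elements.\<close>

definition tendsto_in_prob ::
  "'a measure \<Rightarrow> 'c topology \<Rightarrow> (nat \<Rightarrow> 'a \<Rightarrow> 'c) \<Rightarrow> 'c \<Rightarrow> bool" where
  "tendsto_in_prob M T X l \<longleftrightarrow>
     l \<in> topspace T \<and>
     (\<forall>\<^sub>F n in sequentially. X n \<in> measurable M (borel_of T)) \<and>
     (\<forall>\<rho>. Metric_space (topspace T) \<rho> \<and> Metric_space.mtopology (topspace T) \<rho> = T \<longrightarrow>
        (\<forall>\<epsilon>>0. (\<lambda>n. measure M {\<omega> \<in> space M. \<rho> (X n \<omega>) l > \<epsilon>}) \<longlonglongrightarrow> 0))"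

end

theory Submission
  imports Defs
begin

text \<open>
The proof follows the Fourier transform of the composition of the urn,
\<open>M\<^sub>n(t) = \<Sum>v. U\<^sub>n(v) exp(i t\<cdot>v)\<close>. A drawn colour \<open>z\<close> adds mass \<open>p(v - z)\<close> to every colour \<open>v\<close>, so
the wave \<open>exp(i t\<cdot>v)\<close> is an eigenfunction of the replacement with eigenvalue
\<open>\<phi>(t) = E exp(i t\<cdot>X\<^sub>1)\<close>, and the conditional expectation of \<open>M\<^sub>n\<^sub>+\<^sub>1(t)\<close> given the past is
\<open>(1 + \<phi>(t)/(n+1)) M\<^sub>n(t)\<close>. Two things follow.

The mean of \<open>M\<^sub>n(t)\<close> is \<open>M\<^sub>0(t) \<Prod>k\<le>n. (1 + \<phi>(t)/k)\<close>, which after division by \<open>n + 1\<close> behaves like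
\<open>exp((\<phi>(t) - 1) log n)\<close>. At \<open>t = r / sqrt (log n)\<close> the second order expansion of \<open>\<phi>\<close> gives the
phase \<open>sqrt (log n) r\<cdot>\<mu>\<close>, which the centring removes, and the factor \<open>exp(- r\<Sigma>r\<^sup>T/2)\<close>. The exponent
contains \<open>\<phi> - 1\<close> and not \<open>log \<phi>\<close>, which is why \<open>\<Sigma>\<close> is the non-centred second moment matrix
(\<open>growth_product_asymptotics\<close>, \<open>mean_wave_limit\<close>).

The second moment of \<open>M\<^sub>n(t)\<close> satisfies a similar recursion. It shows that the variance of
\<open>M\<^sub>n(t)/(n+1)\<close> grows by at most \<open>1/(n+2)\<^sup>2\<close> in step \<open>n\<close>, uniformly in \<open>t\<close>. For each fixed \<open>n\<close> this
variance vanishes as \<open>t\<close> tends to 0, because \<open>M\<^sub>n(0) = n + 1\<close> is not random. Hence the variance at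
frequencies \<open>t\<^sub>n \<rightarrow> 0\<close> tends to 0 (\<open>rel_variance_Suc_le\<close>, \<open>tendsto_rel_variance\<close>), and the Fourier
transform of the rescaled random measure converges in \<open>L\<^sup>1\<close> to that of the Gaussian measure
(\<open>wave_total_limit\<close>).

It remains to pass from Fourier transforms to the weak topology. The mean of the random measure
\<open>\<Lambda>\<^sub>n\<close> is the distribution of \<open>Z\<^sub>n\<close>; the one-dimensional continuity theorem of Levy, applied to each
coordinate of the rescaled \<open>Z\<^sub>n\<close>, therefore shows that large cubes carry most of the mass. On such a
cube a bounded continuous function is uniformly close to a trigonometric polynomial that is bounded
everywhere (\<open>trig_poly_approx\<close>), so that its integrals converge in \<open>L\<^sup>1\<close>
(\<open>bounded_continuous_converges\<close>). A ball of a metric inducing the weak topology contains a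
neighbourhood given by finitely many such integrals, and Markov's inequality bounds the probability
of leaving that neighbourhood (\<open>tendsto_in_prob_weak_topologyI\<close>).
\<close>

section \<open>Square roots of positive definite matrices\<close>

text \<open>A maximum point of \<open>x \<bullet> f x\<close> on the unit sphere of \<open>V\<close> is an eigenvector: with \<open>c\<close> the maximum, the
quadratic form \<open>c (y \<bullet> y) - y \<bullet> f y\<close> is nonnegative on \<open>V\<close> and vanishes at \<open>e\<close>, so its derivative
at \<open>e\<close> has to vanish.\<close>
lemma selfadjoint_eigenvector:
  fixes f :: "'a::euclidean_space \<Rightarrow> 'a"
  assumes f: "linear f" and sa: "\<And>x y. f x \<bullet> y = x \<bullet> f y"
    and V: "subspace V" "f ` V \<subseteq> V" "V \<noteq> {0}"
  obtains e c where "e \<in> V" "norm e = 1" "f e = c *\<^sub>R e"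
proof -
  interpret linear f by fact
  have "compact (sphere 0 1 \<inter> V)"
    using V(1) by (intro compact_Int_closed closed_subspace) auto
  moreover have "sphere 0 1 \<inter> V \<noteq> {}"
  proof -
    obtain x where "x \<in> V" "x \<noteq> 0"
      using V(1,3) subspace_0 by blast
    then have "(1 / norm x) *\<^sub>R x \<in> sphere 0 1 \<inter> V"
      using V(1) by (auto simp: subspace_scale)
    then show ?thesis by blast
  qed
  moreover have "continuous_on (sphere 0 1 \<inter> V) (\<lambda>x. x \<bullet> f x)"
    using f by (intro continuous_intros linear_continuous_on linear_conv_bounded_linear[THEN iffD1])
  ultimately obtain e where e: "e \<in> sphere 0 1 \<inter> V"
    and max: "\<And>y. y \<in> sphere 0 1 \<inter> V \<Longrightarrow> y \<bullet> f y \<le> e \<bullet> f e"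
    using continuous_attains_sup[of "sphere 0 1 \<inter> V" "\<lambda>x. x \<bullet> f x"] by blast
  define c where "c = e \<bullet> f e"
  have ee: "e \<bullet> e = 1" "e \<in> V" "norm e = 1"
    using e by (auto simp: norm_eq_1)
  have psd: "0 \<le> c * (y \<bullet> y) - y \<bullet> f y" if "y \<in> V" for y
  proof (cases "y = 0")
    case False
    have "(1 / norm y) *\<^sub>R y \<bullet> f ((1 / norm y) *\<^sub>R y) \<le> c"
      unfolding c_def using False that V(1) by (intro max) (auto simp: subspace_scale)
    then have "y \<bullet> f y / (norm y)\<^sup>2 \<le> c"
      by (simp add: scale power2_eq_square)
    then show ?thesis
      using False by (simp add: divide_le_eq dot_square_norm)
  qed simp
  define z where "z = c *\<^sub>R e - f e"
  have z: "z \<in> V"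
    unfolding z_def using ee V by (intro subspace_diff subspace_scale) auto
  have "z \<bullet> z = 0"
  proof (rule ccontr)
    assume "z \<bullet> z \<noteq> 0"
    then have pos: "z \<bullet> z > 0" by simp
    define D where "D = c * (z \<bullet> z) - z \<bullet> f z"
    \<comment> \<open>Moving from \<open>e\<close> by \<open>- \<tau> z\<close> changes the form by \<open>\<tau>\<^sup>2 D - 2 \<tau> (z \<bullet> z)\<close>, which is negative for small \<open>\<tau> > 0\<close>.\<close>
    define \<tau> where "\<tau> = (z \<bullet> z) / (D + 1)"
    have D: "D \<ge> 0" unfolding D_def by (rule psd[OF z])
    have "0 \<le> c * ((e - \<tau> *\<^sub>R z) \<bullet> (e - \<tau> *\<^sub>R z)) - (e - \<tau> *\<^sub>R z) \<bullet> f (e - \<tau> *\<^sub>R z)"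
      using ee z V(1) by (intro psd subspace_diff subspace_scale)
    also have "\<dots> = \<tau>\<^sup>2 * D - 2 * \<tau> * (c * (e \<bullet> z) - f e \<bullet> z)"
      using sa[of e z] by (simp add: diff scale D_def algebra_simps inner_commute ee power2_eq_square c_def)
    also have "c * (e \<bullet> z) - f e \<bullet> z = z \<bullet> z"
      by (simp add: z_def algebra_simps)
    finally have "2 * \<tau> * (z \<bullet> z) \<le> \<tau>\<^sup>2 * D" by simp
    moreover have "\<tau> > 0" unfolding \<tau>_def using pos D by simp
    ultimately have "2 * (z \<bullet> z) \<le> \<tau> * D"
      by (simp add: power2_eq_square)
    also have "\<tau> * D \<le> z \<bullet> z"
      unfolding \<tau>_def using D pos by (simp add: divide_le_eq mult_left_mono)
    finally show False using pos by simp
  qed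
  then have "f e = c *\<^sub>R e" by (simp add: z_def)
  with ee show ?thesis by (intro that) auto
qed

text \<open>The spectral theorem. It is stated for an invariant subspace so that the induction can pass to the
orthogonal complement of an eigenvector inside \<open>V\<close>.\<close>
lemma selfadjoint_orthonormal_eigenbasis:
  fixes f :: "'a::euclidean_space \<Rightarrow> 'a"
  assumes f: "linear f" and sa: "\<And>x y. f x \<bullet> y = x \<bullet> f y"
    and V: "subspace V" "f ` V \<subseteq> V"
  shows "\<exists>B. finite B \<and> pairwise orthogonal B \<and> (\<forall>b\<in>B. norm b = 1) \<and> span B = V \<and>
           (\<forall>b\<in>B. \<exists>c. f b = c *\<^sub>R b)"
  using V
proof (induction "dim V" arbitrary: V rule: less_induct)
  case less
  show ?case
  proof (cases "V = {0}")
    case True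
    then show ?thesis by (intro exI[of _ "{}"]) auto
  next
    case False
    obtain e c where e: "e \<in> V" "norm e = 1" "f e = c *\<^sub>R e"
      using selfadjoint_eigenvector[OF f sa less.prems False] by blast
    define V' where "V' = {x \<in> V. e \<bullet> x = 0}"
    have ee: "e \<bullet> e = 1" using e by (simp add: norm_eq_1)
    have sub: "subspace V'"
      unfolding V'_def using less.prems(1)
      by (auto simp: subspace_def inner_add_right)
    have "f ` V' \<subseteq> V'"
      unfolding V'_def using less.prems(2) sa[of e, symmetric] e(3) by (auto simp: image_subset_iff)
    moreover have "dim V' < dim V"
    proof (rule dim_psubset)
      have "e \<notin> V'" by (simp add: V'_def ee)
      moreover have "V' \<subseteq> V" by (auto simp: V'_def)
      ultimately have "V' \<subset> V" using e(1) by blast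
      then show "span V' \<subset> span V" using sub less.prems(1) by (simp add: span_eq_iff[THEN iffD2])
    qed
    ultimately obtain B where B: "finite B" "pairwise orthogonal B" "\<forall>b\<in>B. norm b = 1" "span B = V'"
        "\<forall>b\<in>B. \<exists>c. f b = c *\<^sub>R b"
      using less.hyps[OF _ sub] by blast
    have BV: "B \<subseteq> V'" using B(4) span_superset by blast
    have "pairwise orthogonal (insert e B)"
      using B(2) BV by (auto simp: pairwise_insert orthogonal_def V'_def inner_commute)
    moreover have "span (insert e B) = V"
    proof
      show "span (insert e B) \<subseteq> V"
        using BV e(1) less.prems(1) by (intro span_minimal) (auto simp: V'_def)
      show "V \<subseteq> span (insert e B)"
      proof
        fix x assume x: "x \<in> V"
        have "x - (e \<bullet> x) *\<^sub>R e \<in> V'"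
          unfolding V'_def using x e(1) less.prems(1)
          by (auto simp: subspace_diff subspace_scale inner_diff_right ee)
        then show "x \<in> span (insert e B)"
          unfolding span_breakdown_eq B(4)[symmetric] by blast
      qed
    qed
    ultimately show ?thesis
      using B e by (intro exI[of _ "insert e B"]) auto
  qed
qed

lemma symmetric_matrix_selfadjoint:
  fixes A :: "real^'n^'n"
  assumes "transpose A = A"
  shows "(A *v x) \<bullet> y = x \<bullet> (A *v y)"
proof -
  have "(transpose A *v x) \<bullet> y = x \<bullet> (A *v y)"
    by (simp add: transpose_matrix_vector dot_lmul_matrix)
  then show ?thesis by (simp add: assms)
qed

lemma selfadjoint_symmetric_matrix:
  fixes A :: "real^'n^'n"
  assumes "\<And>x y. (A *v x) \<bullet> y = x \<bullet> (A *v y)"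
  shows "transpose A = A"
proof -
  have "transpose A *v x = A *v x" for x
  proof (rule vector_eq_ldot[THEN iffD1, rule_format])
    fix z
    have "z \<bullet> (transpose A *v x) = (transpose A *v x) \<bullet> z" by (rule inner_commute)
    also have "\<dots> = x \<bullet> (A *v z)" by (simp add: transpose_matrix_vector dot_lmul_matrix)
    also have "\<dots> = z \<bullet> (A *v x)" using assms[of x z] by (simp add: inner_commute)
    finally show "z \<bullet> (transpose A *v x) = z \<bullet> (A *v x)" .
  qed
  then show ?thesis by (simp add: matrix_eq)
qed

text \<open>The square root acts on each vector of an orthonormal eigenbasis of \<open>A\<close> by the square root of the
eigenvalue.\<close>
lemma pos_definite_sqrt_exists:
  fixes A :: "real^'n^'n"
  assumes A: "pos_definite A"
  shows "\<exists>Q. pos_definite Q \<and> Q ** Q = A"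
proof -
  have symm: "transpose A = A" and pos: "\<And>x. x \<noteq> 0 \<Longrightarrow> x \<bullet> (A *v x) > 0"
    using A by (auto simp: pos_definite_def)
  obtain B where B: "finite B" "pairwise orthogonal B" "\<forall>b\<in>B. norm b = 1" "span B = UNIV"
      and "\<forall>b\<in>B. \<exists>c. A *v b = c *\<^sub>R b"
    using selfadjoint_orthonormal_eigenbasis[of "(*v) A" UNIV] symmetric_matrix_selfadjoint[OF symm]
    by (auto simp: matrix_vector_mul_linear)
  then obtain c where c: "\<And>b. b \<in> B \<Longrightarrow> A *v b = c b *\<^sub>R b" by metis
  have bb: "b \<bullet> b' = (if b = b' then 1 else 0)" if "b \<in> B" "b' \<in> B" for b b'
    using B(2,3) that by (auto simp: pairwise_def orthogonal_def norm_eq_1)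
  have cpos: "c b > 0" if "b \<in> B" for b
  proof -
    have "b \<noteq> 0" using bb[OF that that] by auto
    from pos[OF this] show ?thesis using c[OF that] bb[OF that that] by simp
  qed
  have expand: "(\<Sum>b\<in>B. (x \<bullet> b) *\<^sub>R b) = x" for x
    using B by (intro orthonormal_basis_expand) auto
  define q where "q x = (\<Sum>b\<in>B. (sqrt (c b) * (x \<bullet> b)) *\<^sub>R b)" for x
  have "linear q"
    unfolding q_def
    by (intro linearI)
       (simp_all add: inner_add_left algebra_simps sum.distrib scaleR_sum_right)
  define Q where "Q = matrix q"
  have Q: "Q *v x = q x" for x
    unfolding Q_def by (simp add: linear_matrix_vector_mul_eq matrix_works \<open>linear q\<close>)
  have qb: "q x \<bullet> b = sqrt (c b) * (x \<bullet> b)" if "b \<in> B" for x b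
    using that B(1) by (simp add: q_def inner_sum_left bb if_distrib[of "\<lambda>z. _ * z"] sum.delta' cong: if_cong)
  have form: "q x \<bullet> y = (\<Sum>b\<in>B. sqrt (c b) * (x \<bullet> b) * (y \<bullet> b))" for x y
    by (simp add: q_def inner_sum_left inner_commute[of y])
  have "x \<bullet> q y = q x \<bullet> y" for x y
    using form[of x y] form[of y x] by (simp add: inner_commute mult.commute mult.left_commute)
  then have "transpose Q = Q"
    by (intro selfadjoint_symmetric_matrix) (simp add: Q)
  moreover have "x \<bullet> (Q *v x) > 0" if "x \<noteq> 0" for x
  proof -
    have "\<exists>b\<in>B. x \<bullet> b \<noteq> 0"
      using expand[of x] that by (metis (no_types, lifting) scaleR_zero_left sum.neutral)
    then obtain b where b: "b \<in> B" "x \<bullet> b \<noteq> 0" by blast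
    have "x \<bullet> (Q *v x) = (\<Sum>b\<in>B. sqrt (c b) * (x \<bullet> b)\<^sup>2)"
      by (simp add: Q inner_commute[of x] form power2_eq_square mult_ac)
    also have "\<dots> > 0"
      using b cpos B(1) by (intro sum_pos2[of _ b]) (auto simp: less_imp_le)
    finally show ?thesis .
  qed
  moreover have "Q ** Q = A"
  proof -
    have "(Q ** Q) *v x = A *v x" for x
    proof -
      have "(Q ** Q) *v x = (\<Sum>b\<in>B. (sqrt (c b) * (sqrt (c b) * (x \<bullet> b))) *\<^sub>R b)"
        by (simp add: matrix_vector_mul_assoc[symmetric] Q) (simp add: q_def[of "q x"] qb)
      also have "\<dots> = (\<Sum>b\<in>B. (x \<bullet> b) *\<^sub>R (A *v b))"
        using cpos c by (intro sum.cong) (auto simp: mult.assoc[symmetric] less_imp_le)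
      also have "\<dots> = A *v (\<Sum>b\<in>B. (x \<bullet> b) *\<^sub>R b)"
        by (simp add: matrix_vector_mult_scaleR linear_sum[OF matrix_vector_mul_linear] del: expand)
      finally show ?thesis by (simp add: expand)
    qed
    then show ?thesis by (simp add: matrix_eq)
  qed
  ultimately show ?thesis unfolding pos_definite_def by blast
qed

text \<open>For \<open>D = Q - Q'\<close> the equation \<open>Q\<^sup>2 = Q'\<^sup>2\<close> says \<open>Q D + D Q' = 0\<close>. Evaluated at an eigenvector \<open>b\<close> of
\<open>D\<close> with eigenvalue \<open>c\<close> this reads \<open>c (b \<bullet> Q b + b \<bullet> Q' b) = 0\<close>, hence \<open>c = 0\<close>; since \<open>D\<close> is
symmetric, it vanishes.\<close>
lemma pos_definite_sqrt_unique:
  fixes Q Q' :: "real^'n^'n"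
  assumes Q: "pos_definite Q" and Q': "pos_definite Q'" and eq: "Q ** Q = Q' ** Q'"
  shows "Q = Q'"
proof -
  define D where "D = Q - Q'"
  have tr: "transpose Q = Q" "transpose Q' = Q'"
    using Q Q' by (auto simp: pos_definite_def)
  have D_apply: "D *v x = Q *v x - Q' *v x" for x
    by (simp add: D_def matrix_vector_mult_diff_rdistrib)
  have sa: "(D *v x) \<bullet> y = x \<bullet> (D *v y)" for x y
    by (simp add: D_apply inner_diff symmetric_matrix_selfadjoint tr)
  obtain B where B: "finite B" "\<forall>b\<in>B. norm b = 1" "span B = UNIV"
      and eig: "\<forall>b\<in>B. \<exists>c. D *v b = c *\<^sub>R b"
    using selfadjoint_orthonormal_eigenbasis[of "(*v) D" UNIV] sa
    by (auto simp: matrix_vector_mul_linear)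
  have "D *v b = 0" if "b \<in> B" for b
  proof -
    obtain c where c: "D *v b = c *\<^sub>R b" using eig \<open>b \<in> B\<close> by blast
    have "b \<noteq> 0" using B(2) \<open>b \<in> B\<close> by force
    then have pos: "b \<bullet> (Q *v b) > 0" "b \<bullet> (Q' *v b) > 0"
      using Q Q' by (auto simp: pos_definite_def)
    have "Q *v (D *v b) + D *v (Q' *v b) = 0"
      using eq by (simp add: D_apply matrix_vector_mult_diff_distrib) (simp add: matrix_vector_mul_assoc)
    then have "0 = b \<bullet> (Q *v (D *v b)) + b \<bullet> (D *v (Q' *v b))"
      by (metis inner_add_right inner_zero_right)
    also have "\<dots> = c * (b \<bullet> (Q *v b) + b \<bullet> (Q' *v b))"
      by (simp add: sa[symmetric] c matrix_vector_mult_scaleR algebra_simps)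
    finally have "c = 0" using pos by simp
    then show ?thesis by (simp add: c)
  qed
  then have "D *v x = 0" for x
    using linear_eq_0_on_span[of "(*v) D" B x] B(3) by (simp add: matrix_vector_mul_linear)
  then have "D = 0"
    by (simp add: matrix_eq)
  then show ?thesis by (simp add: D_def)
qed

lemma matrix_sqrt_pos_definite:
  fixes A :: "real^'n^'n"
  assumes "pos_definite A"
  shows "pos_definite (matrix_sqrt A)" "matrix_sqrt A ** matrix_sqrt A = A"
proof -
  have "\<exists>!Q. pos_definite Q \<and> Q ** Q = A"
    using pos_definite_sqrt_exists[OF assms] pos_definite_sqrt_unique by blast
  from theI'[OF this] show "pos_definite (matrix_sqrt A)" "matrix_sqrt A ** matrix_sqrt A = A"
    unfolding matrix_sqrt_def by auto
qed

section \<open>The standard Gaussian measure\<close>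

text \<open>\<open>lborel\<close> is a product over the set \<open>Basis\<close>, whereas the density of \<open>std_gaussian\<close> is a product over
the index type; the two lemmas here translate between them.\<close>
lemma prod_Basis_vec:
  fixes x :: "real^'n" and g :: "'n \<Rightarrow> real \<Rightarrow> 'b::comm_monoid_mult"
  shows "(\<Prod>b\<in>Basis. g (THE i. b = axis i 1) (x \<bullet> b)) = (\<Prod>i\<in>UNIV. g i (x $ i))"
proof -
  have "(\<Prod>b\<in>(\<lambda>i. axis i 1) ` UNIV. g (THE i. b = axis i 1) (x \<bullet> b)) = (\<Prod>i\<in>UNIV. g i (x $ i))"
    by (subst prod.reindex) (auto simp: inj_on_def axis_eq_axis inner_axis)
  also have "(\<lambda>i. axis i 1) ` UNIV = (Basis :: (real^'n) set)"
    by (auto simp: Basis_vec_def)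
  finally show ?thesis .
qed

lemma prod_Basis_vec':
  fixes g :: "'n::finite \<Rightarrow> 'b::comm_monoid_mult"
  shows "(\<Prod>b\<in>(Basis :: (real^'n) set). g (THE i. b = axis i 1)) = (\<Prod>i\<in>UNIV. g i)"
  using prod_Basis_vec[of "\<lambda>i _. g i" 0] by simp

lemma integral_lborel_vec_prod:
  fixes f :: "'n::finite \<Rightarrow> real \<Rightarrow> complex"
  assumes "\<And>i. integrable lborel (f i)"
  shows "(\<integral>x. (\<Prod>i\<in>UNIV. f i (x $ i)) \<partial>(lborel :: (real^'n) measure)) = (\<Prod>i\<in>UNIV. \<integral>x. f i x \<partial>lborel)"
proof -
  let ?i = "\<lambda>b::real^'n. THE i. b = axis i 1"
  have [measurable]: "f i \<in> borel_measurable borel" for i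
    using borel_measurable_integrable[OF assms[of i]] by simp
  interpret product_sigma_finite "\<lambda>_::real^'n. lborel :: real measure" ..
  have "(\<integral>x. (\<Prod>i\<in>UNIV. f i (x $ i)) \<partial>(lborel :: (real^'n) measure)) =
        (\<integral>x. (\<Prod>b\<in>Basis. f (?i b) (x \<bullet> b)) \<partial>(lborel :: (real^'n) measure))"
    by (simp add: prod_Basis_vec)
  also have "\<dots> = (\<integral>y. (\<Prod>b\<in>Basis. f (?i b) ((\<Sum>c\<in>Basis. y c *\<^sub>R c) \<bullet> b)) \<partial>(\<Pi>\<^sub>M b\<in>(Basis :: (real^'n) set). lborel))"
    by (subst lborel_eq) (subst integral_distr; simp)
  also have "\<dots> = (\<integral>y. (\<Prod>b\<in>Basis. f (?i b) (y b)) \<partial>(\<Pi>\<^sub>M b\<in>(Basis :: (real^'n) set). lborel))"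
    by (intro Bochner_Integration.integral_cong refl prod.cong arg_cong[where f = "f _"])
       simp
  also have "\<dots> = (\<Prod>b\<in>(Basis :: (real^'n) set). \<integral>x. f (?i b) x \<partial>lborel)"
    by (rule product_integral_prod) (auto intro: assms)
  also have "\<dots> = (\<Prod>i\<in>UNIV. \<integral>x. f i x \<partial>lborel)"
    by (rule prod_Basis_vec'[of "\<lambda>i. \<integral>x. f i x \<partial>lborel"])
  finally show ?thesis .
qed

lemma space_std_gaussian [simp]: "space std_gaussian = UNIV"
  and sets_std_gaussian [measurable_cong, simp]: "sets std_gaussian = sets borel"
  by (simp_all add: std_gaussian_def)

lemma prob_space_std_gaussian: "prob_space (std_gaussian :: (real^'n) measure)"
proof
  let ?i = "\<lambda>b::real^'n. THE i. b = axis i 1"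
  have "emeasure std_gaussian (space (std_gaussian :: (real^'n) measure)) =
     (\<integral>\<^sup>+x. (\<Prod>i\<in>UNIV. ennreal (std_normal_density (x $ i))) \<partial>(lborel :: (real^'n) measure))"
    by (simp add: std_gaussian_def emeasure_density prod_ennreal)
  also have "\<dots> = (\<integral>\<^sup>+x. (\<Prod>b\<in>Basis. ennreal (std_normal_density (x \<bullet> b))) \<partial>(lborel :: (real^'n) measure))"
    by (intro nn_integral_cong prod_Basis_vec[of "\<lambda>_ x. ennreal (std_normal_density x)", symmetric])
  also have "\<dots> = (\<Prod>b\<in>(Basis :: (real^'n) set). \<integral>\<^sup>+x. ennreal (std_normal_density x) \<partial>lborel)"
    by (rule nn_integral_lborel_prod) auto
  also have "(\<integral>\<^sup>+x. ennreal (std_normal_density x) \<partial>lborel) = 1"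
    using prob_space.emeasure_space_1[OF prob_space_normal_density[of 1 0]] 
    by (simp add: emeasure_density)
  finally show "emeasure std_gaussian (space (std_gaussian :: (real^'n) measure)) = 1" by simp
qed

lemma char_std_gaussian:
  fixes s :: "real^'n"
  shows "(\<integral>x. iexp (s \<bullet> x) \<partial>std_gaussian) = exp (- (s \<bullet> s) / 2)"
proof -
  have 1: "(\<integral>x. std_normal_density x *\<^sub>R iexp (t * x) \<partial>lborel) = exp (- (t\<^sup>2) / 2)" for t
    using fun_cong[OF char_std_normal_distribution, of t]
    by (simp add: char_def integral_density)
  have int: "integrable lborel (\<lambda>x. std_normal_density x *\<^sub>R iexp (t * x))" for t
    by (rule Bochner_Integration.integrable_bound[OF integrable_normal_density[of 1 0]]) auto
  have "(\<integral>x. iexp (s \<bullet> x) \<partial>std_gaussian) =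
     (\<integral>x. (\<Prod>i\<in>UNIV. std_normal_density (x $ i)) *\<^sub>R iexp (s \<bullet> x) \<partial>lborel)"
    unfolding std_gaussian_def
    by (subst integral_density) (auto intro!: prod_nonneg)
  also have "\<dots> = (\<integral>x. (\<Prod>i\<in>UNIV. std_normal_density (x $ i) *\<^sub>R iexp (s $ i * x $ i)) \<partial>lborel)"
    by (simp add: scaleR_conv_of_real prod.distrib inner_vec_def sum_distrib_left exp_sum)
  also have "\<dots> = (\<Prod>i\<in>UNIV. \<integral>x. std_normal_density x *\<^sub>R iexp (s $ i * x) \<partial>lborel)"
    by (rule integral_lborel_vec_prod[where f = "\<lambda>i x. std_normal_density x *\<^sub>R iexp (s $ i * x)"]) (rule int)
  also have "\<dots> = exp (- (s \<bullet> s) / 2)"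
    unfolding 1 by (simp add: inner_vec_def power2_eq_square exp_of_real[symmetric] exp_sum[symmetric] sum_negf sum_divide_distrib
          flip: of_real_prod)
  finally show ?thesis .
qed

section \<open>Trigonometric polynomials\<close>

text \<open>Real parts of linear combinations of waves. Writing a summand as \<open>Re (c * cis (s \<bullet> x))\<close> covers
sine and cosine at once and makes the set closed under products.\<close>
inductive trig_poly :: "('a::real_inner \<Rightarrow> real) \<Rightarrow> bool" where
  trig_poly_basic: "trig_poly (\<lambda>x. Re (c * cis (s \<bullet> x)))"
| trig_poly_add: "trig_poly f \<Longrightarrow> trig_poly g \<Longrightarrow> trig_poly (\<lambda>x. f x + g x)"

lemma trig_poly_const: "trig_poly (\<lambda>_. a)"
  using trig_poly_basic[of "of_real a" 0] by simp

lemma trig_poly_cos: "trig_poly (\<lambda>x. cos (s \<bullet> x))"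
  using trig_poly_basic[of 1 s] by simp

lemma trig_poly_sin: "trig_poly (\<lambda>x. sin (s \<bullet> x))"
  using trig_poly_basic[of "- \<i>" s] by simp

lemma trig_poly_mult:
  assumes "trig_poly f" "trig_poly g"
  shows "trig_poly (\<lambda>x. f x * g x)"
  using assms(1)
proof induction
  case (trig_poly_basic c s)
  from assms(2) show ?case
  proof induction
    case (trig_poly_basic d t)
    have re: "Re a * Re b = Re (a * b / 2) + Re (a * cnj b / 2)" for a b
      by (simp add: field_simps)
    have "Re (c * cis (s \<bullet> x)) * Re (d * cis (t \<bullet> x)) =
      Re ((c * d / 2) * cis ((s + t) \<bullet> x)) + Re ((c * cnj d / 2) * cis ((s - t) \<bullet> x))" for x
    proof -
      have "(c * d / 2) * cis ((s + t) \<bullet> x) = c * cis (s \<bullet> x) * (d * cis (t \<bullet> x)) / 2"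
        unfolding inner_add_left cis_mult[symmetric] by simp
      moreover have "(c * cnj d / 2) * cis ((s - t) \<bullet> x) = c * cis (s \<bullet> x) * cnj (d * cis (t \<bullet> x)) / 2"
        unfolding inner_diff_left complex_cnj_mult cis_cnj using cis_mult[of "s \<bullet> x" "- (t \<bullet> x)"] by simp
      ultimately show ?thesis by (simp only: re)
    qed
    then show ?case by (simp only: trig_poly.intros)
  next
    case (trig_poly_add g h)
    then show ?case by (simp add: distrib_left trig_poly.intros(2))
  qed
next
  case (trig_poly_add f h)
  then show ?case by (simp add: distrib_right trig_poly.intros(2))
qed

text \<open>A trigonometric polynomial that is close to \<open>f\<close> on a cube may be large elsewhere. To control it, wrap
the space around a torus by \<open>E\<close>, with a period so large that \<open>E\<close> is injective on the cube, extend
\<open>f\<close> from the image of the cube to the whole torus without increasing its bound (Tietze), and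
approximate the extension on the torus (Stone-Weierstrass). The bound then holds on all of the
space because \<open>E\<close> maps everything into the torus.\<close>
lemma trig_poly_approx:
  fixes f :: "real^'n \<Rightarrow> real"
  assumes f: "continuous_on UNIV f" "\<And>x. \<bar>f x\<bar> \<le> b" and L: "L > 0" and e: "e > 0"
  obtains g where "trig_poly g" "\<And>x. (\<And>i. \<bar>x $ i\<bar> \<le> L) \<Longrightarrow> \<bar>f x - g x\<bar> < e"
    "\<And>x. \<bar>g x\<bar> < b + e"
proof -
  \<comment> \<open>On the cube \<open>\<bar>x $ i / L\<bar> \<le> 1 < pi\<close>, so the angles do not overlap.\<close>
  define E :: "real^'n \<Rightarrow> complex^'n" where "E x = (\<chi> i. cis (x $ i / L))" for x
  define K :: "(real^'n) set" where "K = cbox (\<chi> i. - L) (\<chi> i. L)"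
  define T :: "(complex^'n) set" where "T = {z. \<forall>i. cmod (z $ i) = 1}"
  have K_iff: "x \<in> K \<longleftrightarrow> (\<forall>i. \<bar>x $ i\<bar> \<le> L)" for x
    by (auto simp: K_def mem_box_cart abs_le_iff minus_le_iff)
  have contE: "continuous_on X E" for X
    unfolding E_def using L by (intro continuous_intros continuous_on_vec_lambda) auto
  have injE: "inj_on E K"
  proof (rule inj_onI)
    fix x y assume x: "x \<in> K" and y: "y \<in> K" and xy: "E x = E y"
    have "x $ i = y $ i" for i
    proof -
      have "\<bar>x $ i / L\<bar> \<le> 1" "\<bar>y $ i / L\<bar> \<le> 1"
        using x y L by (simp_all add: K_iff)
      then have "- pi < x $ i / L" "x $ i / L \<le> pi" "- pi < y $ i / L" "y $ i / L \<le> pi"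
        using pi_gt3 by linarith+
      moreover have "cis (x $ i / L) = cis (y $ i / L)"
        using xy by (simp add: E_def vec_eq_iff)
      ultimately have "x $ i / L = y $ i / L" by (metis Arg_cis greaterThanAtMost_iff)
      then show ?thesis using L by simp
    qed
    then show "x = y" by (simp add: vec_eq_iff)
  qed
  have compK: "compact K" unfolding K_def by (rule compact_cbox)
  have ET: "E x \<in> T" for x by (simp add: E_def T_def)
  have compT: "compact T"
  proof (rule compact_eq_bounded_closed[THEN iffD2], rule conjI)
    have "norm z \<le> real CARD('n)" if "z \<in> T" for z
      using that L2_set_le_sum[of UNIV "\<lambda>i. norm (z $ i)"]
      by (simp add: norm_vec_def T_def)
    then show "bounded T" by (auto simp: bounded_iff)
    show "closed T" unfolding T_def
      by (intro closed_Collect_all closed_Collect_eq continuous_intros)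
  qed
  obtain E' where E': "homeomorphism K (E ` K) E E'"
    using homeomorphism_compact[OF compK contE refl injE] by blast
  have "continuous_on (E ` K) (f \<circ> E')"
    using E' f(1) by (intro continuous_on_compose continuous_on_subset[OF f(1)])
       (auto simp: homeomorphism_def)
  moreover have "closedin (top_of_set T) (E ` K)"
    using ET by (intro closed_subset compact_imp_closed compact_continuous_image contE compK) auto
  moreover have "b \<ge> 0" using f(2)[of 0] by simp
  ultimately obtain F where F: "continuous_on T F" "\<And>z. z \<in> E ` K \<Longrightarrow> F z = (f \<circ> E') z"
      "\<And>z. z \<in> T \<Longrightarrow> norm (F z) \<le> b"
    using Tietze[of "E ` K" "f \<circ> E'" T b] f(2) by auto
  have FE: "F (E x) = f x" if "x \<in> K" for x
    using F(2)[of "E x"] that E' by (simp add: homeomorphism_apply1)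
  let ?R = "{h. continuous_on T h \<and> trig_poly (\<lambda>x. h (E x))}"
  have coord: "(\<lambda>z. Re (z $ i)) \<in> ?R" "(\<lambda>z. Im (z $ i)) \<in> ?R" for i
  proof -
    have "(axis i (1/L) \<bullet> x) = x $ i / L" for x :: "real^'n"
      by (simp add: inner_axis')
    then show "(\<lambda>z. Re (z $ i)) \<in> ?R" "(\<lambda>z. Im (z $ i)) \<in> ?R"
      using trig_poly_cos[of "axis i (1/L) :: real^'n"] trig_poly_sin[of "axis i (1/L) :: real^'n"]
      by (auto simp: E_def intro!: continuous_intros)
  qed
  interpret function_ring_on ?R T
  proof
    show "compact T" by (rule compT)
    show "continuous_on T g" if "g \<in> ?R" for g
      using that by simp
    show "(\<lambda>z. g z + h z) \<in> ?R" if "g \<in> ?R" "h \<in> ?R" for g h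
      using that trig_poly_add[of "\<lambda>x. g (E x)" "\<lambda>x. h (E x)"] by (simp add: continuous_on_add)
    show "(\<lambda>z. g z * h z) \<in> ?R" if "g \<in> ?R" "h \<in> ?R" for g h
      using that trig_poly_mult[of "\<lambda>x. g (E x)" "\<lambda>x. h (E x)"] by (simp add: continuous_on_mult)
    show "(\<lambda>_. a) \<in> ?R" for a
      by (simp add: trig_poly_const)
    fix z w :: "complex^'n" assume "z \<noteq> w"
    then obtain i where "Re (z $ i) \<noteq> Re (w $ i) \<or> Im (z $ i) \<noteq> Im (w $ i)"
      by (auto simp: vec_eq_iff complex_eq_iff)
    then show "\<exists>h\<in>?R. h z \<noteq> h w"
    proof
      assume "Re (z $ i) \<noteq> Re (w $ i)"
      then show ?thesis by (intro bexI[OF _ coord(1)])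
    next
      assume "Im (z $ i) \<noteq> Im (w $ i)"
      then show ?thesis by (intro bexI[OF _ coord(2)])
    qed
  qed
  from Stone_Weierstrass_basic[OF F(1) e]
  obtain h where h: "h \<in> ?R" "\<forall>z\<in>T. \<bar>F z - h z\<bar> < e"
    by (rule bexE)
  show ?thesis
  proof (rule that[of "\<lambda>x. h (E x)"])
    show "\<bar>f x - h (E x)\<bar> < e" if "\<And>i. \<bar>x $ i\<bar> \<le> L" for x
      using h(2)[rule_format, OF ET[of x]] FE[of x] that by (simp add: K_iff)
    show "\<bar>h (E x)\<bar> < b + e" for x
      using h(2)[rule_format, OF ET[of x]] F(3)[OF ET[of x]] by simp
  qed (use h in simp)
qed

section \<open>Convergence of random measures to the Gaussian measure\<close>

lemma prob_space_bounded_integral: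
  fixes f :: "'b \<Rightarrow> 'd::{banach, second_countable_topology}"
  assumes "prob_space P" "f \<in> borel_measurable P" "\<And>x. norm (f x) \<le> b"
  shows "integrable P f" "norm (\<integral>x. f x \<partial>P) \<le> b"
proof -
  interpret prob_space P by fact
  show int: "integrable P f"
    by (rule integrable_const_bound[where B = b]) (use assms in auto)
  have "norm (\<integral>x. f x \<partial>P) \<le> (\<integral>x. norm (f x) \<partial>P)" by (rule integral_norm_bound)
  also have "\<dots> \<le> (\<integral>x. b \<partial>P)" using int assms(3) by (intro integral_mono) auto
  finally show "norm (\<integral>x. f x \<partial>P) \<le> b" by (simp add: prob_space)
qed

lemma integrable_std_gaussian:
  fixes f :: "real^'n \<Rightarrow> real"
  assumes "f \<in> borel_measurable borel" "bounded (range f)"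
  shows "integrable std_gaussian f"
proof -
  obtain b where "\<And>x. norm (f x) \<le> b" using assms(2) by (auto simp: bounded_iff)
  then show ?thesis
    using assms(1) by (intro prob_space_bounded_integral(1)[OF prob_space_std_gaussian, where b = b]) auto
qed

lemma gaussian_cis: "(\<integral>x. cis (s \<bullet> x) \<partial>std_gaussian) = of_real (exp (- (s \<bullet> s) / 2))" for s :: "real^'n"
  using char_std_gaussian[of s] by (simp add: cis_conv_exp)

lemma prob_space_tail_tendsto_0:
  fixes g :: "'b \<Rightarrow> real"
  assumes "prob_space P" and g [measurable]: "g \<in> borel_measurable P"
  shows "(\<lambda>k. measure P {x \<in> space P. real k < g x}) \<longlonglongrightarrow> 0"
proof -
  interpret prob_space P by fact
  have "(\<lambda>k. measure P {x \<in> space P. real k < g x}) \<longlonglongrightarrow> measure P (\<Inter>k. {x \<in> space P. real k < g x})"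
    by (rule finite_Lim_measure_decseq) (auto simp: decseq_def)
  also have "(\<Inter>k. {x \<in> space P. real k < g x}) = {}"
  proof -
    have "\<exists>k. \<not> real k < g x" for x
      using reals_Archimedean2[of "g x"] by (meson less_asym')
    then show ?thesis by blast
  qed
  finally show ?thesis by simp
qed

lemma integral_Re_cis:
  assumes "prob_space P" "sets P = sets borel"
  shows "(\<integral>x. Re (c * cis (s \<bullet> x)) \<partial>P) = Re (c * (\<integral>x. cis (s \<bullet> x) \<partial>P))"
proof -
  have [measurable_cong]: "sets P = sets borel" by fact
  have m: "(\<lambda>x. cis (s \<bullet> x)) \<in> borel_measurable borel"
    by (intro borel_measurable_continuous_onI continuous_intros)
  then have "integrable P (\<lambda>x. cis (s \<bullet> x))"
    by (intro prob_space_bounded_integral(1)[OF assms(1), where b = 1]) auto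
  then show ?thesis
    by (simp del: times_complex.sel add: integral_Re[symmetric])
qed

lemma trig_poly_bounded: "trig_poly f \<Longrightarrow> bounded (range f)"
proof (induction rule: trig_poly.induct)
  case (trig_poly_basic c s)
  have "norm (Re (c * cis (s \<bullet> x))) \<le> norm c" for x
    using abs_Re_le_cmod[of "c * cis (s \<bullet> x)"] by (simp add: norm_mult)
  then show ?case by (auto simp: bounded_iff simp del: times_complex.sel)
qed (rule bounded_plus_comp)

lemma trig_poly_measurable: "trig_poly f \<Longrightarrow> f \<in> borel_measurable borel"
proof (induction rule: trig_poly.induct)
  case (trig_poly_basic c s)
  show ?case by (intro borel_measurable_continuous_onI continuous_intros)
qed (rule borel_measurable_add)

text \<open>A continuity theorem for random measures: \<open>L\<^sup>1\<close> convergence of the characteristic functions implies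
\<open>L\<^sup>1\<close> convergence of the integrals of bounded continuous functions. The random vector \<open>Y n\<close> has the
mean of the random measure \<open>\<Lambda> n\<close> as its distribution; it makes tightness a statement about random
variables.\<close>
locale random_measures_gaussian_limit = prob_space M
  for M :: "'a measure" and \<Lambda> :: "nat \<Rightarrow> 'a \<Rightarrow> (real^'n) measure" and Y :: "nat \<Rightarrow> 'a \<Rightarrow> real^'n" +
  assumes prob_\<Lambda>: "\<And>n \<omega>. \<omega> \<in> space M \<Longrightarrow> prob_space (\<Lambda> n \<omega>)"
    and sets_\<Lambda>: "\<And>n \<omega>. \<omega> \<in> space M \<Longrightarrow> sets (\<Lambda> n \<omega>) = sets borel"
    and integral_measurable: "\<And>n f. f \<in> borel_measurable borel \<Longrightarrow> bounded (range f) \<Longrightarrow>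
        (\<lambda>\<omega>. (\<integral>x. f x \<partial>\<Lambda> n \<omega>) :: real) \<in> borel_measurable M"
    and Y [measurable]: "\<And>n. Y n \<in> borel_measurable M"
    and mean: "\<And>n f. f \<in> borel_measurable borel \<Longrightarrow> bounded (range f) \<Longrightarrow>
        (\<integral>\<omega>. (\<integral>x. f x \<partial>\<Lambda> n \<omega>) \<partial>M) = (\<integral>\<omega>. f (Y n \<omega>) \<partial>M :: real)"
    and char_converges: "\<And>s. (\<lambda>n. \<integral>\<omega>. norm ((\<integral>x. cis (s \<bullet> x) \<partial>\<Lambda> n \<omega>) - of_real (exp (- (s \<bullet> s) / 2))) \<partial>M) \<longlonglongrightarrow> 0"
begin

lemma abs_integral_le:
  fixes f :: "real^'n \<Rightarrow> real"
  assumes "f \<in> borel_measurable borel" "\<And>x. \<bar>f x\<bar> \<le> b" "\<omega> \<in> space M"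
  shows "\<bar>\<integral>x. f x \<partial>\<Lambda> n \<omega>\<bar> \<le> b"
proof -
  have [measurable_cong]: "sets (\<Lambda> n \<omega>) = sets borel" by (rule sets_\<Lambda>) fact
  have "f \<in> borel_measurable (\<Lambda> n \<omega>)" using assms(1) by measurable
  then show ?thesis
    using prob_space_bounded_integral(2)[OF prob_\<Lambda>[OF assms(3)], where f = f and b = b] assms(2) by simp
qed

lemma integrable_\<Lambda>:
  fixes f :: "real^'n \<Rightarrow> real"
  assumes "f \<in> borel_measurable borel" "bounded (range f)" "\<omega> \<in> space M"
  shows "integrable (\<Lambda> n \<omega>) f"
proof -
  obtain b where b: "\<And>x. norm (f x) \<le> b" using assms(2) by (auto simp: bounded_iff)
  have [measurable_cong]: "sets (\<Lambda> n \<omega>) = sets borel" by (rule sets_\<Lambda>) fact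
  have "f \<in> borel_measurable (\<Lambda> n \<omega>)" using assms(1) by measurable
  then show ?thesis
    using prob_space_bounded_integral(1)[OF prob_\<Lambda>[OF assms(3)]] b by blast
qed

lemma integrable_integral_\<Lambda>:
  fixes f :: "real^'n \<Rightarrow> real"
  assumes "f \<in> borel_measurable borel" "bounded (range f)"
  shows "integrable M (\<lambda>\<omega>. \<integral>x. f x \<partial>\<Lambda> n \<omega>)"
proof -
  obtain b where b: "\<And>x. \<bar>f x\<bar> \<le> b" using assms(2) by (auto simp: bounded_iff)
  show ?thesis
    by (rule integrable_const_bound[where B = b])
       (use abs_integral_le[OF assms(1) b] integral_measurable[OF assms] in auto)
qed

text \<open>Measurability is assumed for real integrands only; real and imaginary parts give the complex case.\<close>
lemma cis_integral_measurable: "(\<lambda>\<omega>. \<integral>x. cis (s \<bullet> x) \<partial>\<Lambda> n \<omega>) \<in> borel_measurable M"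
proof -
  have eq: "(\<integral>x. cis (s \<bullet> x) \<partial>\<Lambda> n \<omega>) = Complex (\<integral>x. Re (1 * cis (s \<bullet> x)) \<partial>\<Lambda> n \<omega>) (\<integral>x. Re (- \<i> * cis (s \<bullet> x)) \<partial>\<Lambda> n \<omega>)"
    if "\<omega> \<in> space M" for \<omega>
    unfolding integral_Re_cis[OF prob_\<Lambda>[OF that] sets_\<Lambda>[OF that]] by simp
  have m: "(\<lambda>\<omega>. \<integral>x. Re (c * cis (s \<bullet> x)) \<partial>\<Lambda> n \<omega>) \<in> borel_measurable M" for c
    by (intro integral_measurable trig_poly_measurable trig_poly_bounded trig_poly_basic)
  show ?thesis
    by (subst measurable_cong[OF eq]) (use m[of 1] m[of "- \<i>"] in \<open>auto simp: Complex_eq\<close>)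
qed

lemma norm_cis_integral_le: "\<omega> \<in> space M \<Longrightarrow> norm (\<integral>x. cis (s \<bullet> x) \<partial>\<Lambda> n \<omega>) \<le> 1"
proof -
  assume \<omega>: "\<omega> \<in> space M"
  have m: "(\<lambda>x. cis (s \<bullet> x)) \<in> borel_measurable borel"
    by (intro borel_measurable_continuous_onI continuous_intros)
  have [measurable_cong]: "sets (\<Lambda> n \<omega>) = sets borel" by (rule sets_\<Lambda>) fact
  show ?thesis
    by (rule prob_space_bounded_integral(2)[OF prob_\<Lambda>[OF \<omega>]]) (use m in auto)
qed

lemma integrable_cis_integral: "integrable M (\<lambda>\<omega>. \<integral>x. cis (s \<bullet> x) \<partial>\<Lambda> n \<omega>)"
  by (rule integrable_const_bound[where B = 1]) (use norm_cis_integral_le cis_integral_measurable in auto)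

lemma trig_poly_converges:
  assumes "trig_poly f"
  shows "(\<lambda>n. \<integral>\<omega>. \<bar>(\<integral>x. f x \<partial>\<Lambda> n \<omega>) - (\<integral>x. f x \<partial>std_gaussian)\<bar> \<partial>M) \<longlonglongrightarrow> 0"
  using assms
proof induction
  case (trig_poly_basic c s)
  let ?D = "\<lambda>n \<omega>. (\<integral>x. cis (s \<bullet> x) \<partial>\<Lambda> n \<omega>) - of_real (exp (- (s \<bullet> s) / 2))"
  have bnd: "(\<integral>\<omega>. \<bar>(\<integral>x. Re (c * cis (s \<bullet> x)) \<partial>\<Lambda> n \<omega>) - (\<integral>x. Re (c * cis (s \<bullet> x)) \<partial>std_gaussian)\<bar> \<partial>M)
      \<le> (\<integral>\<omega>. norm c * norm (?D n \<omega>) \<partial>M)" for n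
  proof (rule integral_mono)
    show "integrable M (\<lambda>\<omega>. \<bar>(\<integral>x. Re (c * cis (s \<bullet> x)) \<partial>\<Lambda> n \<omega>) - (\<integral>x. Re (c * cis (s \<bullet> x)) \<partial>std_gaussian)\<bar>)"
      by (intro integrable_abs Bochner_Integration.integrable_diff integrable_integral_\<Lambda> integrable_const
            trig_poly_measurable trig_poly_bounded trig_poly.trig_poly_basic)
    show "integrable M (\<lambda>\<omega>. norm c * norm (?D n \<omega>))"
      by (intro integrable_mult_right integrable_norm Bochner_Integration.integrable_diff integrable_cis_integral integrable_const)
    fix \<omega> assume \<omega>: "\<omega> \<in> space M"
    have "(\<integral>x. Re (c * cis (s \<bullet> x)) \<partial>\<Lambda> n \<omega>) - (\<integral>x. Re (c * cis (s \<bullet> x)) \<partial>std_gaussian) = Re (c * ?D n \<omega>)"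
      unfolding integral_Re_cis[OF prob_\<Lambda>[OF \<omega>] sets_\<Lambda>[OF \<omega>]]
        integral_Re_cis[OF prob_space_std_gaussian sets_std_gaussian] gaussian_cis
      by (simp only: right_diff_distrib minus_complex.sel)
    then show "\<bar>(\<integral>x. Re (c * cis (s \<bullet> x)) \<partial>\<Lambda> n \<omega>) - (\<integral>x. Re (c * cis (s \<bullet> x)) \<partial>std_gaussian)\<bar> \<le> norm c * norm (?D n \<omega>)"
      using abs_Re_le_cmod[of "c * ?D n \<omega>"] by (simp only: norm_mult)
  qed
  show ?case
  proof (rule tendsto_sandwich[OF _ _ tendsto_const])
    show "(\<lambda>n. \<integral>\<omega>. norm c * norm (?D n \<omega>) \<partial>M) \<longlonglongrightarrow> 0"
      using tendsto_mult_left[OF char_converges, of "norm c"] by simp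
  qed (use bnd in \<open>auto intro!: always_eventually\<close>)
next
  case (trig_poly_add f g)
  note fg = trig_poly_add.hyps[THEN trig_poly_measurable] trig_poly_add.hyps[THEN trig_poly_bounded]
  let ?D = "\<lambda>f n \<omega>. \<bar>(\<integral>x. f x \<partial>\<Lambda> n \<omega>) - (\<integral>x. f x \<partial>std_gaussian)\<bar>"
  have int: "integrable M (?D h n)" if "h \<in> borel_measurable borel" "bounded (range h)" for h :: "real^'n \<Rightarrow> real" and n
    by (intro integrable_abs Bochner_Integration.integrable_diff integrable_integral_\<Lambda>[OF that] integrable_const)
  have bnd: "(\<integral>\<omega>. ?D (\<lambda>x. f x + g x) n \<omega> \<partial>M) \<le> (\<integral>\<omega>. ?D f n \<omega> \<partial>M) + (\<integral>\<omega>. ?D g n \<omega> \<partial>M)" for n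
  proof -
    have "(\<integral>\<omega>. ?D (\<lambda>x. f x + g x) n \<omega> \<partial>M) \<le> (\<integral>\<omega>. ?D f n \<omega> + ?D g n \<omega> \<partial>M)"
    proof (rule integral_mono)
      show "integrable M (?D (\<lambda>x. f x + g x) n)"
        using fg by (intro int borel_measurable_add bounded_plus_comp)
      show "integrable M (\<lambda>\<omega>. ?D f n \<omega> + ?D g n \<omega>)"
        using fg by (intro Bochner_Integration.integrable_add int)
      fix \<omega> assume \<omega>: "\<omega> \<in> space M"
      show "?D (\<lambda>x. f x + g x) n \<omega> \<le> ?D f n \<omega> + ?D g n \<omega>"
      proof -
        have "(\<integral>x. f x + g x \<partial>\<Lambda> n \<omega>) = (\<integral>x. f x \<partial>\<Lambda> n \<omega>) + (\<integral>x. g x \<partial>\<Lambda> n \<omega>)"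
          by (intro Bochner_Integration.integral_add integrable_\<Lambda>[OF _ _ \<omega>] fg)
        moreover have "(\<integral>x. f x + g x \<partial>std_gaussian) = (\<integral>x. f x \<partial>std_gaussian) + (\<integral>x. g x \<partial>std_gaussian)"
          by (intro Bochner_Integration.integral_add integrable_std_gaussian fg)
        ultimately show ?thesis by linarith
      qed
    qed
    also have "\<dots> = (\<integral>\<omega>. ?D f n \<omega> \<partial>M) + (\<integral>\<omega>. ?D g n \<omega> \<partial>M)"
      using fg by (intro Bochner_Integration.integral_add int)
    finally show ?thesis .
  qed
  show ?case
  proof (rule tendsto_sandwich[OF _ _ tendsto_const])
    show "(\<lambda>n. (\<integral>\<omega>. ?D f n \<omega> \<partial>M) + (\<integral>\<omega>. ?D g n \<omega> \<partial>M)) \<longlonglongrightarrow> 0"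
      using tendsto_add[OF trig_poly_add.IH] by simp
  qed (use bnd in \<open>auto intro!: always_eventually\<close>)
qed

text \<open>The characteristic function of a coordinate of \<open>Y n\<close> is the mean of the characteristic function of
\<open>\<Lambda> n\<close> at a multiple of a unit vector, so each coordinate converges weakly to a standard normal
variable by the continuity theorem of Levy.\<close>
lemma Y_coordinate_tail:
  "(\<lambda>n. measure M {\<omega> \<in> space M. L < \<bar>Y n \<omega> $ j\<bar>}) \<longlonglongrightarrow> measure std_normal_distribution {x. L < \<bar>x\<bar>}"
proof -
  let ?\<mu> = "\<lambda>n. distr M borel (\<lambda>\<omega>. Y n \<omega> $ j)"
  have [measurable]: "(\<lambda>\<omega>. Y n \<omega> $ j) \<in> borel_measurable M" for n
    by (rule measurable_compose[OF Y]) (intro borel_measurable_continuous_onI continuous_intros)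
  have rd: "real_distribution (?\<mu> n)" for n
    by (intro real_distribution.intro real_distribution_axioms.intro prob_space_distr) auto
  have ch: "char (?\<mu> n) u = (\<integral>\<omega>. (\<integral>x. cis (axis j u \<bullet> x) \<partial>\<Lambda> n \<omega>) \<partial>M)" for n u
  proof -
    have m: "(\<lambda>x. cis (axis j u \<bullet> x)) \<in> borel_measurable borel"
      by (intro borel_measurable_continuous_onI continuous_intros)
    have Re_eq: "Re (c * (\<integral>\<omega>. (\<integral>x. cis (axis j u \<bullet> x) \<partial>\<Lambda> n \<omega>) \<partial>M)) = Re (c * (\<integral>\<omega>. cis (axis j u \<bullet> Y n \<omega>) \<partial>M))" for c
    proof -
      have "Re (c * (\<integral>\<omega>. (\<integral>x. cis (axis j u \<bullet> x) \<partial>\<Lambda> n \<omega>) \<partial>M)) = (\<integral>\<omega>. Re (c * (\<integral>x. cis (axis j u \<bullet> x) \<partial>\<Lambda> n \<omega>)) \<partial>M)"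
        using integrable_cis_integral[where s = "axis j u" and n = n] by (simp del: times_complex.sel add: integral_Re[symmetric])
      also have "\<dots> = (\<integral>\<omega>. (\<integral>x. Re (c * cis (axis j u \<bullet> x)) \<partial>\<Lambda> n \<omega>) \<partial>M)"
        by (intro Bochner_Integration.integral_cong refl integral_Re_cis[symmetric] prob_\<Lambda> sets_\<Lambda>)
      also have "\<dots> = (\<integral>\<omega>. Re (c * cis (axis j u \<bullet> Y n \<omega>)) \<partial>M)"
        by (intro mean trig_poly_measurable trig_poly_bounded trig_poly.trig_poly_basic)
      also have "\<dots> = Re (c * (\<integral>\<omega>. cis (axis j u \<bullet> Y n \<omega>) \<partial>M))"
      proof -
        have "integrable M (\<lambda>\<omega>. cis (axis j u \<bullet> Y n \<omega>))"
          by (rule integrable_const_bound[where B = 1]) (use measurable_compose[OF Y m] in auto)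
        then show ?thesis by (simp del: times_complex.sel add: integral_Re[symmetric])
      qed
      finally show ?thesis .
    qed
    have "char (?\<mu> n) u = (\<integral>\<omega>. cis (axis j u \<bullet> Y n \<omega>) \<partial>M)"
      by (simp add: char_def integral_distr inner_axis' cis_conv_exp)
    also have "\<dots> = (\<integral>\<omega>. (\<integral>x. cis (axis j u \<bullet> x) \<partial>\<Lambda> n \<omega>) \<partial>M)"
      using Re_eq[of 1] Re_eq[of "- \<i>"] by (simp add: complex_eq_iff)
    finally show ?thesis .
  qed
  have "weak_conv_m ?\<mu> std_normal_distribution"
  proof (rule levy_continuity[OF rd real_dist_normal_dist])
    fix u
    have uu: "(axis j u :: real^'n) \<bullet> axis j u = u\<^sup>2"
      by (simp add: inner_axis' power2_eq_square)
    let ?e = "of_real (exp (- (u\<^sup>2) / 2)) :: complex"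
    have "(\<lambda>n. char (?\<mu> n) u - ?e) \<longlonglongrightarrow> 0"
    proof (rule Lim_null_comparison[OF always_eventually[OF allI]])
      show "(\<lambda>n. \<integral>\<omega>. norm ((\<integral>x. cis (axis j u \<bullet> x) \<partial>\<Lambda> n \<omega>) - ?e) \<partial>M) \<longlonglongrightarrow> 0"
        using char_converges[of "axis j u"] by (simp add: uu)
      fix n
      have "char (?\<mu> n) u - ?e = (\<integral>\<omega>. (\<integral>x. cis (axis j u \<bullet> x) \<partial>\<Lambda> n \<omega>) - ?e \<partial>M)"
        unfolding ch using integrable_cis_integral by (simp add: prob_space)
      then show "norm (char (?\<mu> n) u - ?e) \<le> (\<integral>\<omega>. norm ((\<integral>x. cis (axis j u \<bullet> x) \<partial>\<Lambda> n \<omega>) - ?e) \<partial>M)"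
        by (simp only: integral_norm_bound)
    qed
    then show "(\<lambda>n. char (?\<mu> n) u) \<longlonglongrightarrow> char std_normal_distribution u"
      by (simp add: char_std_normal_distribution LIM_zero_iff)
  qed
  then have "(\<lambda>n. measure (?\<mu> n) {x. L < \<bar>x\<bar>}) \<longlonglongrightarrow> measure std_normal_distribution {x. L < \<bar>x\<bar>}"
  proof (rule weak_conv_imp_continuity_set_conv[OF rd real_dist_normal_dist])
    have "frontier {x::real. L < \<bar>x\<bar>} \<subseteq> {L, - L}"
    proof -
      have "frontier {x::real. L < \<bar>x\<bar>} \<subseteq> {x. \<bar>x\<bar> = L}"
        unfolding frontier_def
      proof
        fix x assume x: "x \<in> closure {x::real. L < \<bar>x\<bar>} - interior {x. L < \<bar>x\<bar>}"
        have "open {x::real. L < \<bar>x\<bar>}" by (intro open_Collect_less continuous_intros)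
        then have "\<not> L < \<bar>x\<bar>" using x by (simp add: interior_open)
        moreover have "closure {x::real. L < \<bar>x\<bar>} \<subseteq> {x. L \<le> \<bar>x\<bar>}"
          by (intro closure_minimal closed_Collect_le continuous_intros) auto
        ultimately show "x \<in> {x. \<bar>x\<bar> = L}" using x by auto
      qed
      then show ?thesis by auto
    qed
    then have "finite (frontier {x::real. L < \<bar>x\<bar>})" by (rule finite_subset) simp
    then have null: "frontier {x::real. L < \<bar>x\<bar>} \<in> null_sets lborel"
      by (rule finite_imp_null_set_lborel)
    have "AE x in lborel. x \<in> frontier {x::real. L < \<bar>x\<bar>} \<longrightarrow> ennreal (std_normal_density x) = 0"
      using AE_not_in[OF null] by eventually_elim simp
    then show "emeasure std_normal_distribution (frontier {x. L < \<bar>x\<bar>}) = 0"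
      using null by (intro null_setsD1) (simp add: null_sets_density_iff)
  qed measurable
  then show ?thesis
    by (simp add: measure_distr vimage_def Int_def conj_commute)
qed

text \<open>Replace \<open>f\<close> by a trigonometric polynomial \<open>g\<close> that is close to it on a cube. The error is at most
\<open>\<eta>\<close> on the cube and at most \<open>2 b + 1\<close> outside, which the function \<open>q\<close> in the proof records. Its mean
integral against \<open>\<Lambda> n\<close> is the expectation of \<open>q (Y n)\<close>, which is small because the coordinates of
\<open>Y n\<close> have normal tails in the limit.\<close>
theorem bounded_continuous_converges:
  fixes f :: "real^'n \<Rightarrow> real"
  assumes f: "continuous_on UNIV f" and bdd: "bounded (range f)"
  shows "(\<lambda>n. \<integral>\<omega>. \<bar>(\<integral>x. f x \<partial>\<Lambda> n \<omega>) - (\<integral>x. f x \<partial>std_gaussian)\<bar> \<partial>M) \<longlonglongrightarrow> 0"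
proof (rule order_tendstoI)
  fix e :: real assume "e < 0"
  then show "eventually (\<lambda>n. e < (\<integral>\<omega>. \<bar>(\<integral>x. f x \<partial>\<Lambda> n \<omega>) - (\<integral>x. f x \<partial>std_gaussian)\<bar> \<partial>M)) sequentially"
    by (intro always_eventually allI) (rule less_le_trans, assumption, simp)
next
  fix e :: real assume e: "e > 0"
  obtain b where b: "\<And>x. \<bar>f x\<bar> \<le> b" using bdd by (auto simp: bounded_iff)
  have b0: "b \<ge> 0" using b[of 0] by simp
  have fm: "f \<in> borel_measurable borel" using f by (rule borel_measurable_continuous_onI)
  define d where "d = real CARD('n)"
  define C where "C = 2 + 2 * (2 * b + 1) * d"
  have C: "C > 0" using b0 by (simp add: C_def d_def add_pos_nonneg)
  \<comment> \<open>\<open>C * \<eta>\<close> will bound the error of replacing \<open>f\<close> by \<open>g\<close> under both measures together.\<close>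
  define \<eta> where "\<eta> = min 1 (e / (2 * C))"
  have \<eta>: "\<eta> > 0" "\<eta> \<le> 1" "C * \<eta> \<le> e / 2"
    using e C by (auto simp: \<eta>_def min_def field_simps)
  let ?T = "\<lambda>(k::nat) j. {x :: real^'n. real k < \<bar>x $ j\<bar>}"
  have coord: "(\<lambda>x::real^'n. x $ j) \<in> borel_measurable borel" for j
    by (intro borel_measurable_continuous_onI continuous_intros)
  have T [measurable]: "?T k j \<in> sets borel" for k j
    using coord[of j] by measurable
  have "eventually (\<lambda>k. \<forall>j. measure std_gaussian (?T k j) < \<eta> \<and> measure std_normal_distribution {x. real k < \<bar>x\<bar>} < \<eta>) sequentially"
  proof (intro eventually_all_finite eventually_conj)
    show "eventually (\<lambda>k. measure std_gaussian (?T k j) < \<eta>) sequentially" for j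
      using order_tendstoD(2)[OF prob_space_tail_tendsto_0[OF prob_space_std_gaussian, of "\<lambda>x. \<bar>x $ j\<bar>"] \<eta>(1)] coord[of j]
      by simp
    have "prob_space std_normal_distribution"
      using real_dist_normal_dist by (simp add: real_distribution_def)
    from order_tendstoD(2)[OF prob_space_tail_tendsto_0[OF this, of "\<lambda>x. \<bar>x\<bar>"] \<eta>(1)]
    show "eventually (\<lambda>k. measure std_normal_distribution {x. real k < \<bar>x\<bar>} < \<eta>) sequentially"
      by simp
  qed
  then obtain k where k: "\<And>j. measure std_gaussian (?T k j) < \<eta>" "measure std_normal_distribution {x. real k < \<bar>x\<bar>} < \<eta>"
    by (auto simp: eventually_sequentially)
  obtain g where g: "trig_poly g" "\<And>x. (\<And>i. \<bar>x $ i\<bar> \<le> real k + 1) \<Longrightarrow> \<bar>f x - g x\<bar> < \<eta>" "\<And>x. \<bar>g x\<bar> < b + \<eta>"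
    using trig_poly_approx[OF f b, of "real k + 1" \<eta>] \<eta>(1) by auto
  note gm = trig_poly_measurable[OF g(1)] and gb = trig_poly_bounded[OF g(1)]
  define q where "q x = \<eta> + (2 * b + 1) * (\<Sum>j\<in>UNIV. indicator (?T k j) x)" for x :: "real^'n"
  have qm: "q \<in> borel_measurable borel" unfolding q_def by measurable
  have qb: "bounded (range q)"
  proof -
    have "\<bar>q x\<bar> \<le> \<eta> + (2 * b + 1) * (\<Sum>j\<in>(UNIV::'n set). 1)" for x
    proof -
      have "0 \<le> (\<Sum>j\<in>UNIV. indicator (?T k j) x :: real)" by (rule sum_nonneg) simp
      moreover have "(\<Sum>j\<in>UNIV. indicator (?T k j) x :: real) \<le> (\<Sum>j\<in>(UNIV::'n set). 1)"
        by (rule sum_mono) (simp only: indicator_le_1)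
      ultimately have "0 \<le> (2 * b + 1) * (\<Sum>j\<in>UNIV. indicator (?T k j) x)"
        "(2 * b + 1) * (\<Sum>j\<in>UNIV. indicator (?T k j) x) \<le> (2 * b + 1) * (\<Sum>j\<in>(UNIV::'n set). 1)"
        using b0 by (auto intro!: mult_nonneg_nonneg mult_left_mono simp del: sum_constant)
      then show ?thesis unfolding q_def using \<eta>(1) by (simp only: abs_of_nonneg add_nonneg_nonneg less_imp_le add_left_mono)
    qed
    then show ?thesis by (auto simp: bounded_iff)
  qed
  have fgq: "\<bar>f x - g x\<bar> \<le> q x" for x
  proof (cases "\<exists>j. real k < \<bar>x $ j\<bar>")
    case True
    then obtain j where j: "x \<in> ?T k j" by auto
    have "1 \<le> (\<Sum>j\<in>UNIV. indicator (?T k j) x :: real)"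
      using member_le_sum[of j UNIV "\<lambda>j. indicator (?T k j) x :: real"] j by simp
    then have "(2 * b + 1) * 1 \<le> (2 * b + 1) * (\<Sum>j\<in>UNIV. indicator (?T k j) x)"
      using b0 by (intro mult_left_mono) auto
    moreover have "\<bar>f x - g x\<bar> \<le> 2 * b + 1" using b[of x] g(3)[of x] \<eta>(2) by linarith
    ultimately show ?thesis unfolding q_def using \<eta>(1) by (intro add_increasing) (auto intro: order_trans)
  next
    case False
    then have "\<bar>f x - g x\<bar> < \<eta>" by (intro g(2)) (auto simp: not_less intro: order_trans)
    moreover have "0 \<le> (2 * b + 1) * (\<Sum>j\<in>UNIV. indicator (?T k j) x)"
      using b0 by (intro mult_nonneg_nonneg sum_nonneg) auto
    ultimately show ?thesis unfolding q_def by (intro add_increasing2) auto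
  qed
  have diff: "\<bar>(\<integral>x. f x \<partial>P) - (\<integral>x. g x \<partial>P)\<bar> \<le> (\<integral>x. q x \<partial>P)"
    if P: "integrable P f" "integrable P g" "integrable P q" for P
  proof -
    have "\<bar>(\<integral>x. f x \<partial>P) - (\<integral>x. g x \<partial>P)\<bar> = \<bar>\<integral>x. f x - g x \<partial>P\<bar>" using P by simp
    also have "\<dots> \<le> (\<integral>x. \<bar>f x - g x\<bar> \<partial>P)" by (rule integral_abs_bound)
    also have "\<dots> \<le> (\<integral>x. q x \<partial>P)" using P fgq by (intro integral_mono) auto
    finally show ?thesis .
  qed
  have q_int: "(\<integral>\<omega>. q (W \<omega>) \<partial>P) = \<eta> + (2 * b + 1) * (\<Sum>j\<in>UNIV. measure P {\<omega> \<in> space P. real k < \<bar>W \<omega> $ j\<bar>})"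
    if P: "prob_space P" and W: "W \<in> borel_measurable P" for P :: "'z measure" and W
  proof -
    interpret P: prob_space P by fact
    have TW: "{\<omega> \<in> space P. real k < \<bar>W \<omega> $ j\<bar>} \<in> sets P" for j
      using measurable_sets[OF W T[of k j]] by (simp add: vimage_def Int_def conj_commute)
    have "(\<integral>\<omega>. q (W \<omega>) \<partial>P) = (\<integral>\<omega>. \<eta> + (2 * b + 1) * (\<Sum>j\<in>UNIV. indicator {\<omega> \<in> space P. real k < \<bar>W \<omega> $ j\<bar>} \<omega>) \<partial>P)"
      by (intro Bochner_Integration.integral_cong) (auto simp: q_def indicator_def)
    also have "\<dots> = \<eta> + (2 * b + 1) * (\<Sum>j\<in>UNIV. measure P {\<omega> \<in> space P. real k < \<bar>W \<omega> $ j\<bar>})"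
      using TW by (simp add: P.prob_space P.emeasure_eq_measure)
    finally show ?thesis .
  qed
  have bound: "(\<integral>\<omega>. \<bar>(\<integral>x. f x \<partial>\<Lambda> n \<omega>) - (\<integral>x. f x \<partial>std_gaussian)\<bar> \<partial>M) \<le>
      (\<integral>\<omega>. q (Y n \<omega>) \<partial>M) + (\<integral>\<omega>. \<bar>(\<integral>x. g x \<partial>\<Lambda> n \<omega>) - (\<integral>x. g x \<partial>std_gaussian)\<bar> \<partial>M) + (\<integral>x. q x \<partial>std_gaussian)" for n
  proof -
    note I = integrable_integral_\<Lambda>[OF fm bdd] integrable_integral_\<Lambda>[OF gm gb] integrable_integral_\<Lambda>[OF qm qb]
    have "(\<integral>\<omega>. \<bar>(\<integral>x. f x \<partial>\<Lambda> n \<omega>) - (\<integral>x. f x \<partial>std_gaussian)\<bar> \<partial>M) \<le>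
      (\<integral>\<omega>. (\<integral>x. q x \<partial>\<Lambda> n \<omega>) + \<bar>(\<integral>x. g x \<partial>\<Lambda> n \<omega>) - (\<integral>x. g x \<partial>std_gaussian)\<bar> + (\<integral>x. q x \<partial>std_gaussian) \<partial>M)"
    proof (rule integral_mono)
      fix \<omega> assume \<omega>: "\<omega> \<in> space M"
      show "\<bar>(\<integral>x. f x \<partial>\<Lambda> n \<omega>) - (\<integral>x. f x \<partial>std_gaussian)\<bar> \<le>
         (\<integral>x. q x \<partial>\<Lambda> n \<omega>) + \<bar>(\<integral>x. g x \<partial>\<Lambda> n \<omega>) - (\<integral>x. g x \<partial>std_gaussian)\<bar> + (\<integral>x. q x \<partial>std_gaussian)"
        using diff[of "\<Lambda> n \<omega>"] diff[of std_gaussian] integrable_\<Lambda>[OF fm bdd \<omega>] integrable_\<Lambda>[OF gm gb \<omega>]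
          integrable_\<Lambda>[OF qm qb \<omega>] integrable_std_gaussian[OF fm bdd]
          integrable_std_gaussian[OF gm gb] integrable_std_gaussian[OF qm qb] by force
    qed (use I in auto)
    also have "\<dots> = (\<integral>\<omega>. (\<integral>x. q x \<partial>\<Lambda> n \<omega>) \<partial>M) + (\<integral>\<omega>. \<bar>(\<integral>x. g x \<partial>\<Lambda> n \<omega>) - (\<integral>x. g x \<partial>std_gaussian)\<bar> \<partial>M) + (\<integral>x. q x \<partial>std_gaussian)"
      using I by (simp add: prob_space)
    finally show ?thesis by (simp add: mean[OF qm qb])
  qed
  define \<beta> where "\<beta> = \<eta> + (2 * b + 1) * (d * \<eta>)"
  have sum_le: "\<eta> + (2 * b + 1) * (\<Sum>j\<in>UNIV. m j) \<le> \<beta>" if "\<And>j. m j < \<eta>" for m :: "'n \<Rightarrow> real"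
  proof -
    have "(\<Sum>j\<in>UNIV. m j) \<le> (\<Sum>j\<in>(UNIV::'n set). \<eta>)"
      by (rule sum_mono) (rule less_imp_le[OF that])
    then show ?thesis unfolding \<beta>_def using b0 by (intro add_left_mono mult_left_mono) (auto simp: d_def)
  qed
  have q\<Phi>: "(\<integral>x. q x \<partial>std_gaussian) \<le> \<beta>"
    using q_int[OF prob_space_std_gaussian, of "\<lambda>x. x"] sum_le[OF k(1)] by simp
  have "eventually (\<lambda>n. \<forall>j. measure M {\<omega> \<in> space M. real k < \<bar>Y n \<omega> $ j\<bar>} < \<eta>) sequentially"
    by (intro eventually_all_finite order_tendstoD(2)[OF Y_coordinate_tail k(2)])
  moreover have "eventually (\<lambda>n. (\<integral>\<omega>. \<bar>(\<integral>x. g x \<partial>\<Lambda> n \<omega>) - (\<integral>x. g x \<partial>std_gaussian)\<bar> \<partial>M) < e / 2) sequentially"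
    using order_tendstoD(2)[OF trig_poly_converges[OF g(1)], of "e / 2"] e by simp
  ultimately show "eventually (\<lambda>n. (\<integral>\<omega>. \<bar>(\<integral>x. f x \<partial>\<Lambda> n \<omega>) - (\<integral>x. f x \<partial>std_gaussian)\<bar> \<partial>M) < e) sequentially"
  proof eventually_elim
    case (elim n)
    have "(\<integral>\<omega>. q (Y n \<omega>) \<partial>M) \<le> \<beta>"
      unfolding q_int[OF prob_space_axioms Y] using elim(1) by (intro sum_le) auto
    moreover have "2 * \<beta> = C * \<eta>" by (simp add: \<beta>_def C_def algebra_simps)
    ultimately show ?case using bound[of n] q\<Phi> elim(2) \<eta>(3) by linarith
  qed
qed

end

section \<open>Convergence in probability in the weak topology\<close>

lemma integral_preimage_openin_weak_topology:
  fixes f :: "'c::topological_space \<Rightarrow> real"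
  assumes "continuous_on UNIV f" "bounded (range f)" "open G"
  shows "openin weak_topology {P \<in> borel_prob_measures. (\<integral>x. f x \<partial>P) \<in> G}"
  unfolding weak_topology_def openin_topology_generated_by_iff
  using assms by (intro generate_topology_on.Basis) blast

text \<open>For every open set \<open>G\<close> around the limit, the probability that \<open>\<Lambda> n\<close> lies outside \<open>G\<close> tends to 0: for
the generating sets this is Markov's inequality, and the property passes to finite intersections
and to unions. The balls of any metric that induces the topology are such open sets.\<close>
lemma tendsto_in_prob_weak_topologyI:
  fixes \<Lambda> :: "nat \<Rightarrow> 'a \<Rightarrow> 'c::topological_space measure"
  assumes M: "prob_space M" and l: "l \<in> borel_prob_measures"
    and meas: "eventually (\<lambda>n. \<Lambda> n \<in> measurable M (borel_of weak_topology)) sequentially"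
    and conv: "\<And>f::'c \<Rightarrow> real. continuous_on UNIV f \<Longrightarrow> bounded (range f) \<Longrightarrow>
      (\<lambda>n. \<integral>\<omega>. \<bar>(\<integral>x. f x \<partial>\<Lambda> n \<omega>) - (\<integral>x. f x \<partial>l)\<bar> \<partial>M) \<longlonglongrightarrow> 0"
  shows "tendsto_in_prob M weak_topology \<Lambda> l"
proof -
  interpret prob_space M by fact
  have sub: "G \<subseteq> borel_prob_measures" if "openin weak_topology G" for G :: "'c measure set"
    using openin_subset[OF that] by (simp add: topspace_weak_topology)
  have space_bo: "space (borel_of (weak_topology :: 'c measure topology)) = borel_prob_measures"
    unfolding borel_of_def by (subst space_measure_of) (auto simp: topspace_weak_topology dest: sub)
  have open_sets: "G \<in> sets (borel_of (weak_topology :: 'c measure topology))" if "openin weak_topology G" for G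
    unfolding borel_of_def using that by (intro in_measure_of) (auto simp: topspace_weak_topology dest: sub)
  \<comment> \<open>The event \<open>\<Lambda> n \<notin> G\<close> is enclosed in a measurable set \<open>A\<close> so that no measurability has to be carried through the induction.\<close>
  have escape: "\<forall>e>0. eventually (\<lambda>n. \<exists>A\<in>sets M. {\<omega> \<in> space M. \<Lambda> n \<omega> \<notin> G} \<subseteq> A \<and> measure M A < e) sequentially"
    if "openin weak_topology G" "l \<in> G" for G
    using that unfolding weak_topology_def openin_topology_generated_by_iff
  proof (induction rule: generate_topology_on.induct)
    case (Int G H)
    show ?case
    proof (intro allI impI)
      fix e :: real assume "e > 0"
      then have e2: "e / 2 > 0" by simp
      have "eventually (\<lambda>n. \<exists>A\<in>sets M. {\<omega> \<in> space M. \<Lambda> n \<omega> \<notin> G} \<subseteq> A \<and> measure M A < e / 2) sequentially"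
        "eventually (\<lambda>n. \<exists>A\<in>sets M. {\<omega> \<in> space M. \<Lambda> n \<omega> \<notin> H} \<subseteq> A \<and> measure M A < e / 2) sequentially"
        using Int.IH(1)[THEN spec, THEN mp, OF _ e2] Int.IH(2)[THEN spec, THEN mp, OF _ e2] Int.prems by blast+
      then show "eventually (\<lambda>n. \<exists>A\<in>sets M. {\<omega> \<in> space M. \<Lambda> n \<omega> \<notin> G \<inter> H} \<subseteq> A \<and> measure M A < e) sequentially"
      proof eventually_elim
        case (elim n)
        then obtain A B where AB: "A \<in> sets M" "{\<omega> \<in> space M. \<Lambda> n \<omega> \<notin> G} \<subseteq> A" "measure M A < e / 2"
           "B \<in> sets M" "{\<omega> \<in> space M. \<Lambda> n \<omega> \<notin> H} \<subseteq> B" "measure M B < e / 2" by blast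
        have "measure M (A \<union> B) \<le> measure M A + measure M B"
          using AB by (intro measure_Un_le)
        then show ?case using AB by (intro bexI[of _ "A \<union> B"]) auto
      qed
    qed
  next
    case (UN K)
    then obtain G where G: "G \<in> K" "l \<in> G" by blast
    show ?case
    proof (intro allI impI)
      fix e :: real assume "e > 0"
      then have "eventually (\<lambda>n. \<exists>A\<in>sets M. {\<omega> \<in> space M. \<Lambda> n \<omega> \<notin> G} \<subseteq> A \<and> measure M A < e) sequentially"
        using UN.IH[OF G] by blast
      then show "eventually (\<lambda>n. \<exists>A\<in>sets M. {\<omega> \<in> space M. \<Lambda> n \<omega> \<notin> \<Union>K} \<subseteq> A \<and> measure M A < e) sequentially"
        by eventually_elim (use G in blast)
    qed
  next
    case (Basis H)
    then obtain f :: "'c \<Rightarrow> real" and G where H: "H = {P \<in> borel_prob_measures. (\<integral>x. f x \<partial>P) \<in> G}"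
      and f: "continuous_on UNIV f" "bounded (range f)" "open G" by blast
    have "(\<integral>x. f x \<partial>l) \<in> G" using Basis H by simp
    then obtain \<delta> where \<delta>: "\<delta> > 0" "ball (\<integral>x. f x \<partial>l) \<delta> \<subseteq> G"
      using f(3) by (auto simp: open_contains_ball)
    obtain b where b: "\<And>x. \<bar>f x\<bar> \<le> b" using f(2) by (auto simp: bounded_iff)
    have b0: "b \<ge> 0" using order_trans[OF abs_ge_zero b] .
    show ?case
    proof (intro allI impI)
      fix e :: real assume e: "e > 0"
      have "eventually (\<lambda>n. (\<integral>\<omega>. \<bar>(\<integral>x. f x \<partial>\<Lambda> n \<omega>) - (\<integral>x. f x \<partial>l)\<bar> \<partial>M) < e * \<delta>) sequentially"
        using conv[OF f(1,2)] e \<delta>(1) by (intro order_tendstoD(2)) auto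
      with meas show "eventually (\<lambda>n. \<exists>A\<in>sets M. {\<omega> \<in> space M. \<Lambda> n \<omega> \<notin> H} \<subseteq> A \<and> measure M A < e) sequentially"
      proof eventually_elim
        case (elim n)
        have in_P: "\<Lambda> n \<omega> \<in> borel_prob_measures" if "\<omega> \<in> space M" for \<omega>
          using measurable_space[OF elim(1) that] by (simp add: space_bo)
        have I [measurable]: "(\<lambda>\<omega>. \<integral>x. f x \<partial>\<Lambda> n \<omega>) \<in> borel_measurable M"
        proof (rule borel_measurableI)
          fix G :: "real set" assume "open G"
          then have "{P \<in> borel_prob_measures. (\<integral>x. f x \<partial>P) \<in> G} \<in> sets (borel_of weak_topology)"
            by (intro open_sets integral_preimage_openin_weak_topology f)
          from measurable_sets[OF elim(1) this]
          show "(\<lambda>\<omega>. \<integral>x. f x \<partial>\<Lambda> n \<omega>) -` G \<inter> space M \<in> sets M"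
            using in_P by (elim back_subst[of "\<lambda>A. A \<in> sets M"]) auto
        qed
        let ?D = "\<lambda>\<omega>. \<bar>(\<integral>x. f x \<partial>\<Lambda> n \<omega>) - (\<integral>x. f x \<partial>l)\<bar>"
        have le_b: "\<bar>\<integral>x. f x \<partial>P\<bar> \<le> b" if "P \<in> borel_prob_measures" for P
        proof -
          have [measurable_cong]: "sets P = sets borel" using that by (simp add: borel_prob_measures_def)
          have "f \<in> borel_measurable borel" using f(1) by (rule borel_measurable_continuous_onI)
          then have "f \<in> borel_measurable P" by measurable
          then show ?thesis
            using prob_space_bounded_integral(2)[of P f b] that b by (simp add: borel_prob_measures_def)
        qed
        have int: "integrable M ?D"
        proof (rule integrable_const_bound[where B = "2 * b"])
          show "AE \<omega> in M. norm (?D \<omega>) \<le> 2 * b"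
          proof (rule AE_I2)
            fix \<omega> assume "\<omega> \<in> space M"
            then show "norm (?D \<omega>) \<le> 2 * b" using le_b[OF in_P] le_b[OF l] by fastforce
          qed
        qed measurable
        have A: "{\<omega> \<in> space M. \<delta> \<le> ?D \<omega>} \<in> sets M" by measurable
        have "measure M {\<omega> \<in> space M. \<delta> \<le> ?D \<omega>} \<le> (\<integral>\<omega>. ?D \<omega> \<partial>M) / \<delta>"
          by (rule integral_Markov_inequality_measure[OF int sets.top]) (use \<delta>(1) in auto)
        also have "\<dots> < e" using elim(2) \<delta>(1) by (simp add: divide_less_eq)
        finally have "measure M {\<omega> \<in> space M. \<delta> \<le> ?D \<omega>} < e" .
        moreover have "{\<omega> \<in> space M. \<Lambda> n \<omega> \<notin> H} \<subseteq> {\<omega> \<in> space M. \<delta> \<le> ?D \<omega>}"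
        proof clarify
          fix \<omega> assume \<omega>: "\<omega> \<in> space M" "\<Lambda> n \<omega> \<notin> H"
          then have "(\<integral>x. f x \<partial>\<Lambda> n \<omega>) \<notin> ball (\<integral>x. f x \<partial>l) \<delta>"
            using \<delta>(2) in_P by (auto simp: H)
          then show "\<delta> \<le> ?D \<omega>" by (simp add: dist_real_def abs_minus_commute not_less)
        qed
        ultimately show ?case using A by blast
      qed
    qed
  qed simp
  show ?thesis
    unfolding tendsto_in_prob_def
  proof (intro conjI allI impI)
    show "l \<in> topspace weak_topology" using l by (simp add: topspace_weak_topology)
    show "eventually (\<lambda>n. \<Lambda> n \<in> measurable M (borel_of weak_topology)) sequentially" by (rule meas)
    fix \<rho> :: "'c measure \<Rightarrow> 'c measure \<Rightarrow> real" and \<epsilon> :: real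
    assume "Metric_space (topspace weak_topology) \<rho> \<and> Metric_space.mtopology (topspace weak_topology) \<rho> = weak_topology"
      and \<epsilon>: "0 < \<epsilon>"
    then have ms: "Metric_space (topspace weak_topology) \<rho>"
      and mt: "Metric_space.mtopology (topspace weak_topology) \<rho> = weak_topology" by blast+
    interpret Metric_space "topspace weak_topology" \<rho> by (rule ms)
    have "openin weak_topology (mball l \<epsilon>)"
      using openin_mball[of l \<epsilon>] unfolding mt .
    moreover have "l \<in> mball l \<epsilon>"
      using l \<epsilon> centre_in_mball_iff[of l \<epsilon>] by (simp only: topspace_weak_topology)
    ultimately have esc: "\<forall>e>0. eventually (\<lambda>n. \<exists>A\<in>sets M. {\<omega> \<in> space M. \<Lambda> n \<omega> \<notin> mball l \<epsilon>} \<subseteq> A \<and> measure M A < e) sequentially"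
      by (rule escape)
    show "(\<lambda>n. measure M {\<omega> \<in> space M. \<epsilon> < \<rho> (\<Lambda> n \<omega>) l}) \<longlonglongrightarrow> 0"
    proof (rule order_tendstoI)
      fix a :: real assume "a < 0"
      then show "eventually (\<lambda>n. a < measure M {\<omega> \<in> space M. \<epsilon> < \<rho> (\<Lambda> n \<omega>) l}) sequentially"
        by (intro always_eventually allI) (rule less_le_trans, assumption, simp)
    next
      fix e :: real assume "e > 0"
      then have "eventually (\<lambda>n. \<exists>A\<in>sets M. {\<omega> \<in> space M. \<Lambda> n \<omega> \<notin> mball l \<epsilon>} \<subseteq> A \<and> measure M A < e) sequentially"
        using esc by blast
      then show "eventually (\<lambda>n. measure M {\<omega> \<in> space M. \<epsilon> < \<rho> (\<Lambda> n \<omega>) l} < e) sequentially"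
      proof eventually_elim
        case (elim n)
        then obtain A where A: "A \<in> sets M" "{\<omega> \<in> space M. \<Lambda> n \<omega> \<notin> mball l \<epsilon>} \<subseteq> A" "measure M A < e" by blast
        have "{\<omega> \<in> space M. \<epsilon> < \<rho> (\<Lambda> n \<omega>) l} \<subseteq> {\<omega> \<in> space M. \<Lambda> n \<omega> \<notin> mball l \<epsilon>}"
          using commute[of l] by auto
        then have "measure M {\<omega> \<in> space M. \<epsilon> < \<rho> (\<Lambda> n \<omega>) l} \<le> measure M A"
          using A by (intro finite_measure_mono) auto
        with A(3) show ?case by simp
      qed
    qed
  qed
qed

section \<open>Asymptotics of the growth factor\<close>

lemma norm_exp_sub_linear:
  fixes z :: complex
  assumes "norm z \<le> 1"
  shows "norm (exp z - (1 + z)) \<le> 3 * (norm z)\<^sup>2"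
proof -
  have "norm (exp z - (1 + z)) \<le> exp \<bar>Re z\<bar> * (norm z)\<^sup>2"
    using Taylor_exp[of z 1] by (simp add: numeral_2_eq_2)
  also have "exp \<bar>Re z\<bar> \<le> exp 1"
    using abs_Re_le_cmod[of z] assms by simp
  also have "exp 1 \<le> (3::real)" by (rule exp_le)
  finally show ?thesis by (simp add: mult_right_mono)
qed

lemma inverse_square_le_telescope:
  "1 / (real n + 2)\<^sup>2 \<le> 1 / (real n + 1) - 1 / (real n + 2)"
proof -
  have "1 / (real n + 2)\<^sup>2 \<le> 1 / ((real n + 1) * (real n + 2))"
    unfolding power2_eq_square by (intro frac_le mult_mono) auto
  also have "\<dots> = 1 / (real n + 1) - 1 / (real n + 2)"
    by (simp add: field_simps)
  finally show ?thesis .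
qed

lemma sum_inverse_squares_le: "(\<Sum>k=1..n. 1 / (real k + 1)\<^sup>2) \<le> 1 - 1 / (real n + 1)"
proof (induction n)
  case (Suc n)
  then show ?case using inverse_square_le_telescope[of n] by (simp add: add.commute)
qed simp

lemma prod_Suc_ratio: "(\<Prod>k=1..n. 1 + (1 + \<delta>) / of_nat k) / (of_nat n + 1) = (\<Prod>k=1..n. 1 + \<delta> / (of_nat k + 1 :: complex))"
proof (induction n)
  case (Suc n)
  have nz: "(of_nat n + 1 :: complex) \<noteq> 0" "(of_nat n + 2 :: complex) \<noteq> 0"
    by (metis of_nat_Suc of_nat_eq_0_iff add.commute nat.distinct(1), 
        metis of_nat_Suc of_nat_add of_nat_eq_0_iff of_nat_numeral add_2_eq_Suc' nat.distinct(1))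
  have frac: "A * t / y = A / z * (t * z / y)" if "z \<noteq> 0" for A t y z :: complex
    using that by simp
  have simplify: "(1 + (1 + \<delta>) / z) * z / (z + 1) = 1 + \<delta> / (z + 1)" if "z \<noteq> 0" "z + 1 \<noteq> 0" for z
  proof -
    have "(1 + (1 + \<delta>) / z) * z = (z + 1) + \<delta>"
      using that(1) by (simp add: distrib_right add_divide_distrib)
    then show ?thesis using that(2) by (simp add: add_divide_distrib)
  qed
  have "(\<Prod>k=1..Suc n. 1 + (1 + \<delta>) / of_nat k) / (of_nat (Suc n) + 1) =
     (\<Prod>k=1..n. 1 + (1 + \<delta>) / of_nat k) * (1 + (1 + \<delta>) / of_nat (Suc n)) / (of_nat n + 2)"
    by simp
  also have "\<dots> =
     (\<Prod>k=1..n. 1 + (1 + \<delta>) / of_nat k) / (of_nat n + 1) * ((1 + (1 + \<delta>) / of_nat (Suc n)) * (of_nat n + 1) / (of_nat n + 2))"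
    by (rule frac[OF nz(1)])
  also have "(1 + (1 + \<delta>) / of_nat (Suc n)) * (of_nat n + 1) / (of_nat n + 2) = 1 + \<delta> / (of_nat (Suc n) + 1)"
    using simplify[of "of_nat (Suc n)"] nz by (simp add: add_ac)
  finally show ?case unfolding Suc.IH by simp
qed simp

text \<open>For \<open>\<phi> = 1 + \<delta>\<close> with \<open>\<bar>\<phi>\<bar> \<le> 1\<close>, the product \<open>\<Prod>k\<le>n. (1 + \<phi>/k)\<close> divided by \<open>n + 1\<close> equals
\<open>\<Prod>k\<le>n. (1 + \<delta>/(k+1))\<close>. Its factors and the numbers \<open>exp (\<delta>/(k+1))\<close> lie in the closed unit disc
and differ by \<open>O(\<bar>\<delta>\<bar>\<^sup>2/(k+1)\<^sup>2)\<close>, so both products differ by \<open>O(\<bar>\<delta>\<bar>\<^sup>2)\<close> uniformly in \<open>n\<close>. The product of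
the exponentials is \<open>exp (\<delta> h\<^sub>n)\<close> with \<open>h\<^sub>n = log n + O(1)\<close>. The uniformity in \<open>n\<close> matters, because
\<open>\<delta>\<close> depends on \<open>n\<close> in the application.\<close>
lemma growth_product_asymptotics:
  fixes \<delta> :: "nat \<Rightarrow> complex" and \<theta> :: "nat \<Rightarrow> real"
  assumes \<delta>: "\<delta> \<longlonglongrightarrow> 0" and le1: "\<And>n. norm (1 + \<delta> n) \<le> 1"
    and c: "(\<lambda>n. \<delta> n * of_real (ln (real n)) - \<i> * of_real (\<theta> n)) \<longlonglongrightarrow> c"
  shows "(\<lambda>n. cis (- \<theta> n) * ((\<Prod>k=1..n. 1 + (1 + \<delta> n) / of_nat k) / (of_nat n + 1))) \<longlonglongrightarrow> exp c"
proof -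
  define P where "P n = (\<Prod>k=1..n. 1 + \<delta> n / (of_nat k + 1))" for n
  define h :: "nat \<Rightarrow> real" where "h n = (\<Sum>k=1..n. 1 / (real k + 1))" for n
  have Re\<delta>: "Re (\<delta> n) \<le> 0" for n
    using complex_Re_le_cmod[of "1 + \<delta> n"] le1[of n] by simp
  have approx: "norm (P n - exp (\<delta> n * of_real (h n))) \<le> 3 * (norm (\<delta> n))\<^sup>2" if small: "norm (\<delta> n) \<le> 1" for n
  proof -
    have "exp (\<delta> n * of_real (h n)) = (\<Prod>k=1..n. exp (\<delta> n / (of_nat k + 1)))"
      by (simp add: exp_sum[symmetric] h_def sum_distrib_left)
    then have "norm (P n - exp (\<delta> n * of_real (h n))) =
        norm ((\<Prod>k=1..n. exp (\<delta> n / (of_nat k + 1))) - (\<Prod>k=1..n. 1 + \<delta> n / (of_nat k + 1)))"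
      by (simp add: P_def norm_minus_commute)
    also have "\<dots> \<le> (\<Sum>k=1..n. norm (exp (\<delta> n / (of_nat k + 1)) - (1 + \<delta> n / (of_nat k + 1))))"
    proof (rule norm_prod_diff)
      fix k assume "k \<in> {1..n}"
      have k: "(of_nat k + 1 :: complex) = of_real (real k + 1)" by simp
      have "Re (\<delta> n / (of_nat k + 1)) \<le> 0"
        unfolding k Re_divide_of_real using Re\<delta>[of n] by (simp add: divide_nonpos_pos)
      then show "norm (exp (\<delta> n / (of_nat k + 1))) \<le> 1" by simp
      have nz: "(of_nat k + 1 :: complex) \<noteq> 0"
        by (metis add.commute of_nat_Suc of_nat_eq_0_iff nat.distinct(1))
      have "1 + \<delta> n / (of_nat k + 1) = (of_nat k + (1 + \<delta> n)) / (of_nat k + 1)"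
        using nz by (simp add: field_simps)
      moreover have "norm (of_nat k + (1 + \<delta> n)) \<le> real k + 1"
        using norm_triangle_ineq[of "of_nat k" "1 + \<delta> n"] le1[of n] by simp
      moreover have "norm (of_nat k + 1 :: complex) = real k + 1"
        unfolding k norm_of_real by simp
      ultimately show "norm (1 + \<delta> n / (of_nat k + 1)) \<le> 1"
        by (simp add: norm_divide)
    qed
    also have "\<dots> \<le> (\<Sum>k=1..n. 3 * (norm (\<delta> n))\<^sup>2 * (1 / (real k + 1)\<^sup>2))"
    proof (rule sum_mono)
      fix k assume "k \<in> {1..n}"
      have k: "(of_nat k + 1 :: complex) = of_real (real k + 1)" by simp
      have n: "norm (\<delta> n / (of_nat k + 1)) = norm (\<delta> n) / (real k + 1)"
        unfolding k norm_divide norm_of_real by simp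
      show "norm (exp (\<delta> n / (of_nat k + 1)) - (1 + \<delta> n / (of_nat k + 1))) \<le> 3 * (norm (\<delta> n))\<^sup>2 * (1 / (real k + 1)\<^sup>2)"
        using norm_exp_sub_linear[of "\<delta> n / (of_nat k + 1)"] small unfolding n
        by (simp add: power_divide divide_le_eq)
    qed
    also have "\<dots> = 3 * (norm (\<delta> n))\<^sup>2 * (\<Sum>k=1..n. 1 / (real k + 1)\<^sup>2)"
      by (simp add: sum_distrib_left)
    also have "\<dots> \<le> 3 * (norm (\<delta> n))\<^sup>2 * 1"
    proof (rule mult_left_mono)
      have "1 / (real n + 1) \<ge> 0" by simp
      then show "(\<Sum>k=1..n. 1 / (real k + 1)\<^sup>2) \<le> 1" using sum_inverse_squares_le[of n] by linarith
    qed simp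
    finally show ?thesis by simp
  qed
  have "(\<lambda>n. P n - exp (\<delta> n * of_real (h n))) \<longlonglongrightarrow> 0"
  proof (rule Lim_null_comparison)
    have "eventually (\<lambda>n. norm (\<delta> n) < 1) sequentially"
      using tendsto_norm[OF \<delta>] by (auto dest: order_tendstoD(2)[of _ _ _ 1])
    then show "eventually (\<lambda>n. norm (P n - exp (\<delta> n * of_real (h n))) \<le> 3 * (norm (\<delta> n))\<^sup>2) sequentially"
      by eventually_elim (rule approx, simp)
    show "(\<lambda>n. 3 * (norm (\<delta> n))\<^sup>2) \<longlonglongrightarrow> 0"
      using tendsto_mult_left[OF tendsto_power[OF tendsto_norm[OF \<delta>], of 2], of 3] by simp
  qed
  then have "(\<lambda>n. cis (- \<theta> n) * (P n - exp (\<delta> n * of_real (h n)))) \<longlonglongrightarrow> 0"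
    by (subst tendsto_norm_zero_iff[symmetric]) (simp add: norm_mult tendsto_norm_zero)
  moreover have "(\<lambda>n. cis (- \<theta> n) * exp (\<delta> n * of_real (h n))) \<longlonglongrightarrow> exp c"
  proof -
    have "h n - ln (real n) = (harm n - ln (real n)) + 1 / (real n + 1) - 1" for n
    proof -
      have "h n = harm (Suc n) - 1"
        by (induction n) (simp_all add: h_def harm_expand harm_Suc inverse_eq_divide add.commute)
      then show ?thesis by (simp add: harm_Suc inverse_eq_divide)
    qed
    moreover obtain g where "(\<lambda>n. harm n - ln (real n)) \<longlonglongrightarrow> g"
      using euler_mascheroni_convergent by (auto simp: convergent_def)
    moreover have "(\<lambda>n. 1 / (real n + 1)) \<longlonglongrightarrow> 0"
      using LIMSEQ_inverse_real_of_nat by (simp add: inverse_eq_divide add.commute)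
    ultimately have "(\<lambda>n. h n - ln (real n)) \<longlonglongrightarrow> g + 0 - 1"
      by (simp only:) (intro tendsto_intros)
    then have "(\<lambda>n. \<delta> n * of_real (h n - ln (real n))) \<longlonglongrightarrow> 0 * of_real (g + 0 - 1)"
      by (intro tendsto_mult \<delta> tendsto_of_real)
    from tendsto_add[OF c this]
    have "(\<lambda>n. - (\<i> * of_real (\<theta> n)) + \<delta> n * of_real (h n)) \<longlonglongrightarrow> c"
      by (simp add: algebra_simps)
    then have "(\<lambda>n. exp (- (\<i> * of_real (\<theta> n)) + \<delta> n * of_real (h n))) \<longlonglongrightarrow> exp c"
      by (rule tendsto_exp)
    then show ?thesis by (simp only: exp_add) (simp add: cis_conv_exp)
  qed
  ultimately have "(\<lambda>n. cis (- \<theta> n) * (P n - exp (\<delta> n * of_real (h n))) + cis (- \<theta> n) * exp (\<delta> n * of_real (h n))) \<longlonglongrightarrow> 0 + exp c"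
    by (rule tendsto_add)
  then show ?thesis
    by (simp only: prod_Suc_ratio P_def[symmetric] right_diff_distrib diff_add_cancel add_0)
qed

text \<open>The expansion \<open>exp(icy) = 1 + icy - c\<^sup>2y\<^sup>2/2 + O(c\<^sup>3)\<close>, divided by \<open>c\<^sup>2\<close>; in the application
\<open>c n = 1 / sqrt (ln n)\<close>, so that the division multiplies by \<open>ln n\<close>.\<close>
lemma cis_second_order:
  fixes c :: "nat \<Rightarrow> real"
  assumes c: "c \<longlonglongrightarrow> 0" and pos: "eventually (\<lambda>n. c n > 0) sequentially"
  shows "(\<lambda>n. (cis (c n * y) - 1) / of_real ((c n)\<^sup>2) - \<i> * of_real (y / c n)) \<longlonglongrightarrow> - of_real (y\<^sup>2 / 2)"
proof -
  have "(\<lambda>n. (cis (c n * y) - 1) / of_real ((c n)\<^sup>2) - \<i> * of_real (y / c n) + of_real (y\<^sup>2 / 2)) \<longlonglongrightarrow> 0"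
  proof (rule Lim_null_comparison)
    show "eventually (\<lambda>n. norm ((cis (c n * y) - 1) / of_real ((c n)\<^sup>2) - \<i> * of_real (y / c n) + of_real (y\<^sup>2 / 2)) \<le> c n * (\<bar>y\<bar> ^ 3 / 6)) sequentially"
      using pos
    proof eventually_elim
      case (elim n)
      have "(cis (c n * y) - 1) / of_real ((c n)\<^sup>2) - \<i> * of_real (y / c n) + of_real (y\<^sup>2 / 2) =
        (iexp (c n * y) - (\<Sum>k\<le>2. (\<i> * of_real (c n * y)) ^ k / fact k)) / of_real ((c n)\<^sup>2)"
        using elim by (simp add: cis_conv_exp numeral_2_eq_2 field_simps)
      also have "norm \<dots> \<le> (\<bar>c n * y\<bar> ^ 3 / 6) / (c n)\<^sup>2"
        using divide_right_mono[OF iexp_approx1[of "c n * y" 2], of "(c n)\<^sup>2"] elim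
        by (simp only: norm_divide norm_of_real) (simp add: eval_nat_numeral del: of_real_mult)
      also have "\<dots> = c n * (\<bar>y\<bar> ^ 3 / 6)"
        using elim by (simp add: abs_mult power_mult_distrib field_simps eval_nat_numeral)
      finally show ?case .
    qed
    show "(\<lambda>n. c n * (\<bar>y\<bar> ^ 3 / 6)) \<longlonglongrightarrow> 0"
      using tendsto_mult_right[OF c] by simp
  qed
  from tendsto_add[OF this tendsto_const[of "- of_real (y\<^sup>2 / 2)"]] show ?thesis
    by simp
qed

section \<open>Mass distributions of the urn\<close>

text \<open>The colours that can have been produced after \<open>n\<close> steps from colours in \<open>A\<close> with increments in \<open>B\<close>.
They form a finite set, which turns the sums over the infinite set of colours into finite ones.\<close>
primrec reach :: "'c::plus set \<Rightarrow> 'c set \<Rightarrow> nat \<Rightarrow> 'c set" where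
  "reach A B 0 = A"
| "reach A B (Suc n) = reach A B n \<union> (\<lambda>(v, b). v + b) ` (reach A B n \<times> B)"

lemma finite_reach: "finite A \<Longrightarrow> finite B \<Longrightarrow> finite (reach A B n)"
  by (induction n) auto

lemma reach_mono: "m \<le> n \<Longrightarrow> reach A B m \<subseteq> reach A B n"
  by (rule lift_Suc_mono_le[of "reach A B"]) auto

locale color_urn = prob_space M
  for M :: "'a measure" and S :: "'c::euclidean_space set" and p u0 :: "'c pmf"
    and U :: "nat \<Rightarrow> 'a \<Rightarrow> 'c \<Rightarrow> real" and Z :: "nat \<Rightarrow> 'a \<Rightarrow> 'c" +
  assumes urn: "infinite_color_urn M S p u0 U Z"
    and countable_S: "countable S"
    and finite_p: "finite (set_pmf p)"
    and S_add: "\<And>z b. z \<in> S \<Longrightarrow> b \<in> set_pmf p \<Longrightarrow> z + b \<in> S"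
begin

lemma u0_subset: "set_pmf u0 \<subseteq> S" and finite_u0: "finite (set_pmf u0)"
  and U_0: "\<omega> \<in> space M \<Longrightarrow> v \<in> S \<Longrightarrow> U 0 \<omega> v = pmf u0 v"
  and Z_measurable: "Z n \<in> measurable M (count_space S)"
  and U_Suc: "\<omega> \<in> space M \<Longrightarrow> v \<in> S \<Longrightarrow> U (Suc n) \<omega> v = U n \<omega> v + pmf p (v - Z n \<omega>)"
  and selection: "v \<in> S \<Longrightarrow> AE \<omega> in M.
        real_cond_exp M (history M S U n) (indicator {\<omega> \<in> space M. Z n \<omega> = v}) \<omega>
          = U n \<omega> v / (real n + 1)"
  using urn unfolding infinite_color_urn_def by auto

lemma Z_in_S: "\<omega> \<in> space M \<Longrightarrow> Z n \<omega> \<in> S"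
  using measurable_space[OF Z_measurable, of \<omega> n] by simp

lemma Z_eq_sets [measurable]: "{\<omega> \<in> space M. Z n \<omega> = v} \<in> sets M"
proof (cases "v \<in> S")
  case True
  then show ?thesis using measurable_sets[OF Z_measurable[of n], of "{v}"]
    by (simp add: vimage_def Int_def conj_commute)
next
  case False
  then have "{\<omega> \<in> space M. Z n \<omega> = v} = {}" using Z_in_S by auto
  then show ?thesis by (simp only: sets.empty_sets)
qed

lemma measurable_of_Z [measurable]:
  fixes h :: "'c \<Rightarrow> 'd::topological_space"
  shows "(\<lambda>\<omega>. h (Z n \<omega>)) \<in> borel_measurable M"
  by (rule measurable_compose[OF Z_measurable]) simp

lemma U_eq_sum: "\<omega> \<in> space M \<Longrightarrow> v \<in> S \<Longrightarrow> U n \<omega> v = pmf u0 v + (\<Sum>k<n. pmf p (v - Z k \<omega>))"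
  by (induction n) (simp_all add: U_0 U_Suc)

lemma U_measurable: "v \<in> S \<Longrightarrow> (\<lambda>\<omega>. U n \<omega> v) \<in> borel_measurable M"
  by (subst measurable_cong[OF U_eq_sum]) measurable

lemma U_nonneg: "\<omega> \<in> space M \<Longrightarrow> v \<in> S \<Longrightarrow> 0 \<le> U n \<omega> v"
  by (simp add: U_eq_sum sum_nonneg)

lemma U_le: "\<omega> \<in> space M \<Longrightarrow> v \<in> S \<Longrightarrow> U n \<omega> v \<le> real n + 1"
proof (induction n)
  case (Suc n)
  then show ?case using pmf_le_1[of p "v - Z n \<omega>"] by (simp add: U_Suc)
qed (simp add: U_0 pmf_le_1)

lemma history_generators:
  "{(\<lambda>\<omega>. U m \<omega> v) -` A \<inter> space M | m v A. m \<le> n \<and> v \<in> S \<and> A \<in> sets borel} \<subseteq> Pow (space M)"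
  by auto

lemma subalgebra_history: "subalgebra M (history M S U n)"
  unfolding subalgebra_def history_def
  by (auto simp: space_measure_of_conv sets_measure_of[OF history_generators]
        intro!: sets.sigma_sets_subset measurable_sets[OF U_measurable])

lemma U_history_measurable:
  assumes v: "v \<in> S"
  shows "(\<lambda>\<omega>. U n \<omega> v) \<in> borel_measurable (history M S U n)"
proof (rule measurableI)
  fix A :: "real set" assume "A \<in> sets borel"
  then show "(\<lambda>\<omega>. U n \<omega> v) -` A \<inter> space (history M S U n) \<in> sets (history M S U n)"
    unfolding history_def using v
    by (auto simp: space_measure_of_conv sets_measure_of[OF history_generators] intro!: sigma_sets.Basic)
qed simp

text \<open>The selection rule in integrated form: against a bounded function of the past, the event that colour
\<open>v\<close> is drawn may be replaced by its proportion in the urn.\<close>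
lemma integral_history_indicator:
  assumes f [measurable]: "f \<in> borel_measurable (history M S U n)"
    and b: "\<And>\<omega>. \<omega> \<in> space M \<Longrightarrow> \<bar>f \<omega>\<bar> \<le> C" and v: "v \<in> S"
  shows "(\<integral>\<omega>. f \<omega> * indicator {\<omega> \<in> space M. Z n \<omega> = v} \<omega> \<partial>M) = (\<integral>\<omega>. f \<omega> * (U n \<omega> v / (real n + 1)) \<partial>M)"
proof -
  interpret finite_measure_subalgebra M "history M S U n"
    by unfold_locales (rule subalgebra_history)
  have fM [measurable]: "f \<in> borel_measurable M"
    by (rule measurable_from_subalg[OF subalgebra_history f])
  note U_measurable[OF v, measurable]
  have C: "C \<ge> 0" using not_empty b order_trans[OF abs_ge_zero] by blast
  let ?i = "indicator {\<omega> \<in> space M. Z n \<omega> = v} :: 'a \<Rightarrow> real"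
  have "integrable M (\<lambda>\<omega>. f \<omega> * ?i \<omega>)"
    by (rule integrable_const_bound[where B = C]) (auto simp: indicator_def b C)
  then have "(\<integral>\<omega>. f \<omega> * ?i \<omega> \<partial>M) = (\<integral>\<omega>. f \<omega> * real_cond_exp M (history M S U n) ?i \<omega> \<partial>M)"
    by (intro real_cond_exp_intg(2)[symmetric]) measurable
  also have "\<dots> = (\<integral>\<omega>. f \<omega> * (U n \<omega> v / (real n + 1)) \<partial>M)"
    using selection[OF v, of n] 
    by (intro integral_cong_AE) auto
  finally show ?thesis .
qed

text \<open>The contribution to \<open>\<Sum>v. U\<^sub>n(v) h(v)\<close> of the balls that are added when colour \<open>z\<close> is drawn.\<close>
definition step :: "('c \<Rightarrow> 'd::real_vector) \<Rightarrow> 'c \<Rightarrow> 'd" where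
  "step h z = (\<Sum>b\<in>set_pmf p. pmf p b *\<^sub>R h (z + b))"

text \<open>The integral \<open>\<Sum>v. U\<^sub>n(v) h(v)\<close> of \<open>h\<close> against the content of the urn. The formula in terms of the
drawn colours involves finite sums only and depends on \<open>\<omega>\<close> through finitely many discrete random
variables; \<open>urn_total_eq_sum\<close> identifies it with the sum over colours.\<close>
definition urn_total :: "nat \<Rightarrow> ('c \<Rightarrow> 'd::real_vector) \<Rightarrow> 'a \<Rightarrow> 'd" where
  "urn_total n h \<omega> = (\<Sum>v\<in>set_pmf u0. pmf u0 v *\<^sub>R h v) + (\<Sum>k<n. step h (Z k \<omega>))"

lemma urn_total_Suc: "urn_total (Suc n) h \<omega> = urn_total n h \<omega> + step h (Z n \<omega>)"
  by (simp add: urn_total_def)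

lemma urn_total_measurable [measurable]:
  fixes h :: "'c \<Rightarrow> 'd::{real_normed_vector, second_countable_topology}"
  shows "urn_total n h \<in> borel_measurable M"
  unfolding urn_total_def by measurable

lemma sum_pmf_p: "(\<Sum>b\<in>set_pmf p. pmf p b) = 1" and sum_pmf_u0: "(\<Sum>v\<in>set_pmf u0. pmf u0 v) = 1"
  using sum_pmf_eq_1[OF finite_p] sum_pmf_eq_1[OF finite_u0] by auto

lemma norm_step_le:
  fixes h :: "'c \<Rightarrow> 'd::real_normed_vector"
  assumes "\<And>v. norm (h v) \<le> C"
  shows "norm (step h z) \<le> C"
proof -
  have "norm (step h z) \<le> (\<Sum>b\<in>set_pmf p. pmf p b * C)"
    unfolding step_def using assms by (intro sum_norm_le) (auto intro!: mult_left_mono)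
  then show ?thesis by (simp add: sum_distrib_right[symmetric] sum_pmf_p)
qed

lemma norm_urn_total_le:
  fixes h :: "'c \<Rightarrow> 'd::real_normed_vector"
  assumes "\<And>v. norm (h v) \<le> C"
  shows "norm (urn_total n h \<omega>) \<le> (real n + 1) * C"
proof (induction n)
  case 0
  have "norm (urn_total 0 h \<omega>) \<le> (\<Sum>v\<in>set_pmf u0. pmf u0 v * C)"
    unfolding urn_total_def using assms by (simp, intro sum_norm_le) (auto intro!: mult_left_mono)
  then show ?case by (simp add: sum_distrib_right[symmetric] sum_pmf_u0)
next
  case (Suc n)
  have "norm (urn_total (Suc n) h \<omega>) \<le> (real n + 1) * C + C"
    unfolding urn_total_Suc using Suc norm_step_le[of h C, OF assms] by (intro norm_triangle_mono) auto
  then show ?case by (simp add: algebra_simps)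
qed

lemma urn_total_eq_sum:
  assumes \<omega>: "\<omega> \<in> space M" and F: "finite F" "F \<subseteq> S" "set_pmf u0 \<subseteq> F"
    and ZF: "\<And>k b. k < n \<Longrightarrow> b \<in> set_pmf p \<Longrightarrow> Z k \<omega> + b \<in> F"
  shows "urn_total n h \<omega> = (\<Sum>v\<in>F. U n \<omega> v *\<^sub>R h v)"
    and "\<And>v. v \<in> S - F \<Longrightarrow> U n \<omega> v = 0"
proof -
  have initial: "(\<Sum>v\<in>F. pmf u0 v *\<^sub>R h v) = (\<Sum>v\<in>set_pmf u0. pmf u0 v *\<^sub>R h v)"
    using F by (intro sum.mono_neutral_right) (auto simp: set_pmf_iff)
  have added: "(\<Sum>v\<in>F. pmf p (v - z) *\<^sub>R h v) = step h z" if "\<And>b. b \<in> set_pmf p \<Longrightarrow> z + b \<in> F" for z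
  proof -
    have "step h z = (\<Sum>v\<in>(+) z ` set_pmf p. pmf p (v - z) *\<^sub>R h v)"
      by (subst sum.reindex) (auto simp: step_def)
    also have "\<dots> = (\<Sum>v\<in>F. pmf p (v - z) *\<^sub>R h v)"
    proof (intro sum.mono_neutral_left F ballI)
      fix v assume v: "v \<in> F - (+) z ` set_pmf p"
      have "v - z \<notin> set_pmf p"
      proof
        assume "v - z \<in> set_pmf p"
        then have "z + (v - z) \<in> (+) z ` set_pmf p" by (rule imageI)
        with v show False by simp
      qed
      then show "pmf p (v - z) *\<^sub>R h v = 0" by (simp add: set_pmf_iff)
    qed (use that in auto)
    finally show ?thesis by simp
  qed
  show "urn_total n h \<omega> = (\<Sum>v\<in>F. U n \<omega> v *\<^sub>R h v)"
  proof -
    have "(\<Sum>v\<in>F. U n \<omega> v *\<^sub>R h v) = (\<Sum>v\<in>F. pmf u0 v *\<^sub>R h v + (\<Sum>k<n. pmf p (v - Z k \<omega>) *\<^sub>R h v))"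
      using F(2) by (intro sum.cong refl) (auto simp: U_eq_sum[OF \<omega>] scaleR_left_distrib scaleR_sum_left)
    also have "\<dots> = (\<Sum>v\<in>F. pmf u0 v *\<^sub>R h v) + (\<Sum>k<n. \<Sum>v\<in>F. pmf p (v - Z k \<omega>) *\<^sub>R h v)"
      by (simp add: sum.distrib sum.swap[of _ "{..<n}" F])
    also have "\<dots> = urn_total n h \<omega>"
      unfolding urn_total_def initial using ZF by (intro arg_cong2[where f = "(+)"] sum.cong refl added) auto
    finally show ?thesis by simp
  qed
  fix v assume v: "v \<in> S - F"
  have "pmf p (v - Z k \<omega>) = 0" if "k < n" for k
  proof (rule ccontr)
    assume "pmf p (v - Z k \<omega>) \<noteq> 0"
    then have "Z k \<omega> + (v - Z k \<omega>) \<in> F" using that by (intro ZF) (auto simp: set_pmf_iff)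
    then show False using v by simp
  qed
  moreover have "pmf u0 v = 0" using F(3) v by (auto simp: set_pmf_iff)
  ultimately show "U n \<omega> v = 0" using v by (simp add: U_eq_sum[OF \<omega>])
qed

abbreviation reached :: "nat \<Rightarrow> 'c set" where "reached \<equiv> reach (set_pmf u0) (set_pmf p)"

lemma finite_reached: "finite (reached n)"
  by (intro finite_reach finite_u0 finite_p)

lemma reached_subset: "reached n \<subseteq> S"
  using u0_subset S_add by (induction n) auto

lemma Z_plus_in_reached: "Z k \<omega> \<in> reached k \<Longrightarrow> b \<in> set_pmf p \<Longrightarrow> k < n \<Longrightarrow> Z k \<omega> + b \<in> reached n"
  using reach_mono[of "Suc k" n "set_pmf u0" "set_pmf p"] by (auto simp del: reach.simps(1))

text \<open>If all earlier draws are in the sets of reached colours, a colour outside the next set has mass 0 in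
the urn and is drawn with probability 0; there are countably many such colours.\<close>
lemma AE_Z_in_reached: "AE \<omega> in M. Z n \<omega> \<in> reached n"
proof (induction n rule: less_induct)
  case (less n)
  have 1: "AE \<omega> in M. \<forall>k\<in>{..<n}. Z k \<omega> \<in> reached k"
    using less by (subst AE_ball_countable) auto
  have "AE \<omega> in M. \<forall>v\<in>S - reached n. Z n \<omega> \<noteq> v"
  proof (subst AE_ball_countable)
    show "countable (S - reached n)" using countable_S by simp
    show "\<forall>v\<in>S - reached n. AE \<omega> in M. Z n \<omega> \<noteq> v"
    proof
      fix v assume v: "v \<in> S - reached n"
      have "AE \<omega> in M. U n \<omega> v = 0"
        using 1
      proof (rule AE_mp, intro AE_I2 impI)
        fix \<omega> assume \<omega>: "\<omega> \<in> space M" and k: "\<forall>k\<in>{..<n}. Z k \<omega> \<in> reached k"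
        show "U n \<omega> v = 0"
          using v k reach_mono[of 0 n "set_pmf u0" "set_pmf p"]
          by (intro urn_total_eq_sum(2)[OF \<omega> finite_reached reached_subset]) (auto intro: Z_plus_in_reached)
      qed
      then have "(\<integral>\<omega>. 1 * (U n \<omega> v / (real n + 1)) \<partial>M) = (\<integral>\<omega>. 0 \<partial>M)"
        using v by (intro integral_cong_AE) (auto intro!: borel_measurable_divide U_measurable)
      then have "measure M {\<omega> \<in> space M. Z n \<omega> = v} = 0"
        using integral_history_indicator[of "\<lambda>_. 1" n 1 v] v by simp
      then show "AE \<omega> in M. Z n \<omega> \<noteq> v"
        by (subst AE_iff_measurable[OF _ refl]) (auto simp: emeasure_eq_measure)
    qed
  qed
  then show ?case
    by (rule AE_mp) (auto intro!: AE_I2 dest: Z_in_S)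
qed

lemma AE_all_Z_in_reached: "AE \<omega> in M. \<forall>k. Z k \<omega> \<in> reached k"
  using AE_Z_in_reached by (simp add: AE_all_countable)

lemma AE_urn_total: "AE \<omega> in M. urn_total n h \<omega> = (\<Sum>v\<in>reached n. U n \<omega> v *\<^sub>R h v)"
  using AE_all_Z_in_reached
proof (rule AE_mp, intro AE_I2 impI)
  fix \<omega> assume \<omega>: "\<omega> \<in> space M" and k: "\<forall>k. Z k \<omega> \<in> reached k"
  show "urn_total n h \<omega> = (\<Sum>v\<in>reached n. U n \<omega> v *\<^sub>R h v)"
    using k reach_mono[of 0 n "set_pmf u0" "set_pmf p"]
    by (intro urn_total_eq_sum(1)[OF \<omega> finite_reached reached_subset]) (auto intro: Z_plus_in_reached)
qed

text \<open>This is the identity \<open>E (f h(Z\<^sub>n)) = E (f \<Sum>v. U\<^sub>n(v) h(v)) / (n + 1)\<close>, obtained by splitting according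
to the value of \<open>Z\<^sub>n\<close>, which lies in a finite set almost surely.\<close>
lemma integral_history_of_Z:
  fixes h :: "'c \<Rightarrow> complex"
  assumes f: "f \<in> borel_measurable (history M S U n)"
    and b: "\<And>\<omega>. \<omega> \<in> space M \<Longrightarrow> \<bar>f \<omega>\<bar> \<le> C"
  shows "(\<integral>\<omega>. of_real (f \<omega>) * h (Z n \<omega>) \<partial>M) = (\<integral>\<omega>. of_real (f \<omega>) * urn_total n h \<omega> \<partial>M) / (of_nat n + 1)"
proof -
  have fM [measurable]: "f \<in> borel_measurable M"
    by (rule measurable_from_subalg[OF subalgebra_history f])
  note Um = U_measurable[OF subsetD[OF reached_subset], measurable]
  have C: "C \<ge> 0" using not_empty b order_trans[OF abs_ge_zero] by blast
  let ?i = "\<lambda>v. indicator {\<omega> \<in> space M. Z n \<omega> = v} :: 'a \<Rightarrow> real"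
  have int1: "integrable M (\<lambda>\<omega>. f \<omega> * ?i v \<omega>)" if "v \<in> reached n" for v
    by (intro integrable_const_bound[where B = C]) (auto simp: indicator_def b C)
  have int2: "integrable M (\<lambda>\<omega>. f \<omega> * (U n \<omega> v / (real n + 1)))" if "v \<in> reached n" for v
  proof (rule integrable_const_bound[where B = C])
    show "AE \<omega> in M. norm (f \<omega> * (U n \<omega> v / (real n + 1))) \<le> C"
    proof (rule AE_I2)
      fix \<omega> assume \<omega>: "\<omega> \<in> space M"
      have "\<bar>f \<omega>\<bar> * \<bar>U n \<omega> v / (real n + 1)\<bar> \<le> C * 1"
        using b[OF \<omega>] U_nonneg[OF \<omega>, of v n] U_le[OF \<omega>, of v n] subsetD[OF reached_subset that]
        by (intro mult_mono) (auto simp: divide_le_eq intro: order_trans[OF abs_ge_zero])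
      then show "norm (f \<omega> * (U n \<omega> v / (real n + 1))) \<le> C" by (simp add: abs_mult)
    qed
  qed (use Um[OF that] in measurable)
  have "(\<integral>\<omega>. of_real (f \<omega>) * h (Z n \<omega>) \<partial>M) = (\<integral>\<omega>. (\<Sum>v\<in>reached n. of_real (f \<omega> * ?i v \<omega>) * h v) \<partial>M)"
  proof (rule integral_cong_AE)
    show "AE \<omega> in M. of_real (f \<omega>) * h (Z n \<omega>) = (\<Sum>v\<in>reached n. of_real (f \<omega> * ?i v \<omega>) * h v)"
      using AE_Z_in_reached[of n]
    proof (rule AE_mp, intro AE_I2 impI)
      fix \<omega> assume \<omega>: "\<omega> \<in> space M" "Z n \<omega> \<in> reached n"
      have "(\<Sum>v\<in>reached n. of_real (f \<omega> * ?i v \<omega>) * h v) = (\<Sum>v\<in>reached n. if v = Z n \<omega> then of_real (f \<omega>) * h v else 0)"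
        using \<omega>(1) by (intro sum.cong) (auto simp: indicator_def)
      then show "of_real (f \<omega>) * h (Z n \<omega>) = (\<Sum>v\<in>reached n. of_real (f \<omega> * ?i v \<omega>) * h v)"
        using \<omega>(2) finite_reached by simp
    qed
  qed measurable
  also have "\<dots> = (\<Sum>v\<in>reached n. of_real (\<integral>\<omega>. f \<omega> * ?i v \<omega> \<partial>M) * h v)"
    using int1 by (subst Bochner_Integration.integral_sum) (auto intro!: integrable_mult_left integrable_of_real simp del: of_real_mult)
  also have "\<dots> = (\<Sum>v\<in>reached n. of_real (\<integral>\<omega>. f \<omega> * (U n \<omega> v / (real n + 1)) \<partial>M) * h v)"
    using reached_subset by (intro sum.cong refl) (subst integral_history_indicator[OF f b], auto)
  also have "\<dots> = (\<integral>\<omega>. (\<Sum>v\<in>reached n. of_real (f \<omega> * (U n \<omega> v / (real n + 1))) * h v) \<partial>M)"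
    using int2 by (subst Bochner_Integration.integral_sum) (auto intro!: integrable_mult_left integrable_of_real simp del: of_real_mult of_real_divide)
  also have "\<dots> = (\<integral>\<omega>. of_real (f \<omega>) * urn_total n h \<omega> / (of_nat n + 1) \<partial>M)"
  proof (rule integral_cong_AE)
    show "AE \<omega> in M. (\<Sum>v\<in>reached n. of_real (f \<omega> * (U n \<omega> v / (real n + 1))) * h v) = of_real (f \<omega>) * urn_total n h \<omega> / (of_nat n + 1)"
      using AE_urn_total[of n h]
      by eventually_elim (simp add: sum_distrib_left sum_divide_distrib scaleR_conv_of_real mult_ac)
  qed (use Um in measurable)
  finally show ?thesis by simp
qed

end

section \<open>First and second moments of the Fourier transform\<close>

context color_urn
begin

definition wave :: "'c \<Rightarrow> 'c \<Rightarrow> complex" where "wave t v = cis (t \<bullet> v)"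

definition char_p :: "'c \<Rightarrow> complex" where
  "char_p t = (\<Sum>b\<in>set_pmf p. pmf p b *\<^sub>R wave t b)"

definition char_u0 :: "'c \<Rightarrow> complex" where
  "char_u0 t = (\<Sum>v\<in>set_pmf u0. pmf u0 v *\<^sub>R wave t v)"

lemma norm_wave [simp]: "norm (wave t v) = 1" by (simp add: wave_def)

text \<open>Waves are eigenfunctions of the replacement because the increment is independent of the drawn
colour. All later computations rest on this identity.\<close>
lemma step_wave: "step (wave t) z = char_p t * wave t z"
  by (simp add: step_def char_p_def wave_def inner_add_right cis_mult[symmetric] sum_distrib_left sum_distrib_right scaleR_conv_of_real mult_ac)

lemma norm_char_p_le: "norm (char_p t) \<le> 1"
  unfolding char_p_def
  using sum_norm_le[of "set_pmf p" "\<lambda>b. pmf p b *\<^sub>R wave t b" "pmf p"] sum_pmf_p by simp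

lemma norm_urn_total_wave_le: "norm (urn_total n (wave t) \<omega>) \<le> real n + 1"
  using norm_urn_total_le[of "wave t" 1 n \<omega>] by simp

lemma urn_total_integrable [simp]: "integrable M (urn_total n (wave t))"
  by (rule integrable_const_bound[where B = "real n + 1"])
     (auto intro!: norm_urn_total_wave_le AE_I2)

lemma urn_total_norm2_integrable [simp]: "integrable M (\<lambda>\<omega>. (norm (urn_total n (wave t) \<omega>))\<^sup>2)"
  by (rule integrable_const_bound[where B = "(real n + 1)\<^sup>2"])
     (auto intro!: norm_urn_total_wave_le AE_I2 power_mono)

lemma integral_of_Z:
  fixes h :: "'c \<Rightarrow> complex"
  shows "(\<integral>\<omega>. h (Z n \<omega>) \<partial>M) = (\<integral>\<omega>. urn_total n h \<omega> \<partial>M) / (of_nat n + 1)"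
  using integral_history_of_Z[of "\<lambda>_. 1" n 1 h] by simp

lemma cnj_urn_total: "cnj (urn_total n (wave t) \<omega>) = urn_total n (wave (- t)) \<omega>"
  by (simp add: urn_total_def step_def wave_def cis_cnj)

text \<open>The mixed moment that occurs in the recursion for the second moment. The conjugate transform depends
on the past only, but it is complex; its expansion over the reached colours reduces the claim to the
real functions \<open>U\<^sub>n(v)\<close> of the past.\<close>
lemma integral_urn_total_wave_Z:
  "(\<integral>\<omega>. cnj (urn_total n (wave t) \<omega>) * wave t (Z n \<omega>) \<partial>M) =
     of_real (\<integral>\<omega>. (norm (urn_total n (wave t) \<omega>))\<^sup>2 \<partial>M) / (of_nat n + 1)"
proof -
  let ?W = "urn_total n (wave t)"
  have U_b: "\<bar>U n \<omega> v\<bar> \<le> real n + 1" if "v \<in> reached n" "\<omega> \<in> space M" for \<omega> v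
    using U_nonneg[of \<omega> v n] U_le[of \<omega> v n] subsetD[OF reached_subset that(1)] that(2) by simp
  note Um = U_measurable[OF subsetD[OF reached_subset], measurable]
  have int: "integrable M (\<lambda>\<omega>. of_real (U n \<omega> v) * Y \<omega>)"
    if "v \<in> reached n" "Y \<in> borel_measurable M" "\<And>\<omega>. norm (Y \<omega>) \<le> B" for v and Y :: "'a \<Rightarrow> complex" and B
  proof (rule integrable_const_bound[where B = "(real n + 1) * B"])
    show "AE \<omega> in M. norm (of_real (U n \<omega> v) * Y \<omega>) \<le> (real n + 1) * B"
      using U_b[OF that(1)] that(3) by (intro AE_I2) (auto simp: norm_mult intro!: mult_mono)
  qed (use Um[OF that(1)] that(2) in measurable)
  have "(\<integral>\<omega>. cnj (?W \<omega>) * wave t (Z n \<omega>) \<partial>M) =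
      (\<integral>\<omega>. (\<Sum>v\<in>reached n. cnj (wave t v) * (of_real (U n \<omega> v) * wave t (Z n \<omega>))) \<partial>M)"
  proof (rule integral_cong_AE)
    show "AE \<omega> in M. cnj (?W \<omega>) * wave t (Z n \<omega>) = (\<Sum>v\<in>reached n. cnj (wave t v) * (of_real (U n \<omega> v) * wave t (Z n \<omega>)))"
      using AE_urn_total[of n "wave t"]
      by eventually_elim (simp add: sum_distrib_left sum_distrib_right scaleR_conv_of_real mult_ac)
  qed (use Um in \<open>auto simp: cnj_urn_total\<close>)
  also have "\<dots> = (\<Sum>v\<in>reached n. cnj (wave t v) * (\<integral>\<omega>. of_real (U n \<omega> v) * wave t (Z n \<omega>) \<partial>M))"
    by (subst Bochner_Integration.integral_sum) (auto intro!: integrable_mult_right int[OF _ _ eq_refl[OF norm_wave]])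
  also have "\<dots> = (\<Sum>v\<in>reached n. cnj (wave t v) * ((\<integral>\<omega>. of_real (U n \<omega> v) * ?W \<omega> \<partial>M) / (of_nat n + 1)))"
    using reached_subset by (intro sum.cong refl arg_cong2[where f = "(*)"] integral_history_of_Z[where C = "real n + 1"] U_b)
       (auto intro!: U_history_measurable)
  also have "\<dots> = (\<Sum>v\<in>reached n. cnj (wave t v) * (\<integral>\<omega>. of_real (U n \<omega> v) * ?W \<omega> \<partial>M)) / (of_nat n + 1)"
    by (simp add: sum_divide_distrib)
  also have "(\<Sum>v\<in>reached n. cnj (wave t v) * (\<integral>\<omega>. of_real (U n \<omega> v) * ?W \<omega> \<partial>M)) =
      (\<integral>\<omega>. (\<Sum>v\<in>reached n. cnj (wave t v) * (of_real (U n \<omega> v) * ?W \<omega>)) \<partial>M)"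
    by (subst Bochner_Integration.integral_sum)
       (auto intro!: integrable_mult_right int[OF _ _ norm_urn_total_wave_le])
  also have "\<dots> = (\<integral>\<omega>. of_real ((norm (?W \<omega>))\<^sup>2) \<partial>M)"
  proof (rule integral_cong_AE)
    show "AE \<omega> in M. (\<Sum>v\<in>reached n. cnj (wave t v) * (of_real (U n \<omega> v) * ?W \<omega>)) = of_real ((norm (?W \<omega>))\<^sup>2)"
      using AE_urn_total[of n "wave t"]
    proof eventually_elim
      case (elim \<omega>)
      have "of_real ((norm (?W \<omega>))\<^sup>2) = cnj (?W \<omega>) * ?W \<omega>"
        by (simp only: complex_norm_square mult.commute)
      also have "cnj (?W \<omega>) = (\<Sum>v\<in>reached n. cnj (wave t v) * of_real (U n \<omega> v))"
        unfolding elim by (simp add: scaleR_conv_of_real mult_ac)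
      finally show ?case by (simp add: sum_distrib_left sum_distrib_right mult_ac)
    qed
  qed (use Um in auto)
  finally show ?thesis by (simp del: of_real_power)
qed

definition mean_total :: "nat \<Rightarrow> 'c \<Rightarrow> complex" where
  "mean_total n t = (\<integral>\<omega>. urn_total n (wave t) \<omega> \<partial>M)"

definition second_total :: "nat \<Rightarrow> 'c \<Rightarrow> real" where
  "second_total n t = (\<integral>\<omega>. (norm (urn_total n (wave t) \<omega>))\<^sup>2 \<partial>M)"

lemma wave_Z_integrable [simp]: "integrable M (\<lambda>\<omega>. wave t (Z n \<omega>))"
  by (rule integrable_const_bound[where B = 1]) auto

lemma mean_total_0: "mean_total 0 t = char_u0 t"
  by (simp add: mean_total_def urn_total_def char_u0_def prob_space)

lemma mean_total_Suc: "mean_total (Suc n) t = mean_total n t * (1 + char_p t / (of_nat n + 1))"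
proof -
  have "mean_total (Suc n) t = mean_total n t + char_p t * (\<integral>\<omega>. wave t (Z n \<omega>) \<partial>M)"
    unfolding mean_total_def urn_total_Suc step_wave by simp
  then show ?thesis by (simp add: integral_of_Z mean_total_def algebra_simps)
qed

lemma mean_total_eq_prod: "mean_total n t = char_u0 t * (\<Prod>k=1..n. 1 + char_p t / of_nat k)"
  by (induction n) (simp_all add: mean_total_0 mean_total_Suc add.commute)

lemma second_total_0: "second_total 0 t = (norm (char_u0 t))\<^sup>2"
  by (simp add: second_total_def urn_total_def char_u0_def prob_space)

text \<open>Expand \<open>\<bar>M\<^sub>n + \<phi> exp(i t\<cdot>Z\<^sub>n)\<bar>\<^sup>2\<close>. The cross term has expectation \<open>2 Re \<phi> E\<bar>M\<^sub>n\<bar>\<^sup>2 / (n + 1)\<close>, so the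
recursion for \<open>E\<bar>M\<^sub>n\<bar>\<^sup>2\<close> is closed.\<close>
lemma second_total_Suc:
  "second_total (Suc n) t = second_total n t * (1 + 2 * Re (char_p t) / (real n + 1)) + (norm (char_p t))\<^sup>2"
proof -
  let ?W = "urn_total n (wave t)" and ?Y = "\<lambda>\<omega>. wave t (Z n \<omega>)"
  have sq: "(norm (a + b))\<^sup>2 = (norm a)\<^sup>2 + 2 * Re (cnj a * b) + (norm b)\<^sup>2" for a b :: complex
    by (simp only: cmod_power2) (simp add: power2_eq_square algebra_simps)
  have "second_total (Suc n) t =
      (\<integral>\<omega>. (norm (?W \<omega>))\<^sup>2 + 2 * Re (char_p t * (cnj (?W \<omega>) * ?Y \<omega>)) + (norm (char_p t))\<^sup>2 \<partial>M)"
    unfolding second_total_def urn_total_Suc step_wave sq by (simp add: norm_mult mult_ac)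
  also have "\<dots> = second_total n t + 2 * Re (char_p t * (\<integral>\<omega>. cnj (?W \<omega>) * ?Y \<omega> \<partial>M)) + (norm (char_p t))\<^sup>2"
  proof -
    have [simp]: "integrable M (\<lambda>\<omega>. cnj (?W \<omega>) * ?Y \<omega>)"
      by (rule integrable_const_bound[where B = "real n + 1"])
         (auto intro!: norm_urn_total_wave_le AE_I2 simp: norm_mult cnj_urn_total)
    show ?thesis
      by (simp add: second_total_def prob_space integrable_mult_right del: times_complex.sel)
  qed
  also have "char_p t * (\<integral>\<omega>. cnj (?W \<omega>) * ?Y \<omega> \<partial>M) = of_real (second_total n t / (real n + 1)) * char_p t"
    by (simp add: integral_urn_total_wave_Z second_total_def)
  also have "Re \<dots> = second_total n t / (real n + 1) * Re (char_p t)"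
    by simp
  finally show ?thesis by (simp add: algebra_simps)
qed

lemma square_mult_one_plus: "x > 0 \<Longrightarrow> x\<^sup>2 * (1 + 2 / x) = x\<^sup>2 + 2 * (x::real)"
  by (simp add: field_simps power2_eq_square)

text \<open>The variance of \<open>M\<^sub>n(t) / (n + 1)\<close>, which is the Fourier transform of the random probability measure.\<close>
definition rel_variance :: "nat \<Rightarrow> 'c \<Rightarrow> real" where
  "rel_variance n t = (second_total n t - (norm (mean_total n t))\<^sup>2) / (real n + 1)\<^sup>2"

lemma integral_deviation:
  "(\<integral>\<omega>. (norm (urn_total n (wave t) \<omega> - mean_total n t))\<^sup>2 \<partial>M) = (real n + 1)\<^sup>2 * rel_variance n t"
proof -
  let ?W = "urn_total n (wave t)"
  have sq: "(norm (a - b))\<^sup>2 = (norm a)\<^sup>2 - 2 * Re (cnj b * a) + (norm b)\<^sup>2" for a b :: complex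
    by (simp only: cmod_power2) (simp add: power2_eq_square algebra_simps)
  have "(\<integral>\<omega>. (norm (?W \<omega> - mean_total n t))\<^sup>2 \<partial>M) =
     second_total n t - 2 * Re (cnj (mean_total n t) * mean_total n t) + (norm (mean_total n t))\<^sup>2"
    unfolding sq by (simp add: second_total_def prob_space mean_total_def del: times_complex.sel)
  also have "Re (cnj (mean_total n t) * mean_total n t) = (norm (mean_total n t))\<^sup>2"
    by (simp only: cmod_power2) (simp add: power2_eq_square)
  finally show ?thesis by (simp add: rel_variance_def)
qed

lemma rel_variance_nonneg: "rel_variance n t \<ge> 0"
proof -
  have "0 \<le> (\<integral>\<omega>. (norm (urn_total n (wave t) \<omega> - mean_total n t))\<^sup>2 \<partial>M)" by simp
  then show ?thesis unfolding integral_deviation by (simp add: zero_le_mult_iff)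
qed

text \<open>Let \<open>V\<close> be the variance of \<open>M\<^sub>n\<close>. The recursions give \<open>V (1 + 2 Re \<phi>/(n+1)) + \<bar>\<phi>\<bar>\<^sup>2\<close> minus a
nonnegative term for the next variance. Since \<open>\<bar>\<phi>\<bar> \<le> 1\<close>, this is at most \<open>V (1 + 2/(n+1)) + 1\<close>, and
\<open>(n+1)\<^sup>2 (1 + 2/(n+1)) \<le> (n+2)\<^sup>2\<close>.\<close>
lemma rel_variance_Suc_le: "rel_variance (Suc n) t \<le> rel_variance n t + 1 / (real n + 2)\<^sup>2"
proof -
  let ?x = "real n + 1" and ?m = "norm (mean_total n t)" and ?c = "char_p t"
  define V where "V = second_total n t - ?m\<^sup>2"
  have V: "V = ?x\<^sup>2 * rel_variance n t" by (simp add: V_def rel_variance_def)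
  have V0: "V \<ge> 0" unfolding V using rel_variance_nonneg[of n t] by simp
  have x: "(of_nat n + 1 :: complex) = of_real ?x" by simp
  have "(norm (1 + ?c / of_real ?x))\<^sup>2 = 1 + 2 * Re ?c / ?x + (norm ?c)\<^sup>2 / ?x\<^sup>2"
    unfolding cmod_power2 by (simp only: plus_complex.sel Re_divide_of_real Im_divide_of_real one_complex.sel)
       (simp add: power2_sum power_divide add_divide_distrib)
  then have m: "(norm (mean_total (Suc n) t))\<^sup>2 = ?m\<^sup>2 * (1 + 2 * Re ?c / ?x + (norm ?c)\<^sup>2 / ?x\<^sup>2)"
    unfolding mean_total_Suc norm_mult power_mult_distrib x by simp
  have "second_total (Suc n) t - (norm (mean_total (Suc n) t))\<^sup>2 =
      V * (1 + 2 * Re ?c / ?x) + (norm ?c)\<^sup>2 - ?m\<^sup>2 * ((norm ?c)\<^sup>2 / ?x\<^sup>2)"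
    unfolding m second_total_Suc V_def by (simp only: algebra_simps)
  also have "\<dots> \<le> V * (1 + 2 / ?x) + 1"
  proof -
    have "Re ?c \<le> 1" using complex_Re_le_cmod[of ?c] norm_char_p_le[of t] by linarith
    then have "V * (1 + 2 * Re ?c / ?x) \<le> V * (1 + 2 / ?x)"
      using V0 by (intro mult_left_mono add_left_mono divide_right_mono) auto
    moreover have "(norm ?c)\<^sup>2 \<le> 1" using norm_char_p_le[of t] by (simp add: power_le_one)
    moreover have "0 \<le> ?m\<^sup>2 * ((norm ?c)\<^sup>2 / ?x\<^sup>2)" by simp
    ultimately show ?thesis by linarith
  qed
  also have "\<dots> = rel_variance n t * (?x\<^sup>2 * (1 + 2 / ?x)) + 1" by (simp add: V)
  also have "?x\<^sup>2 * (1 + 2 / ?x) = ?x\<^sup>2 + 2 * ?x" by (rule square_mult_one_plus) simp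
  also have "rel_variance n t * (?x\<^sup>2 + 2 * ?x) \<le> rel_variance n t * (real n + 2)\<^sup>2"
    by (intro mult_left_mono rel_variance_nonneg) (simp add: power2_eq_square algebra_simps)
  finally have "second_total (Suc n) t - (norm (mean_total (Suc n) t))\<^sup>2 \<le> rel_variance n t * (real n + 2)\<^sup>2 + 1"
    by simp
  then have "rel_variance (Suc n) t \<le> (rel_variance n t * (real n + 2)\<^sup>2 + 1) / (real n + 2)\<^sup>2"
    unfolding rel_variance_def[of "Suc n"] by (simp add: divide_right_mono add.commute)
  then show ?thesis by (simp add: add_divide_distrib)
qed

lemma rel_variance_le: "K \<le> n \<Longrightarrow> rel_variance n t \<le> rel_variance K t + 1 / (real K + 1)"
proof -
  assume "K \<le> n"
  then have "rel_variance n t + 1 / (real n + 1) \<le> rel_variance K t + 1 / (real K + 1)"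
  proof (induction n rule: dec_induct)
    case (step n)
    then show ?case
      using rel_variance_Suc_le[of n t] inverse_square_le_telescope[of n] by (simp add: add.commute)
  qed simp
  moreover have "0 \<le> 1 / (real n + 1)" by simp
  ultimately show ?thesis by linarith
qed

lemma tendsto_char:
  assumes "t \<longlonglongrightarrow> 0"
  shows "(\<lambda>n. char_p (t n)) \<longlonglongrightarrow> 1" "(\<lambda>n. char_u0 (t n)) \<longlonglongrightarrow> 1"
proof -
  have w: "(\<lambda>n. wave (t n) v) \<longlonglongrightarrow> 1" for v
  proof -
    have "(\<lambda>n. cis (t n \<bullet> v)) \<longlonglongrightarrow> cis (0 \<bullet> v)"
      by (intro tendsto_intros assms)
    then show ?thesis by (simp add: wave_def)
  qed
  have "(\<lambda>n. char_p (t n)) \<longlonglongrightarrow> (\<Sum>b\<in>set_pmf p. pmf p b *\<^sub>R 1)"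
    unfolding char_p_def by (intro tendsto_intros w)
  then show "(\<lambda>n. char_p (t n)) \<longlonglongrightarrow> 1"
    by (simp add: sum_pmf_p flip: scaleR_sum_left)
  have "(\<lambda>n. char_u0 (t n)) \<longlonglongrightarrow> (\<Sum>b\<in>set_pmf u0. pmf u0 b *\<^sub>R 1)"
    unfolding char_u0_def by (intro tendsto_intros w)
  then show "(\<lambda>n. char_u0 (t n)) \<longlonglongrightarrow> 1"
    by (simp add: sum_pmf_u0 flip: scaleR_sum_left)
qed

text \<open>At \<open>t = 0\<close> the total mass \<open>K + 1\<close> is deterministic, and the recursions make the first two moments
continuous in \<open>t\<close>.\<close>
lemma tendsto_rel_variance_fixed:
  assumes t: "t \<longlonglongrightarrow> 0"
  shows "(\<lambda>n. rel_variance K (t n)) \<longlonglongrightarrow> 0"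
proof -
  have m: "(\<lambda>n. mean_total K (t n)) \<longlonglongrightarrow> of_nat K + 1"
  proof (induction K)
    case (Suc K)
    have "(\<lambda>n. mean_total (Suc K) (t n)) \<longlonglongrightarrow> (of_nat K + 1) * (1 + 1 / (of_nat K + 1))"
      unfolding mean_total_Suc by (intro tendsto_intros Suc tendsto_char t) (simp add: of_nat_Suc[symmetric] add.commute del: of_nat_Suc)
    also have "(of_nat K + 1) * (1 + 1 / (of_nat K + 1)) = (of_nat (Suc K) + 1 :: complex)"
      by (simp add: distrib_left) (simp add: of_nat_Suc[symmetric] add.commute del: of_nat_Suc)
    finally show ?case .
  qed (simp add: mean_total_0 tendsto_char t)
  have s: "(\<lambda>n. second_total K (t n)) \<longlonglongrightarrow> (real K + 1)\<^sup>2"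
  proof (induction K)
    case 0
    show ?case using tendsto_power[OF tendsto_norm[OF tendsto_char(2)[OF t]], of 2]
      by (simp add: second_total_0)
  next
    case (Suc K)
    have "(\<lambda>n. second_total (Suc K) (t n)) \<longlonglongrightarrow> (real K + 1)\<^sup>2 * (1 + 2 * Re 1 / (real K + 1)) + (norm (1::complex))\<^sup>2"
      unfolding second_total_Suc by (intro tendsto_intros Suc tendsto_char t) simp
    also have "(real K + 1)\<^sup>2 * (1 + 2 * Re 1 / (real K + 1)) + (norm (1::complex))\<^sup>2 = (real (Suc K) + 1)\<^sup>2"
      using square_mult_one_plus[of "real K + 1"] by (simp add: power2_eq_square algebra_simps)
    finally show ?case .
  qed
  have "(\<lambda>n. rel_variance K (t n)) \<longlonglongrightarrow> ((real K + 1)\<^sup>2 - (norm (of_nat K + 1 :: complex))\<^sup>2) / (real K + 1)\<^sup>2"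
    unfolding rel_variance_def by (intro tendsto_intros m s) simp
  moreover have "norm (of_nat K + 1 :: complex) = real K + 1"
    using norm_of_nat[of "Suc K", where 'a = complex] by (simp add: add.commute)
  ultimately show ?thesis by simp
qed

text \<open>The increments after time \<open>K\<close> add up to at most \<open>1/(K+1)\<close> for every \<open>t\<close>, and the variance at time \<open>K\<close>
vanishes as \<open>t\<close> tends to 0. So choose \<open>K\<close> first.\<close>
lemma tendsto_rel_variance:
  assumes t: "t \<longlonglongrightarrow> 0"
  shows "(\<lambda>n. rel_variance n (t n)) \<longlonglongrightarrow> 0"
proof (rule order_tendstoI)
  fix e :: real assume e: "0 < e"
  obtain K where K: "1 / (real K + 1) < e / 2"
    using reals_Archimedean[of "e/2"] e by (auto simp: inverse_eq_divide add.commute)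
  have "eventually (\<lambda>n. rel_variance K (t n) < e / 2) sequentially"
    using tendsto_rel_variance_fixed[OF t, of K] e by (auto dest: order_tendstoD(2)[of _ _ _ "e/2"])
  then show "eventually (\<lambda>n. rel_variance n (t n) < e) sequentially"
    using eventually_ge_at_top[of K]
  proof eventually_elim
    case (elim n)
    then show ?case using rel_variance_le[of K n "t n"] K by linarith
  qed
next
  fix e :: real assume "e < 0"
  then show "eventually (\<lambda>n. e < rel_variance n (t n)) sequentially"
    using rel_variance_nonneg by (auto intro!: always_eventually intro: less_le_trans)
qed

lemma integral_abs_deviation_le:
  "(\<integral>\<omega>. norm (urn_total n (wave t) \<omega> - mean_total n t) / (real n + 1) \<partial>M) \<le> sqrt (rel_variance n t)"
proof -
  let ?Y = "\<lambda>\<omega>. norm (urn_total n (wave t) \<omega> - mean_total n t)"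
  have b: "?Y \<omega> \<le> real n + 1 + norm (mean_total n t)" for \<omega>
    by (rule order_trans[OF norm_triangle_ineq4]) (intro add_right_mono norm_urn_total_wave_le)
  have i1: "integrable M ?Y"
    by (rule integrable_const_bound[OF AE_I2]) (use b in auto)
  have i2: "integrable M (\<lambda>\<omega>. (?Y \<omega>)\<^sup>2)"
    by (rule integrable_const_bound[where B = "(real n + 1 + norm (mean_total n t))\<^sup>2"], rule AE_I2)
       (use b in \<open>auto intro!: power_mono\<close>)
  have "(\<integral>\<omega>. ?Y \<omega> \<partial>M)\<^sup>2 \<le> (\<integral>\<omega>. (?Y \<omega>)\<^sup>2 \<partial>M)"
    using variance_eq[OF i1 i2] variance_positive[of ?Y] by linarith
  then have "(\<integral>\<omega>. ?Y \<omega> \<partial>M) \<le> sqrt ((real n + 1)\<^sup>2 * rel_variance n t)"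
    unfolding integral_deviation by (rule real_le_rsqrt)
  then show ?thesis by (simp add: real_sqrt_mult divide_le_eq mult.commute)
qed

end

context color_urn
begin

lemma urn_total_mult_left:
  fixes h :: "'c \<Rightarrow> complex"
  shows "urn_total n (\<lambda>v. a * h v) \<omega> = a * urn_total n h \<omega>"
  by (simp add: urn_total_def step_def sum_distrib_left distrib_left)

lemma integral_of_Z_real:
  fixes h :: "'c \<Rightarrow> real"
  shows "(\<integral>\<omega>. h (Z n \<omega>) \<partial>M) = (\<integral>\<omega>. urn_total n h \<omega> / (real n + 1) \<partial>M)"
proof -
  have t: "urn_total n (\<lambda>v. complex_of_real (h v)) \<omega> = of_real (urn_total n h \<omega>)" for \<omega>
    by (simp add: urn_total_def step_def scaleR_conv_of_real)
  have "complex_of_real (\<integral>\<omega>. h (Z n \<omega>) \<partial>M) = of_real ((\<integral>\<omega>. urn_total n h \<omega> \<partial>M) / (real n + 1))"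
    using integral_of_Z[of "\<lambda>v. complex_of_real (h v)" n] unfolding t integral_complex_of_real by simp
  then show ?thesis by (simp only: of_real_eq_iff) simp
qed

end

section \<open>Limit of the random Fourier transform\<close>

context color_urn
begin

text \<open>The mean at the frequency \<open>r / sqrt (ln n)\<close>. The linear term of the expansion of \<open>\<phi>\<close>, multiplied by
\<open>ln n\<close>, is the phase that the factor in front removes; the quadratic term survives in the limit.\<close>
lemma mean_wave_limit:
  fixes r :: 'c
  defines "m \<equiv> (\<Sum>b\<in>set_pmf p. pmf p b *\<^sub>R b)"
  shows "(\<lambda>n. cis (- (sqrt (ln (real n)) * (r \<bullet> m))) * (mean_total n ((1 / sqrt (ln (real n))) *\<^sub>R r) / (of_nat n + 1)))
     \<longlonglongrightarrow> of_real (exp (- (\<Sum>b\<in>set_pmf p. pmf p b * (r \<bullet> b)\<^sup>2) / 2))"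
proof -
  define c where "c n = 1 / sqrt (ln (real n))" for n :: nat
  define \<delta> where "\<delta> n = char_p (c n *\<^sub>R r) - 1" for n
  have c0: "c \<longlonglongrightarrow> 0"
    unfolding c_def by real_asymp
  have cpos: "eventually (\<lambda>n. c n > 0) sequentially"
    unfolding c_def by real_asymp
  have t0: "(\<lambda>n. c n *\<^sub>R r) \<longlonglongrightarrow> 0"
    using tendsto_scaleR[OF c0 tendsto_const[of r]] by simp
  have "\<delta> \<longlonglongrightarrow> 0"
    unfolding \<delta>_def using tendsto_char(1)[OF t0] by (simp add: LIM_zero_iff)
  moreover have "norm (1 + \<delta> n) \<le> 1" for n
    by (simp add: \<delta>_def norm_char_p_le)
  moreover have "(\<lambda>n. \<delta> n * of_real (ln (real n)) - \<i> * of_real (sqrt (ln (real n)) * (r \<bullet> m)))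
      \<longlonglongrightarrow> (\<Sum>b\<in>set_pmf p. pmf p b *\<^sub>R (- of_real ((r \<bullet> b)\<^sup>2 / 2)))"
  proof (rule Lim_transform_eventually)
    show "(\<lambda>n. \<Sum>b\<in>set_pmf p. pmf p b *\<^sub>R ((cis (c n * (r \<bullet> b)) - 1) / of_real ((c n)\<^sup>2) - \<i> * of_real ((r \<bullet> b) / c n)))
       \<longlonglongrightarrow> (\<Sum>b\<in>set_pmf p. pmf p b *\<^sub>R (- of_real ((r \<bullet> b)\<^sup>2 / 2)))"
      by (intro tendsto_sum tendsto_scaleR tendsto_const cis_second_order c0 cpos)
    have "eventually (\<lambda>n. ln (real n) > 0) sequentially" by real_asymp
    then show "eventually (\<lambda>n. (\<Sum>b\<in>set_pmf p. pmf p b *\<^sub>R ((cis (c n * (r \<bullet> b)) - 1) / of_real ((c n)\<^sup>2) - \<i> * of_real ((r \<bullet> b) / c n))) =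
        \<delta> n * of_real (ln (real n)) - \<i> * of_real (sqrt (ln (real n)) * (r \<bullet> m))) sequentially"
    proof eventually_elim
      case (elim n)
      have c2: "x / of_real ((c n)\<^sup>2) = x * of_real (ln (real n))" for x :: complex
        using elim by (simp add: c_def power_divide)
      have c1: "y / c n = sqrt (ln (real n)) * y" for y
        by (simp add: c_def)
      have "(\<Sum>b\<in>set_pmf p. pmf p b *\<^sub>R ((cis (c n * (r \<bullet> b)) - 1) / of_real ((c n)\<^sup>2) - \<i> * of_real ((r \<bullet> b) / c n))) =
        (\<Sum>b\<in>set_pmf p. pmf p b *\<^sub>R (cis (c n * (r \<bullet> b)) - 1)) * of_real (ln (real n)) -
        \<i> * of_real (sqrt (ln (real n)) * (\<Sum>b\<in>set_pmf p. pmf p b * (r \<bullet> b)))"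
        unfolding c1 c2 by (simp add: scaleR_diff_right sum_subtractf sum_distrib_left sum_distrib_right scaleR_conv_of_real mult_ac left_diff_distrib right_diff_distrib)
      moreover have "(\<Sum>b\<in>set_pmf p. pmf p b *\<^sub>R (cis (c n * (r \<bullet> b)) - 1)) = \<delta> n"
        using sum_pmf_p
        by (simp add: \<delta>_def char_p_def wave_def scaleR_diff_right sum_subtractf flip: scaleR_sum_left)
      moreover have "(\<Sum>b\<in>set_pmf p. pmf p b * (r \<bullet> b)) = r \<bullet> m"
        by (simp add: m_def inner_sum_right)
      ultimately show ?case by simp
    qed
  qed
  ultimately have lim: "(\<lambda>n. cis (- (sqrt (ln (real n)) * (r \<bullet> m))) * ((\<Prod>k=1..n. 1 + (1 + \<delta> n) / of_nat k) / (of_nat n + 1)))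
      \<longlonglongrightarrow> exp (\<Sum>b\<in>set_pmf p. pmf p b *\<^sub>R (- of_real ((r \<bullet> b)\<^sup>2 / 2)))"
    by (rule growth_product_asymptotics)
  have "(\<Sum>b\<in>set_pmf p. pmf p b *\<^sub>R (- of_real ((r \<bullet> b)\<^sup>2 / 2))) =
      (of_real (- (\<Sum>b\<in>set_pmf p. pmf p b * (r \<bullet> b)\<^sup>2) / 2) :: complex)"
    by (simp add: sum_divide_distrib sum_negf scaleR_conv_of_real)
  then have e: "exp (\<Sum>b\<in>set_pmf p. pmf p b *\<^sub>R (- of_real ((r \<bullet> b)\<^sup>2 / 2))) =
      (of_real (exp (- (\<Sum>b\<in>set_pmf p. pmf p b * (r \<bullet> b)\<^sup>2) / 2)) :: complex)"
    by (simp only: exp_of_real)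
  have \<delta>1: "1 + \<delta> n = char_p (c n *\<^sub>R r)" for n
    by (simp add: \<delta>_def)
  have "char_u0 (c n *\<^sub>R r) * (x * ((\<Prod>k=1..n. 1 + (1 + \<delta> n) / of_nat k) / y)) = x * (mean_total n (c n *\<^sub>R r) / y)" for n x y
    unfolding \<delta>1 mean_total_eq_prod by (simp only: times_divide_eq_right mult.left_commute)
  with tendsto_mult[OF tendsto_char(2)[OF t0] lim] show ?thesis
    unfolding e c_def by (simp only: mult_1)
qed

lemma wave_total_limit:
  fixes r :: 'c
  defines "m \<equiv> (\<Sum>b\<in>set_pmf p. pmf p b *\<^sub>R b)"
  shows "(\<lambda>n. \<integral>\<omega>. norm (cis (- (sqrt (ln (real n)) * (r \<bullet> m))) * (urn_total n (wave ((1 / sqrt (ln (real n))) *\<^sub>R r)) \<omega> / (of_nat n + 1))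
       - of_real (exp (- (\<Sum>b\<in>set_pmf p. pmf p b * (r \<bullet> b)\<^sup>2) / 2))) \<partial>M) \<longlonglongrightarrow> 0"
proof -
  define t where "t n = (1 / sqrt (ln (real n))) *\<^sub>R r" for n :: nat
  define a where "a n = cis (- (sqrt (ln (real n)) * (r \<bullet> m)))" for n :: nat
  define g :: complex where "g = of_real (exp (- (\<Sum>b\<in>set_pmf p. pmf p b * (r \<bullet> b)\<^sup>2) / 2))"
  have "(\<lambda>n. 1 / sqrt (ln (real n))) \<longlonglongrightarrow> 0" by real_asymp
  from tendsto_scaleR[OF this tendsto_const[of r]] have t0: "t \<longlonglongrightarrow> 0" unfolding t_def by simp
  have bnd: "(\<integral>\<omega>. norm (a n * (urn_total n (wave (t n)) \<omega> / (of_nat n + 1)) - g) \<partial>M) \<le>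
      sqrt (rel_variance n (t n)) + norm (a n * (mean_total n (t n) / (of_nat n + 1)) - g)" for n
  proof -
    let ?W = "urn_total n (wave (t n))" and ?m = "mean_total n (t n)"
    have norm_scaled: "norm (a n * (z / (of_nat n + 1))) = norm z / (real n + 1)" for z
    proof -
      have "norm (of_nat n + 1 :: complex) = real n + 1"
        using norm_of_nat[of "Suc n", where 'a = complex] by (simp add: add.commute)
      moreover have "norm (a n * (z / (of_nat n + 1))) = norm (z / (of_nat n + 1))"
        by (simp only: norm_mult a_def norm_cis mult_1)
      ultimately show ?thesis by (simp only: norm_divide)
    qed
    have "(\<integral>\<omega>. norm (a n * (?W \<omega> / (of_nat n + 1)) - g) \<partial>M) \<le>
       (\<integral>\<omega>. norm (?W \<omega> - ?m) / (real n + 1) + norm (a n * (?m / (of_nat n + 1)) - g) \<partial>M)"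
    proof (rule integral_mono)
      fix \<omega> assume "\<omega> \<in> space M"
      have split: "a n * (?W \<omega> / (of_nat n + 1)) - g = a n * ((?W \<omega> - ?m) / (of_nat n + 1)) + (a n * (?m / (of_nat n + 1)) - g)"
        by (simp add: diff_divide_distrib right_diff_distrib)
      show "norm (a n * (?W \<omega> / (of_nat n + 1)) - g) \<le> norm (?W \<omega> - ?m) / (real n + 1) + norm (a n * (?m / (of_nat n + 1)) - g)"
        unfolding split norm_scaled[of "?W \<omega> - ?m", symmetric] by (rule norm_triangle_ineq)
    qed (intro integrable_norm Bochner_Integration.integrable_diff Bochner_Integration.integrable_add
        integrable_mult_right integrable_divide urn_total_integrable integrable_const)+
    also have "\<dots> = (\<integral>\<omega>. norm (?W \<omega> - ?m) / (real n + 1) \<partial>M) + norm (a n * (?m / (of_nat n + 1)) - g)"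
      by (subst Bochner_Integration.integral_add)
         (simp_all only: prob_space integrable_const integrable_norm Bochner_Integration.integrable_diff
            integrable_divide urn_total_integrable lebesgue_integral_const scaleR_one)
    also have "\<dots> \<le> sqrt (rel_variance n (t n)) + norm (a n * (?m / (of_nat n + 1)) - g)"
      by (intro add_right_mono integral_abs_deviation_le)
    finally show ?thesis .
  qed
  have lim: "(\<lambda>n. sqrt (rel_variance n (t n)) + norm (a n * (mean_total n (t n) / (of_nat n + 1)) - g)) \<longlonglongrightarrow> 0"
  proof -
    have "(\<lambda>n. a n * (mean_total n (t n) / (of_nat n + 1)) - g) \<longlonglongrightarrow> 0"
      using mean_wave_limit[of r] unfolding a_def t_def g_def m_def by (simp only: LIM_zero_iff)
    from tendsto_add[OF tendsto_real_sqrt[OF tendsto_rel_variance[OF t0]] tendsto_norm_zero[OF this]]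
    show ?thesis by simp
  qed
  have "(\<lambda>n. \<integral>\<omega>. norm (a n * (urn_total n (wave (t n)) \<omega> / (of_nat n + 1)) - g) \<partial>M) \<longlonglongrightarrow> 0"
    by (rule tendsto_sandwich[OF _ _ tendsto_const lim]) (use bnd in \<open>auto intro!: always_eventually\<close>)
  then show ?thesis unfolding a_def t_def g_def .
qed

text \<open>For each single \<open>\<omega>\<close> the urn has finitely many colours; in contrast to \<open>AE_urn_total\<close>, the finite set
depends on \<open>\<omega>\<close> and there is no exceptional null set.\<close>
lemma trajectory_support:
  fixes n :: nat
  assumes \<omega>: "\<omega> \<in> space M"
  defines "F \<equiv> set_pmf u0 \<union> (\<Union>k<n. (+) (Z k \<omega>) ` set_pmf p)"
  shows "finite F" "F \<subseteq> S" "urn_total n h \<omega> = (\<Sum>v\<in>F. U n \<omega> v *\<^sub>R h v)" "\<And>v. v \<in> S - F \<Longrightarrow> U n \<omega> v = 0"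
proof -
  show F: "finite F" "F \<subseteq> S"
    unfolding F_def using finite_u0 finite_p u0_subset Z_in_S[OF \<omega>] S_add by auto
  show "urn_total n h \<omega> = (\<Sum>v\<in>F. U n \<omega> v *\<^sub>R h v)" "\<And>v. v \<in> S - F \<Longrightarrow> U n \<omega> v = 0"
    by (rule urn_total_eq_sum[OF \<omega> F]; auto simp: F_def)+
qed

lemma urn_total_one: "urn_total n (\<lambda>_. 1 :: real) \<omega> = real n + 1"
  by (simp add: urn_total_def step_def sum_pmf_u0 sum_pmf_p)

lemma sets_urn_measure [simp]: "sets (urn_measure S U n \<omega>) = sets borel"
  by (simp add: urn_measure_def)

lemma prob_space_urn_measure:
  assumes \<omega>: "\<omega> \<in> space M"
  shows "prob_space (urn_measure S U n \<omega>)"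
proof -
  define F where "F = set_pmf u0 \<union> (\<Union>k<n. (+) (Z k \<omega>) ` set_pmf p)"
  note F = trajectory_support[OF \<omega>, where n = n, folded F_def]
  let ?d = "density (count_space S) (\<lambda>v. ennreal (U n \<omega> v / (real n + 1)))"
  have "emeasure ?d (space ?d) = (\<integral>\<^sup>+v. ennreal (U n \<omega> v / (real n + 1)) \<partial>count_space S)"
    by (subst emeasure_density) (auto intro!: nn_integral_cong)
  also have "\<dots> = (\<Sum>v\<in>F. ennreal (U n \<omega> v / (real n + 1)))"
    using F by (intro nn_integral_count_space') auto
  also have "\<dots> = ennreal (\<Sum>v\<in>F. U n \<omega> v / (real n + 1))"
    using F(2) U_nonneg[OF \<omega>] by (intro sum_ennreal) auto
  also have "(\<Sum>v\<in>F. U n \<omega> v / (real n + 1)) = 1"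
    using F(3)[of "\<lambda>_. 1 :: real"] by (simp add: urn_total_one sum_divide_distrib[symmetric])
  finally have "prob_space ?d" by (intro prob_spaceI) simp
  then show ?thesis
    unfolding urn_measure_def by (rule prob_space.prob_space_distr) simp
qed

lemma integral_urn_measure:
  fixes h :: "'c \<Rightarrow> 'd::{banach, second_countable_topology}"
  assumes \<omega>: "\<omega> \<in> space M" and h: "h \<in> borel_measurable borel"
  shows "(\<integral>x. h x \<partial>urn_measure S U n \<omega>) = urn_total n h \<omega> /\<^sub>R (real n + 1)"
proof -
  define F where "F = set_pmf u0 \<union> (\<Union>k<n. (+) (Z k \<omega>) ` set_pmf p)"
  note F = trajectory_support[OF \<omega>, where n = n, folded F_def]
  have "(\<integral>x. h x \<partial>urn_measure S U n \<omega>) = (\<integral>v. h v \<partial>density (count_space S) (\<lambda>v. ennreal (U n \<omega> v / (real n + 1))))"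
    unfolding urn_measure_def using h by (subst integral_distr) auto
  also have "\<dots> = (\<integral>v. (U n \<omega> v / (real n + 1)) *\<^sub>R h v \<partial>count_space S)"
    using U_nonneg[OF \<omega>] by (subst integral_density) (auto simp: AE_count_space)
  also have "\<dots> = (\<Sum>v | v \<in> S \<and> (U n \<omega> v / (real n + 1)) *\<^sub>R h v \<noteq> 0. (U n \<omega> v / (real n + 1)) *\<^sub>R h v)"
    by (rule lebesgue_integral_count_space_finite_support) (rule finite_subset[OF _ F(1)], use F(4) in auto)
  also have "\<dots> = (\<Sum>v\<in>F. (U n \<omega> v / (real n + 1)) *\<^sub>R h v)"
    using F(1,2,4) by (intro sum.mono_neutral_left) auto
  also have "\<dots> = urn_total n h \<omega> /\<^sub>R (real n + 1)"
    unfolding F(3) by (simp add: scaleR_sum_right divide_inverse mult.commute)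
  finally show ?thesis .
qed

text \<open>The first \<open>n\<close> draws take countably many values, so every function of them is measurable, for any
\<open>\<sigma>\<close>-algebra on the target. In particular this covers the one generated by all weakly open sets.\<close>
lemma measurable_of_trajectory:
  assumes "\<And>\<omega> \<omega>'. \<omega> \<in> space M \<Longrightarrow> \<omega>' \<in> space M \<Longrightarrow> (\<And>k. k < n \<Longrightarrow> Z k \<omega> = Z k \<omega>') \<Longrightarrow> \<Phi> \<omega> = \<Phi> \<omega>'"
    and "\<And>\<omega>. \<omega> \<in> space M \<Longrightarrow> \<Phi> \<omega> \<in> space N"
  shows "\<Phi> \<in> measurable M N"
proof (rule measurableI)
  fix A assume A: "A \<in> sets N"
  let ?tr = "\<lambda>\<omega>. map (\<lambda>k. Z k \<omega>) [0..<n]"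
  have "?tr \<in> measurable M (count_space (lists S))"
    unfolding measurable_count_space_eq_countable[OF countable_lists[OF countable_S]]
  proof (intro conjI ballI)
    show "?tr \<in> space M \<rightarrow> lists S" using Z_in_S by auto
    fix zs assume "zs \<in> lists S"
    have "?tr -` {zs} \<inter> space M = {\<omega> \<in> space M. length zs = n \<and> (\<forall>k\<in>{..<n}. Z k \<omega> = zs ! k)}"
    proof -
      have "?tr \<omega> = zs \<longleftrightarrow> length zs = n \<and> (\<forall>k\<in>{..<n}. Z k \<omega> = zs ! k)" for \<omega>
        unfolding list_eq_iff_nth_eq by auto
      then show ?thesis by blast
    qed
    also have "\<dots> \<in> sets M"
      by (intro sets.sets_Collect_conj sets.sets_Collect_const sets.sets_Collect_finite_All) auto
    finally show "?tr -` {zs} \<inter> space M \<in> sets M" .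
  qed
  then have "?tr -` {zs \<in> lists S. \<exists>\<omega>\<in>space M. ?tr \<omega> = zs \<and> \<Phi> \<omega> \<in> A} \<inter> space M \<in> sets M"
    by (rule measurable_sets) auto
  also have "?tr -` {zs \<in> lists S. \<exists>\<omega>\<in>space M. ?tr \<omega> = zs \<and> \<Phi> \<omega> \<in> A} \<inter> space M = \<Phi> -` A \<inter> space M"
  proof (intro equalityI subsetI)
    fix \<omega> assume "\<omega> \<in> ?tr -` {zs \<in> lists S. \<exists>\<omega>\<in>space M. ?tr \<omega> = zs \<and> \<Phi> \<omega> \<in> A} \<inter> space M"
    then obtain \<omega>' where \<omega>': "\<omega> \<in> space M" "\<omega>' \<in> space M" "?tr \<omega>' = ?tr \<omega>" "\<Phi> \<omega>' \<in> A" by auto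
    have "Z k \<omega> = Z k \<omega>'" if "k < n" for k
      using \<omega>'(3) that by (auto simp: list_eq_iff_nth_eq)
    from assms(1)[OF \<omega>'(1,2) this] \<omega>' show "\<omega> \<in> \<Phi> -` A \<inter> space M" by simp
  next
    fix \<omega> assume "\<omega> \<in> \<Phi> -` A \<inter> space M"
    then show "\<omega> \<in> ?tr -` {zs \<in> lists S. \<exists>\<omega>\<in>space M. ?tr \<omega> = zs \<and> \<Phi> \<omega> \<in> A} \<inter> space M"
      using Z_in_S by (auto intro!: bexI[of _ \<omega>])
  qed
  finally show "\<Phi> -` A \<inter> space M \<in> sets M" .
qed (rule assms(2))

lemma urn_measure_trajectory:
  assumes "\<omega> \<in> space M" "\<omega>' \<in> space M" "\<And>k. k < n \<Longrightarrow> Z k \<omega> = Z k \<omega>'"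
  shows "urn_measure S U n \<omega> = urn_measure S U n \<omega>'"
proof -
  have "density (count_space S) (\<lambda>v. ennreal (U n \<omega> v / (real n + 1))) = density (count_space S) (\<lambda>v. ennreal (U n \<omega>' v / (real n + 1)))"
    using assms by (intro density_cong) (auto simp: AE_count_space U_eq_sum)
  then show ?thesis by (simp add: urn_measure_def)
qed

end

section \<open>Support set, increments and rescaling\<close>

text \<open>An integer combination is encoded by the list of its coefficients and vectors.\<close>
lemma countable_color_set:
  assumes "countable B"
  shows "countable (color_set B)"
proof (rule countable_subset)
  show "color_set B \<subseteq> (\<lambda>xs. \<Sum>(n, b)\<leftarrow>xs. real n *\<^sub>R b) ` lists (UNIV \<times> B)"
  proof
    fix v assume "v \<in> color_set B"
    then obtain k :: nat and n b where v: "v = (\<Sum>i=1..k. real (n i) *\<^sub>R b i)" and b: "\<And>i. i \<in> {1..k} \<Longrightarrow> b i \<in> B"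
      unfolding color_set_def by blast
    let ?xs = "map (\<lambda>i. (n i, b i)) [1..<Suc k]"
    have "v = (\<Sum>(n, b)\<leftarrow>?xs. real n *\<^sub>R b)"
      unfolding v by (simp only: map_map o_def prod.case interv_sum_list_conv_sum_set_nat set_upt atLeastLessThanSuc_atLeastAtMost)
    moreover have "?xs \<in> lists (UNIV \<times> B)" using b by (auto simp del: upt_Suc)
    ultimately show "v \<in> (\<lambda>xs. \<Sum>(n, b)\<leftarrow>xs. real n *\<^sub>R b) ` lists (UNIV \<times> B)" by (rule image_eqI)
  qed
  show "countable ((\<lambda>xs. \<Sum>(n, b)\<leftarrow>xs. real n *\<^sub>R b) ` lists (UNIV \<times> B))"
    using assms by (intro countable_image countable_lists countable_SIGMA) auto
qed

lemma color_set_add: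
  assumes "v \<in> color_set B" "b \<in> B"
  shows "v + b \<in> color_set B"
proof -
  obtain k :: nat and n c where v: "v = (\<Sum>i=1..k. real (n i) *\<^sub>R c i)" and k: "k \<ge> 1"
      and c: "\<And>i. i \<in> {1..k} \<Longrightarrow> c i \<in> B"
    using assms(1) unfolding color_set_def by blast
  let ?n = "n(Suc k := 1)" and ?c = "c(Suc k := b)"
  have "v + b = (\<Sum>i=1..Suc k. real (?n i) *\<^sub>R ?c i)"
    by (simp add: v)
  moreover have "\<forall>i\<in>{1..Suc k}. ?c i \<in> B"
    using c assms(2) by (auto simp: le_Suc_eq)
  ultimately show ?thesis
    unfolding color_set_def using k by (intro CollectI exI[of _ "Suc k"] exI[of _ ?n] exI[of _ ?c]) simp
qed

lemma iid_increments_expectation: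
  fixes g :: "real^'n \<Rightarrow> 'e::{banach, second_countable_topology}"
  assumes iid: "iid_increments N X p" and fin: "finite (set_pmf p)" and g: "g \<in> borel_measurable borel"
  shows "(\<integral>\<omega>. g (X 1 \<omega>) \<partial>N) = (\<Sum>b\<in>set_pmf p. pmf p b *\<^sub>R g b)"
proof -
  interpret prob_space N using iid by (simp add: iid_increments_def)
  have [measurable]: "X 1 \<in> borel_measurable N"
    using iid by (simp add: iid_increments_def indep_vars_def)
  have gX: "(\<lambda>\<omega>. g (X 1 \<omega>)) \<in> borel_measurable N"
    by (rule measurable_compose[OF _ g]) measurable
  have P: "measure N {\<omega> \<in> space N. X 1 \<omega> = v} = pmf p v" for v
    using iid by (simp add: iid_increments_def)
  let ?A = "\<lambda>b. {\<omega> \<in> space N. X 1 \<omega> = b}"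
  have A: "?A b \<in> sets N" for b by measurable
  have "measure N (\<Union>b\<in>set_pmf p. ?A b) = (\<Sum>b\<in>set_pmf p. measure N (?A b))"
    using A fin by (intro finite_measure_finite_Union) (auto simp: disjoint_family_on_def)
  also have "\<dots> = 1"
    using sum_pmf_eq_1[OF fin subset_refl] by (simp only: P)
  finally have "AE \<omega> in N. \<omega> \<in> (\<Union>b\<in>set_pmf p. ?A b)"
    by (rule AE_prob_1)
  then have "AE \<omega> in N. g (X 1 \<omega>) = (\<Sum>b\<in>set_pmf p. indicat_real (?A b) \<omega> *\<^sub>R g b)"
  proof eventually_elim
    case (elim \<omega>)
    then have \<omega>: "\<omega> \<in> space N" "X 1 \<omega> \<in> set_pmf p" by auto
    have "(\<Sum>b\<in>set_pmf p. indicat_real (?A b) \<omega> *\<^sub>R g b) = (\<Sum>b\<in>set_pmf p. if b = X 1 \<omega> then g b else 0)"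
      using \<omega>(1) by (intro sum.cong) (auto simp: indicator_def)
    then show ?case using \<omega>(2) fin by simp
  qed
  then have "(\<integral>\<omega>. g (X 1 \<omega>) \<partial>N) = (\<integral>\<omega>. (\<Sum>b\<in>set_pmf p. indicat_real (?A b) \<omega> *\<^sub>R g b) \<partial>N)"
    using A gX by (intro integral_cong_AE) (auto simp del: One_nat_def)
  also have "\<dots> = (\<Sum>b\<in>set_pmf p. pmf p b *\<^sub>R g b)"
    using A by (subst Bochner_Integration.integral_sum) (auto simp: P emeasure_eq_measure simp del: One_nat_def)
  finally show ?thesis .
qed

text \<open>The matrix enters the limit only through its quadratic form \<open>E (r \<bullet> X\<^sub>1)\<^sup>2\<close>.\<close>
lemma second_moment_quadratic_form:
  fixes r :: "real^'n"
  assumes iid: "iid_increments N X p" and fin: "finite (set_pmf p)"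
  shows "r \<bullet> (second_moment_matrix N (X 1) *v r) = (\<Sum>b\<in>set_pmf p. pmf p b * (r \<bullet> b)\<^sup>2)"
proof -
  let ?g = "\<lambda>x::real^'n. (columnvector x :: real^1^'n) ** (rowvector x :: real^'n^1)"
  have g: "?g x = (\<chi> i j. x $ i * x $ j)" for x
    by (simp add: columnvector_def rowvector_def matrix_matrix_mult_def vec_eq_iff sum_1)
  have "continuous_on UNIV ?g"
    unfolding g by (intro continuous_on_vec_lambda continuous_intros)
  then have "second_moment_matrix N (X 1) = (\<Sum>b\<in>set_pmf p. pmf p b *\<^sub>R ?g b)"
    unfolding second_moment_matrix_def by (intro iid_increments_expectation[OF iid fin] borel_measurable_continuous_onI)
  moreover have "r \<bullet> ((\<Sum>b\<in>F. pmf p b *\<^sub>R ?g b) *v r) = (\<Sum>b\<in>F. pmf p b * (r \<bullet> b)\<^sup>2)" if "finite F" for F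
    using that
  proof induction
    case (insert b F)
    have "?g b *v r = (b \<bullet> r) *\<^sub>R b"
      by (simp add: g matrix_vector_mult_def vec_eq_iff inner_vec_def sum_distrib_left sum_distrib_right mult_ac)
    then have "r \<bullet> ((pmf p b *\<^sub>R ?g b) *v r) = pmf p b * (r \<bullet> b)\<^sup>2"
      by (simp add: scaleR_matrix_vector_assoc[symmetric] power2_eq_square inner_commute)
    then show ?case
      using insert by (simp add: matrix_vector_mult_add_rdistrib inner_add_right)
  qed simp
  ultimately show ?thesis using fin by simp
qed

text \<open>The set function \<open>A \<mapsto> P (c A Q + b)\<close> is the image of \<open>P\<close> under the inverse of the affine bijection
\<open>a \<mapsto> c a Q + b\<close>. Since \<open>Q\<close> is symmetric, \<open>a v* Q\<close> is \<open>Q *v a\<close>.\<close>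
lemma affine_rescale_eq_distr:
  fixes P :: "(real^'n) measure"
  assumes P: "sets P = sets borel" and c: "c \<noteq> 0" and Q: "Qi ** Q = mat 1" and sym: "transpose Q = Q"
  shows "affine_rescale P c Q b = distr P borel (\<lambda>x. (1 / c) *\<^sub>R (Qi *v (x - b)))"
proof -
  let ?g = "\<lambda>a. c *\<^sub>R (a v* Q) + b" and ?G = "\<lambda>x. (1 / c) *\<^sub>R (Qi *v (x - b))"
  have Q': "Q ** Qi = mat 1" using Q by (simp add: matrix_left_right_inverse)
  have vQ: "a v* Q = Q *v a" for a
    using transpose_matrix_vector[of Q a] by (simp add: sym)
  have Gg: "?G (?g a) = a" for a
    using c by (simp add: vQ matrix_vector_mult_scaleR matrix_vector_mul_assoc Q)
  have gG: "?g (?G x) = x" for x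
    using c by (simp add: vQ matrix_vector_mult_scaleR matrix_vector_mul_assoc Q')
  have spP: "space P = UNIV" using sets_eq_imp_space_eq[OF P] by simp
  have [measurable_cong]: "sets P = sets borel" by fact
  have "?G \<in> borel_measurable borel"
    by (intro borel_measurable_continuous_onI continuous_intros linear_continuous_on matrix_vector_mul_bounded_linear
        bounded_linear.continuous_on[OF matrix_vector_mul_bounded_linear])
  then have G: "?G \<in> borel_measurable P" by measurable
  have "affine_rescale P c Q b = measure_of UNIV (sets borel) (emeasure (distr P borel ?G))"
    unfolding affine_rescale_def
  proof (rule measure_of_eq)
    fix A :: "(real^'n) set" assume "A \<in> sigma_sets UNIV (sets borel)"
    then have A: "A \<in> sets borel" using sets.sigma_sets_eq[of "borel :: (real^'n) measure"] by simp
    have "?g ` A = ?G -` A"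
    proof (intro equalityI subsetI)
      fix x assume "x \<in> ?G -` A"
      then have "?g (?G x) \<in> ?g ` A" by (intro imageI) simp
      then show "x \<in> ?g ` A" by (simp only: gG)
    next
      fix x assume "x \<in> ?g ` A"
      then obtain a where "a \<in> A" "x = ?g a" by blast
      then show "x \<in> ?G -` A" using Gg[of a] by simp
    qed
    then show "emeasure P (?g ` A) = emeasure (distr P borel ?G) A"
      using A G by (simp add: emeasure_distr spP)
  qed auto
  also have "\<dots> = distr P borel ?G"
    using measure_of_of_measure[of "distr P borel ?G"] by simp
  finally show ?thesis .
qed

section \<open>The limit theorem\<close>

theorem theorem15:
  fixes N :: "'b measure" and X :: "nat \<Rightarrow> 'b \<Rightarrow> real^'d::finite"
    and p u0 :: "(real^'d) pmf"
    and M :: "'a measure"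
    and U :: "nat \<Rightarrow> 'a \<Rightarrow> real^'d \<Rightarrow> real"
    and Z :: "nat \<Rightarrow> 'a \<Rightarrow> real^'d"
    and \<Lambda>cs :: "nat \<Rightarrow> 'a \<Rightarrow> (real^'d) measure"
  defines "B \<equiv> set_pmf p"
  defines "S \<equiv> color_set B"
  defines "\<mu> \<equiv> prob_space.expectation N (X 1)"
  defines "\<Sigma> \<equiv> second_moment_matrix N (X 1)"
  defines "\<Lambda>cs \<equiv> (\<lambda>n \<omega>. affine_rescale (urn_measure S U n \<omega>)
                          (sqrt (ln (real n))) (matrix_sqrt \<Sigma>) (ln (real n) *\<^sub>R \<mu>))"
  assumes increments: "iid_increments N X p"
    and finite_support: "finite B"
    and Sigma: "pos_definite \<Sigma>"
    and urn: "infinite_color_urn M S p u0 U Z"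
  shows "tendsto_in_prob M weak_topology \<Lambda>cs std_gaussian"
proof -
  have fin: "finite (set_pmf p)" using finite_support by (simp add: B_def)
  interpret color_urn M S p u0 U Z
  proof (intro color_urn.intro color_urn_axioms.intro)
    show "prob_space M" using urn by (simp add: infinite_color_urn_def)
    show "countable S" unfolding S_def using finite_support by (intro countable_color_set countable_finite)
    show "z + b \<in> S" if "z \<in> S" "b \<in> set_pmf p" for z b
      using that unfolding S_def B_def by (rule color_set_add)
  qed (use urn fin in auto)
  define Q where "Q = matrix_sqrt \<Sigma>"
  have Q: "pos_definite Q" "Q ** Q = \<Sigma>"
    unfolding Q_def using Sigma by (rule matrix_sqrt_pos_definite)+
  have symQ: "transpose Q = Q" using Q(1) by (simp add: pos_definite_def)
  have "\<forall>x. Q *v x = 0 \<longrightarrow> x = 0"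
    using Q(1) unfolding pos_definite_def by (metis inner_zero_right less_irrefl)
  then obtain Qi where Qi: "Qi ** Q = mat 1"
    using matrix_left_invertible_ker[of Q] by blast
  have \<mu>: "\<mu> = (\<Sum>b\<in>set_pmf p. pmf p b *\<^sub>R b)"
    unfolding \<mu>_def using iid_increments_expectation[OF increments fin, of "\<lambda>x. x"] by simp
  define G where "G n x = (1 / sqrt (ln (real n))) *\<^sub>R (Qi *v (x - ln (real n) *\<^sub>R \<mu>))" for n x
  have G_cont: "continuous_on UNIV (G n)" for n
    unfolding G_def
    by (intro continuous_intros bounded_linear.continuous_on[OF matrix_vector_mul_bounded_linear])
  have Gm [measurable]: "G n \<in> borel_measurable borel" for n
    by (rule borel_measurable_continuous_onI[OF G_cont])
  have \<Lambda>_distr: "\<Lambda>cs n \<omega> = distr (urn_measure S U n \<omega>) borel (G n)" if "n \<ge> 2" for n \<omega>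
  proof -
    have "sqrt (ln (real n)) \<noteq> 0" using that by simp
    then show ?thesis
      unfolding \<Lambda>cs_def G_def Q_def[symmetric] by (intro affine_rescale_eq_distr Qi symQ sets_urn_measure)
  qed
  have integral_\<Lambda>: "(\<integral>x. f x \<partial>\<Lambda>cs n \<omega>) = urn_total n (\<lambda>v. f (G n v)) \<omega> /\<^sub>R (real n + 1)"
    if "n \<ge> 2" "\<omega> \<in> space M" "f \<in> borel_measurable borel" for n \<omega> and f :: "real^'d \<Rightarrow> 'e::{banach, second_countable_topology}"
  proof -
    have "G n \<in> measurable (urn_measure S U n \<omega>) borel"
      using Gm[of n] by (simp cong: measurable_cong_sets)
    then have "(\<integral>x. f x \<partial>\<Lambda>cs n \<omega>) = (\<integral>v. f (G n v) \<partial>urn_measure S U n \<omega>)"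
      unfolding \<Lambda>_distr[OF that(1)] using that(3) by (rule integral_distr)
    then show ?thesis
      using integral_urn_measure[OF that(2), of "\<lambda>v. f (G n v)" n] measurable_compose[OF Gm that(3)] by simp
  qed
  have prob_\<Lambda>: "prob_space (\<Lambda>cs n \<omega>)" "sets (\<Lambda>cs n \<omega>) = sets borel" if "n \<ge> 2" "\<omega> \<in> space M" for n \<omega>
  proof -
    have "G n \<in> measurable (urn_measure S U n \<omega>) borel"
      using Gm[of n] by (simp cong: measurable_cong_sets)
    then show "prob_space (\<Lambda>cs n \<omega>)"
      unfolding \<Lambda>_distr[OF that(1)] by (intro prob_space.prob_space_distr prob_space_urn_measure that(2))
    show "sets (\<Lambda>cs n \<omega>) = sets borel" unfolding \<Lambda>_distr[OF that(1)] by simp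
  qed
  have char_lim: "(\<lambda>n. \<integral>\<omega>. norm ((\<integral>x. cis (s \<bullet> x) \<partial>\<Lambda>cs n \<omega>) - of_real (exp (- (s \<bullet> s) / 2))) \<partial>M) \<longlonglongrightarrow> 0" for s
  proof -
    \<comment> \<open>The frequency \<open>s\<close> of the rescaled measure corresponds to \<open>r / sqrt (ln n)\<close> before rescaling, with \<open>Q *v r = s\<close>.\<close>
    define r where "r = s v* Qi"
    have "Q *v r = r v* Q" using transpose_matrix_vector[of Q r] by (simp add: symQ)
    also have "\<dots> = s v* (Qi ** Q)" by (simp add: r_def vector_matrix_mul_assoc)
    finally have Qr: "Q *v r = s" by (simp add: Qi)
    have "(\<Sum>b\<in>set_pmf p. pmf p b * (r \<bullet> b)\<^sup>2) = r \<bullet> (Q *v (Q *v r))"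
      unfolding second_moment_quadratic_form[OF increments fin, symmetric] \<Sigma>_def[symmetric] Q(2)[symmetric]
      by (simp add: matrix_vector_mul_assoc)
    also have "\<dots> = s \<bullet> s"
      using symmetric_matrix_selfadjoint[OF symQ, of r s] Qr by simp
    finally have var: "(\<Sum>b\<in>set_pmf p. pmf p b * (r \<bullet> b)\<^sup>2) = s \<bullet> s" .
    have wave_G: "cis (s \<bullet> G n v) = cis (- (sqrt (ln (real n)) * (r \<bullet> \<mu>))) * wave ((1 / sqrt (ln (real n))) *\<^sub>R r) v"
      if "n \<ge> 2" for n v
    proof -
      have pos: "ln (real n) > 0" using that by simp
      have "s \<bullet> G n v = (1 / sqrt (ln (real n))) * (r \<bullet> (v - ln (real n) *\<^sub>R \<mu>))"
        by (simp add: G_def r_def dot_lmul_matrix)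
      also have "\<dots> = - (sqrt (ln (real n)) * (r \<bullet> \<mu>)) + ((1 / sqrt (ln (real n))) *\<^sub>R r) \<bullet> v"
      proof -
        have "ln (real n) * y / sqrt (ln (real n)) = sqrt (ln (real n)) * y" for y
          using pos by (simp only: times_divide_eq_left[symmetric] real_div_sqrt less_imp_le)
        then show ?thesis by (simp add: inner_diff_right right_diff_distrib)
      qed
      finally show ?thesis by (simp only: wave_def cis_mult)
    qed
    have cis_m: "(\<lambda>x. cis (s \<bullet> x)) \<in> borel_measurable borel"
      by (intro borel_measurable_continuous_onI continuous_intros)
    have ev: "eventually (\<lambda>n. (\<integral>\<omega>. norm (cis (- (sqrt (ln (real n)) * (r \<bullet> \<mu>))) * (urn_total n (wave ((1 / sqrt (ln (real n))) *\<^sub>R r)) \<omega> / (of_nat n + 1))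
         - of_real (exp (- (s \<bullet> s) / 2))) \<partial>M) =
       (\<integral>\<omega>. norm ((\<integral>x. cis (s \<bullet> x) \<partial>\<Lambda>cs n \<omega>) - of_real (exp (- (s \<bullet> s) / 2))) \<partial>M)) sequentially"
      using eventually_ge_at_top[of 2]
    proof eventually_elim
      case (elim n)
      show ?case
      proof (rule Bochner_Integration.integral_cong[OF refl])
        fix \<omega> assume \<omega>: "\<omega> \<in> space M"
        have "(\<integral>x. cis (s \<bullet> x) \<partial>\<Lambda>cs n \<omega>) = cis (- (sqrt (ln (real n)) * (r \<bullet> \<mu>))) * (urn_total n (wave ((1 / sqrt (ln (real n))) *\<^sub>R r)) \<omega> / (of_nat n + 1))"
          unfolding integral_\<Lambda>[OF elim \<omega> cis_m] wave_G[OF elim] urn_total_mult_left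
          by (simp add: scaleR_conv_of_real field_simps)
        then show "norm (cis (- (sqrt (ln (real n)) * (r \<bullet> \<mu>))) * (urn_total n (wave ((1 / sqrt (ln (real n))) *\<^sub>R r)) \<omega> / (of_nat n + 1))
         - of_real (exp (- (s \<bullet> s) / 2))) = norm ((\<integral>x. cis (s \<bullet> x) \<partial>\<Lambda>cs n \<omega>) - of_real (exp (- (s \<bullet> s) / 2)))"
          by (simp only:)
      qed
    qed
    show ?thesis
      using Lim_transform_eventually[OF wave_total_limit[of r, folded \<mu>, unfolded var] ev] .
  qed
  \<comment> \<open>For \<open>n < 2\<close> the scaling factor is 0 and the rescaled object is not a probability measure, hence the shift by 2.\<close>
  interpret shifted: random_measures_gaussian_limit M "\<lambda>n. \<Lambda>cs (n + 2)" "\<lambda>n \<omega>. G (n + 2) (Z (n + 2) \<omega>)"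
  proof (intro random_measures_gaussian_limit.intro random_measures_gaussian_limit_axioms.intro prob_space_axioms)
    fix n and f :: "real^'d \<Rightarrow> real" assume f: "f \<in> borel_measurable borel"
    show "(\<lambda>\<omega>. \<integral>x. f x \<partial>\<Lambda>cs (n + 2) \<omega>) \<in> borel_measurable M"
      by (subst measurable_cong[OF integral_\<Lambda>[OF _ _ f]]) auto
    have "(\<integral>\<omega>. (\<integral>x. f x \<partial>\<Lambda>cs (n + 2) \<omega>) \<partial>M) =
        (\<integral>\<omega>. urn_total (n + 2) (\<lambda>v. f (G (n + 2) v)) \<omega> / (real (n + 2) + 1) \<partial>M)"
      by (intro Bochner_Integration.integral_cong refl)
         (subst integral_\<Lambda>[OF _ _ f]; simp add: divide_inverse mult.commute)
    also have "\<dots> = (\<integral>\<omega>. f (G (n + 2) (Z (n + 2) \<omega>)) \<partial>M)"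
      by (rule integral_of_Z_real[symmetric])
    finally show "(\<integral>\<omega>. (\<integral>x. f x \<partial>\<Lambda>cs (n + 2) \<omega>) \<partial>M) = (\<integral>\<omega>. f (G (n + 2) (Z (n + 2) \<omega>)) \<partial>M)" .
  next
    fix s
    show "(\<lambda>n. \<integral>\<omega>. norm ((\<integral>x. cis (s \<bullet> x) \<partial>\<Lambda>cs (n + 2) \<omega>) - of_real (exp (- (s \<bullet> s) / 2))) \<partial>M) \<longlonglongrightarrow> 0"
      by (rule LIMSEQ_ignore_initial_segment[OF char_lim])
  qed (auto simp: prob_\<Lambda>)
  show ?thesis
  proof (rule tendsto_in_prob_weak_topologyI)
    show "prob_space M" by (rule prob_space_axioms)
    show "std_gaussian \<in> borel_prob_measures"
      by (simp add: borel_prob_measures_def prob_space_std_gaussian)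
    show "eventually (\<lambda>n. \<Lambda>cs n \<in> measurable M (borel_of weak_topology)) sequentially"
      using eventually_ge_at_top[of 2]
    proof eventually_elim
      case (elim n)
      show ?case
      proof (rule measurable_of_trajectory[where n = n])
        fix \<omega> \<omega>' assume "\<omega> \<in> space M" "\<omega>' \<in> space M" "\<And>k. k < n \<Longrightarrow> Z k \<omega> = Z k \<omega>'"
        from urn_measure_trajectory[OF this] show "\<Lambda>cs n \<omega> = \<Lambda>cs n \<omega>'"
          by (simp add: \<Lambda>cs_def)
      next
        fix \<omega> assume "\<omega> \<in> space M"
        then have "\<Lambda>cs n \<omega> \<in> borel_prob_measures"
          using prob_\<Lambda>[OF elim] by (simp add: borel_prob_measures_def)
        also have "borel_prob_measures = space (borel_of (weak_topology :: (real^'d) measure topology))"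
          unfolding borel_of_def
          by (subst space_measure_of) (use openin_subset in \<open>auto simp: topspace_weak_topology[symmetric]\<close>)
        finally show "\<Lambda>cs n \<omega> \<in> space (borel_of weak_topology)" .
      qed
    qed
    fix f :: "real^'d \<Rightarrow> real" assume "continuous_on UNIV f" "bounded (range f)"
    from shifted.bounded_continuous_converges[OF this]
    show "(\<lambda>n. \<integral>\<omega>. \<bar>(\<integral>x. f x \<partial>\<Lambda>cs n \<omega>) - (\<integral>x. f x \<partial>std_gaussian)\<bar> \<partial>M) \<longlonglongrightarrow> 0"
      by (rule LIMSEQ_offset)
  qed
qed

end
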